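(* Let $n\ge 2$ and let $Z_1 \subset \mathbb{A}^{n-2}\subset \mathbb{A}^n$ be a closed variety such that $n\geq \max(2\dim Z_1+1, \dim TZ_1)+1$. Then for any closed subvariety $Z_2\subset \mathbb{A}^n$ isomorphic to $Z_1$, there exists a surjective morphism $f: \mathbb{A}^n \to \mathbb{A}^n \setminus Z_2$.
   Context: All varieties are over an algebraically closed field $\mathbb{K}$ of characteristic zero, and $\mathbb{A}^n$ denotes affine $n$-space over $\mathbb{K}$. The inclusion $\mathbb{A}^{n-2}\subset\mathbb{A}^n$ is that of a linear coordinate subspace, $\mathbb{A}^{n-2}=\{(0,0)\}\times\mathbb{A}^{n-2}\subset\mathbb{A}^2\times\mathbb{A}^{n-2}=\mathbb{A}^n$. For an affine variety $Z$, $TZ$ denotes its total Zariski tangent space (the union of the Zariski tangent spaces $T_zZ$ over $z\in Z$, i.e. the closed points of $\operatorname{Spec}\operatorname{Sym}\Omega_{Z/\mathbb{K}}$), and $\dim TZ$ is its dimension as an algebraic variety. Here $Z_2$ isomorphic to $Z_1$ means isomorphic as algebraic varieties. *)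

theory Defs
  imports
    "HOL-Analysis.Abstract_Topology"
    "HOL-Library.Poly_Mapping"
    "HOL-Library.Extended_Nat"
    "HOL-Computational_Algebra.Polynomial"
begin

section \<open>Polynomials in finitely many variables\<close>

text \<open>Polynomials are finitely supported maps from monomials (finitely supported exponent
  vectors \<open>nat \<Rightarrow>\<^sub>0 nat\<close>) to coefficients; the ring structure is that of \<^type>\<open>poly_mapping\<close>.\<close>

type_synonym 'k mpol = "(nat \<Rightarrow>\<^sub>0 nat) \<Rightarrow>\<^sub>0 'k"

definition mpols :: "nat \<Rightarrow> 'k::comm_ring_1 mpol set" where
  "mpols n = {p. \<forall>m \<in> Poly_Mapping.keys p. Poly_Mapping.keys m \<subseteq> {..<n}}"

definition mon_eval :: "(nat \<Rightarrow>\<^sub>0 nat) \<Rightarrow> (nat \<Rightarrow> 'k::comm_ring_1) \<Rightarrow> 'k" where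
  "mon_eval m x = (\<Prod>i \<in> Poly_Mapping.keys m. x i ^ Poly_Mapping.lookup m i)"

definition mp_eval :: "'k::comm_ring_1 mpol \<Rightarrow> (nat \<Rightarrow> 'k) \<Rightarrow> 'k" where
  "mp_eval p x = (\<Sum>m \<in> Poly_Mapping.keys p. Poly_Mapping.lookup p m * mon_eval m x)"

text \<open>The formal partial derivative. If the variable \<open>i\<close> does not occur in the monomial \<open>m\<close>, the
  corresponding summand has coefficient \<open>0\<close>, so the truncated subtraction is harmless.\<close>

definition mp_deriv :: "nat \<Rightarrow> 'k::comm_ring_1 mpol \<Rightarrow> 'k mpol" where
  "mp_deriv i p = (\<Sum>m \<in> Poly_Mapping.keys p.
     Poly_Mapping.single (m - Poly_Mapping.single i 1)
       (of_nat (Poly_Mapping.lookup m i) * Poly_Mapping.lookup p m))"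

section \<open>Affine space and the Zariski topology\<close>

text \<open>The points of affine \<open>n\<close>-space are the \<open>n\<close>-tuples \<open>(x 0, \<dots>, x (n - 1))\<close>, represented
  as functions on \<^typ>\<open>nat\<close> that vanish from \<open>n\<close> on.\<close>

definition affine_space :: "nat \<Rightarrow> (nat \<Rightarrow> 'k::zero) set" where
  "affine_space n = {x. \<forall>i\<ge>n. x i = 0}"

text \<open>The subspace \<open>{(0,0)} \<times> A\<^sup>n\<^sup>-\<^sup>2\<close> of \<open>A\<^sup>2 \<times> A\<^sup>n\<^sup>-\<^sup>2 = A\<^sup>n\<close>, for \<open>n \<ge> 2\<close>.\<close>

definition codim2_subspace :: "nat \<Rightarrow> (nat \<Rightarrow> 'k::zero) set" where
  "codim2_subspace n = {x \<in> affine_space n. x 0 = 0 \<and> x 1 = 0}"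

definition zero_locus :: "nat \<Rightarrow> 'k::comm_ring_1 mpol set \<Rightarrow> (nat \<Rightarrow> 'k) set" where
  "zero_locus n S = {x \<in> affine_space n. \<forall>p\<in>S. mp_eval p x = 0}"

definition zariski :: "nat \<Rightarrow> (nat \<Rightarrow> 'k::idom) topology" where
  "zariski n = topology (\<lambda>U. \<exists>S \<subseteq> mpols n. U = affine_space n - zero_locus n S)"

lemma mp_eval_superset:
  assumes "finite A" "Poly_Mapping.keys p \<subseteq> A"
  shows "mp_eval p x = (\<Sum>m\<in>A. Poly_Mapping.lookup p m * mon_eval m x)"
  unfolding mp_eval_def using assms
  by (intro sum.mono_neutral_left) (auto simp: in_keys_iff)

lemma mp_eval_0 [simp]: "mp_eval 0 x = 0"
  by (simp add: mp_eval_def)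

lemma mp_eval_single: "mp_eval (Poly_Mapping.single m c) x = c * mon_eval m x"
  by (simp add: mp_eval_def)

lemma mp_eval_1 [simp]: "mp_eval 1 x = 1"
  by (simp add: mp_eval_single mon_eval_def flip: single_one)

lemma mp_eval_add: "mp_eval (p + q) x = mp_eval p x + mp_eval q x"
proof -
  let ?A = "Poly_Mapping.keys p \<union> Poly_Mapping.keys q"
  have "Poly_Mapping.keys (p + q) \<subseteq> ?A" by (rule Poly_Mapping.keys_add)
  then show ?thesis
    by (simp add: mp_eval_superset[where A = ?A] lookup_add distrib_right sum.distrib)
qed

lemma mon_eval_add: "mon_eval (m + m') x = mon_eval m x * mon_eval m' x"
proof -
  let ?A = "Poly_Mapping.keys m \<union> Poly_Mapping.keys m'"
  have *: "mon_eval k x = (\<Prod>i\<in>?A. x i ^ Poly_Mapping.lookup k i)"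
    if "Poly_Mapping.keys k \<subseteq> ?A" for k
    unfolding mon_eval_def using that
    by (intro prod.mono_neutral_left) (auto simp: in_keys_iff)
  show ?thesis
    by (simp add: * Poly_Mapping.keys_add lookup_add power_add prod.distrib)
qed

lemma mpol_induct [case_names zero add]:
  fixes p :: "'k::comm_ring_1 mpol"
  assumes "P 0" and "\<And>p m c. P p \<Longrightarrow> P (Poly_Mapping.single m c + p)"
  shows "P p"
proof (induction p rule: update_induct)
  case const
  show ?case by (rule assms(1))
next
  case (update f a b)
  then have "Poly_Mapping.update a b f = Poly_Mapping.single a b + f"
    by (intro poly_mapping_eqI)
      (auto simp: lookup_update lookup_add lookup_single when_def in_keys_iff)
  then show ?case using assms(2) update by simp
qed

lemma mp_eval_mult: "mp_eval (p * q) x = mp_eval p x * mp_eval q x"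
proof (induction p rule: mpol_induct)
  case (add p m c)
  have "mp_eval (Poly_Mapping.single m c * q) x = c * mon_eval m x * mp_eval q x"
    by (induction q rule: mpol_induct)
      (simp_all add: mult_single distrib_left mp_eval_add mp_eval_single mon_eval_add mult_ac)
  with add show ?case
    by (simp add: distrib_right mp_eval_add mp_eval_single)
qed simp

lemma mpols_mult: "p \<in> mpols n \<Longrightarrow> q \<in> mpols n \<Longrightarrow> p * q \<in> mpols n"
  unfolding mpols_def mem_Collect_eq
proof
  fix m
  assume p: "\<forall>m\<in>Poly_Mapping.keys p. Poly_Mapping.keys m \<subseteq> {..<n}"
    and q: "\<forall>m\<in>Poly_Mapping.keys q. Poly_Mapping.keys m \<subseteq> {..<n}"
    and "m \<in> Poly_Mapping.keys (p * q)"
  then obtain a b where "m = a + b" "a \<in> Poly_Mapping.keys p" "b \<in> Poly_Mapping.keys q"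
    using keys_mult[of p q] by blast
  with p q show "Poly_Mapping.keys m \<subseteq> {..<n}"
    using Poly_Mapping.keys_add[of a b] by (meson Un_least order_trans)
qed

lemma istopology_zariski:
  "istopology (\<lambda>U :: (nat \<Rightarrow> 'k::idom) set. \<exists>S \<subseteq> mpols n. U = affine_space n - zero_locus n S)"
  unfolding istopology_def
proof (intro conjI allI impI)
  fix U V :: "(nat \<Rightarrow> 'k) set"
  assume "\<exists>S \<subseteq> mpols n. U = affine_space n - zero_locus n S"
    and "\<exists>S \<subseteq> mpols n. V = affine_space n - zero_locus n S"
  then obtain S T where S: "S \<subseteq> mpols n" "U = affine_space n - zero_locus n S"
    and T: "T \<subseteq> mpols n" "V = affine_space n - zero_locus n T" by blast
  let ?R = "{p * q | p q. p \<in> S \<and> q \<in> T}"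
  have "?R \<subseteq> mpols n" using S T mpols_mult by blast
  moreover have "U \<inter> V = affine_space n - zero_locus n ?R"
  proof -
    have "(\<forall>r\<in>?R. mp_eval r x = 0) \<longleftrightarrow>
        (\<forall>p\<in>S. mp_eval p x = 0) \<or> (\<forall>q\<in>T. mp_eval q x = 0)" for x
    proof (intro iffI)
      assume L: "\<forall>r\<in>?R. mp_eval r x = 0"
      have "mp_eval p x * mp_eval q x = 0" if "p \<in> S" "q \<in> T" for p q
      proof -
        have "p * q \<in> ?R" using that by blast
        with L have "mp_eval (p * q) x = 0" by (rule bspec)
        then show ?thesis by (simp only: mp_eval_mult)
      qed
      then show "(\<forall>p\<in>S. mp_eval p x = 0) \<or> (\<forall>q\<in>T. mp_eval q x = 0)"
        unfolding mult_eq_0_iff by blast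
    next
      assume "(\<forall>p\<in>S. mp_eval p x = 0) \<or> (\<forall>q\<in>T. mp_eval q x = 0)"
      then show "\<forall>r\<in>?R. mp_eval r x = 0"
        by (elim disjE) (auto simp: mp_eval_mult)
    qed
    then have "zero_locus n ?R = zero_locus n S \<union> zero_locus n T"
      unfolding zero_locus_def by blast
    then show ?thesis unfolding S(2) T(2) by blast
  qed
  ultimately show "\<exists>S \<subseteq> mpols n. U \<inter> V = affine_space n - zero_locus n S" by blast
next
  fix K :: "(nat \<Rightarrow> 'k) set set"
  assume "\<forall>U\<in>K. \<exists>S \<subseteq> mpols n. U = affine_space n - zero_locus n S"
  from bchoice[OF this] obtain S where
    S: "\<forall>U\<in>K. S U \<subseteq> mpols n \<and> U = affine_space n - zero_locus n (S U)" ..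
  have eq: "U = affine_space n - zero_locus n (S U)" if "U \<in> K" for U
    by (rule conjunct2[OF bspec[OF S that]])
  have "(\<Union>U\<in>K. U) = (\<Union>U\<in>K. affine_space n - zero_locus n (S U))"
    by (rule SUP_cong[OF refl eq])
  also have "\<dots> = affine_space n - zero_locus n (\<Union>U\<in>K. S U)"
    unfolding zero_locus_def by blast
  finally have "\<Union>K = affine_space n - zero_locus n (\<Union>U\<in>K. S U)" by simp
  moreover have "(\<Union>U\<in>K. S U) \<subseteq> mpols n"
    by (rule UN_least) (rule conjunct1[OF bspec[OF S]])
  ultimately show "\<exists>S \<subseteq> mpols n. \<Union>K = affine_space n - zero_locus n S"
    by (intro exI conjI)
qed

lemma openin_zariski:
  "openin (zariski n) U \<longleftrightarrow> (\<exists>S \<subseteq> mpols n. U = affine_space n - zero_locus n S)"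
  by (simp add: zariski_def topology_inverse'[OF istopology_zariski])

lemma topspace_zariski [simp]: "topspace (zariski n) = affine_space n"
proof (rule antisym)
  show "topspace (zariski n) \<subseteq> affine_space n"
    by (auto simp: topspace_def openin_zariski)
  have "openin (zariski n) (affine_space n :: (nat \<Rightarrow> 'a) set)"
    unfolding openin_zariski
    by (rule exI[of _ "{1}"]) (auto simp: mpols_def zero_locus_def)
  then show "affine_space n \<subseteq> topspace (zariski n :: (nat \<Rightarrow> 'a) topology)"
    by (rule openin_subset)
qed

lemma closedin_zariski:
  "closedin (zariski n) Z \<longleftrightarrow> (\<exists>S \<subseteq> mpols n. Z = zero_locus n S)"
proof -
  have sub: "zero_locus n S \<subseteq> affine_space n" for S :: "'a mpol set"
    by (auto simp: zero_locus_def)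
  have "Z \<subseteq> affine_space n \<and> affine_space n - Z = affine_space n - zero_locus n S
      \<longleftrightarrow> Z = zero_locus n S" for S
    using sub[of S] by blast
  then show ?thesis
    unfolding closedin_def openin_zariski topspace_zariski by blast
qed

section \<open>Dimension\<close>

definition irreducible_space :: "'a topology \<Rightarrow> bool" where
  "irreducible_space X \<longleftrightarrow> topspace X \<noteq> {} \<and>
     (\<forall>A B. closedin X A \<and> closedin X B \<and> A \<union> B = topspace X
        \<longrightarrow> A = topspace X \<or> B = topspace X)"

text \<open>The supremum of the lengths \<open>d\<close> of chains \<open>C 0 \<subset> \<dots> \<subset> C d\<close> of irreducible closed subsets.
  The empty space gets dimension \<open>0\<close> here, since \<^typ>\<open>enat\<close> has no negative elements.\<close>

definition krull_dim :: "'a topology \<Rightarrow> enat" where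
  "krull_dim X = Sup {enat d | d. \<exists>C :: nat \<Rightarrow> 'a set.
     (\<forall>i\<le>d. closedin X (C i) \<and> irreducible_space (subtopology X (C i))) \<and>
     (\<forall>i<d. C i \<subset> C (Suc i))}"

definition variety_dim :: "nat \<Rightarrow> (nat \<Rightarrow> 'k::idom) set \<Rightarrow> enat" where
  "variety_dim n X = krull_dim (subtopology (zariski n) X)"

section \<open>The total Zariski tangent space\<close>

definition vanishing_ideal :: "nat \<Rightarrow> (nat \<Rightarrow> 'k::comm_ring_1) set \<Rightarrow> 'k mpol set" where
  "vanishing_ideal n Z = {p \<in> mpols n. \<forall>x\<in>Z. mp_eval p x = 0}"

definition tangent_space :: "nat \<Rightarrow> (nat \<Rightarrow> 'k::comm_ring_1) set \<Rightarrow> (nat \<Rightarrow> 'k) \<Rightarrow> (nat \<Rightarrow> 'k) set" where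
  "tangent_space n Z z = {v \<in> affine_space n.
     \<forall>p \<in> vanishing_ideal n Z. (\<Sum>i<n. mp_eval (mp_deriv i p) z * v i) = 0}"

text \<open>The identification \<open>A\<^sup>n \<times> A\<^sup>n = A\<^sup>2\<^sup>n\<close>.\<close>

definition join :: "nat \<Rightarrow> (nat \<Rightarrow> 'k) \<Rightarrow> (nat \<Rightarrow> 'k) \<Rightarrow> nat \<Rightarrow> 'k" where
  "join n z v = (\<lambda>i. if i < n then z i else v (i - n))"

text \<open>Since \<open>\<Omega>\<close> of the coordinate ring of \<open>Z\<close> is generated by \<open>dx\<^sub>0, \<dots>, dx\<^sub>n\<^sub>-\<^sub>1\<close> with the
  relations \<open>dp = 0\<close> for \<open>p\<close> in the ideal of \<open>Z\<close>, the closed points of \<open>Spec Sym \<Omega>\<close> form the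
  following subset of \<open>A\<^sup>2\<^sup>n\<close>, which is closed if \<open>Z\<close> is.\<close>

definition total_tangent_space :: "nat \<Rightarrow> (nat \<Rightarrow> 'k::comm_ring_1) set \<Rightarrow> (nat \<Rightarrow> 'k) set" where
  "total_tangent_space n Z = {join n z v | z v. z \<in> Z \<and> v \<in> tangent_space n Z z}"

section \<open>Morphisms\<close>

text \<open>\<open>X\<close> is meant to be a locally closed subset of affine \<open>n\<close>-space; a regular function on \<open>X\<close>
  is one that is locally a quotient of polynomials.\<close>

definition regular_on :: "nat \<Rightarrow> (nat \<Rightarrow> 'k::field) set \<Rightarrow> ((nat \<Rightarrow> 'k) \<Rightarrow> 'k) \<Rightarrow> bool" where
  "regular_on n X f \<longleftrightarrow> (\<forall>x\<in>X. \<exists>U. openin (subtopology (zariski n) X) U \<and> x \<in> U \<and>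
     (\<exists>p \<in> mpols n. \<exists>q \<in> mpols n.
        \<forall>y\<in>U. mp_eval q y \<noteq> 0 \<and> f y = mp_eval p y / mp_eval q y))"

text \<open>A morphism from \<open>X \<subseteq> A\<^sup>n\<close> to \<open>Y \<subseteq> A\<^sup>m\<close> is a map with regular coordinate functions; only
  the values on \<open>X\<close> matter.\<close>

definition morphism ::
  "nat \<Rightarrow> (nat \<Rightarrow> 'k::field) set \<Rightarrow> nat \<Rightarrow> (nat \<Rightarrow> 'k) set \<Rightarrow> ((nat \<Rightarrow> 'k) \<Rightarrow> (nat \<Rightarrow> 'k)) \<Rightarrow> bool" where
  "morphism n X m Y f \<longleftrightarrow> f ` X \<subseteq> Y \<and> (\<forall>i<m. regular_on n X (\<lambda>x. f x i))"

definition isomorphic_varieties ::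
  "nat \<Rightarrow> (nat \<Rightarrow> 'k::field) set \<Rightarrow> nat \<Rightarrow> (nat \<Rightarrow> 'k) set \<Rightarrow> bool" where
  "isomorphic_varieties n X m Y \<longleftrightarrow> (\<exists>f g. morphism n X m Y f \<and> morphism m Y n X g \<and>
     (\<forall>x\<in>X. g (f x) = x) \<and> (\<forall>y\<in>Y. f (g y) = y))"

end

theory Submission
  imports Defs "HOL-Library.Function_Algebras"
begin

text \<open>For a closed set \<open>Z\<close> in \<open>{x\<^sub>0 = x\<^sub>1 = 0}\<close> with equations \<open>p\<^sub>1, \<dots>, p\<^sub>r\<close> in the
  other coordinates \<open>z\<close>, the map
  \<open>(a, b, z) \<mapsto> (1 + a b, a + \<Sum>j. p\<^sub>j(z) a\<^sup>j\<^sup>+\<^sup>1 + (1 + a b) a\<^sup>r\<^sup>+\<^sup>2, z)\<close> is a surjection of affine space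
  onto the complement of \<open>Z\<close>: on the curve \<open>1 + a b = 0\<close>, where \<open>a\<close> is a unit, the second entry
  omits \<open>0\<close> exactly if all \<open>p\<^sub>j(z)\<close> vanish, and all other values are found by solving one equation
  for \<open>a\<close>. It remains to extend the isomorphism of \<open>Z\<^sub>1\<close> with \<open>Z\<^sub>2\<close> to an automorphism of affine
  space. This is the argument of Kaliman and Srinivas: after generic linear changes of coordinates the
  two embeddings \<open>f\<close> and \<open>g\<close> of \<open>Z\<^sub>1\<close> are such that \<open>(f\<^sub>1, \<dots>, f\<^sub>i, g\<^sub>i\<^sub>+\<^sub>2, \<dots>, g\<^sub>n)\<close> is a closed
  embedding into affine \<open>(n - 1)\<close>-space for every \<open>i\<close>, so the coordinates can be exchanged one by one
  with shears. Genericity is a matter of counting parameters. For this, the dimension of a set is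
  measured by the growth of the spaces of polynomial functions of degree at most \<open>s\<close> on it, and the
  Krull dimension is compared with this growth by Noether normalization.\<close>

section \<open>Algebras of polynomial functions\<close>

text \<open>The bound on \<open>n\<close> is spent on tuples with \<open>n - 1\<close> entries. Such
  a tuple must separate the points of \<open>Z1\<close>, a condition on pairs of points, which form
  a set of dimension 2 dim \<open>Z1\<close>; it must kill no nonzero tangent vector, a condition on
  the total tangent space; and the projection that it defines must be finite. The first needs 2 dim
  \<open>Z1\<close> < \<open>n - 1\<close>. The second needs only that the total tangent space has
  dimension at most \<open>n - 1\<close>, because the set of nonzero tangent vectors is stable under
  scaling. For the third, dim \<open>Z1\<close> generic combinations of one embedding are enough,
  and a mixed tuple always contains that many entries from one of the two embeddings. Counting
  parameters is done by linear algebra instead of a theory of fibre dimensions: on the set of bad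
  pairs (point, coefficients) all coefficients are rational functions on a space of smaller growth,
  so they satisfy a nontrivial polynomial relation, and its nonvanishing is the generic condition.
  Only upper bounds on growth occur, so growth has to be compared with the Krull dimension in one
  direction only.\<close>

lemma sum_fun_apply: "(\<Sum>i\<in>A. f i) x = (\<Sum>i\<in>A. f i x)"
  for f :: "'i \<Rightarrow> 'a \<Rightarrow> 'k::comm_monoid_add"
  by (induction A rule: infinite_finite_induct) auto

lemma power_fun_apply: "(f ^ n) x = f x ^ n" for f :: "'a \<Rightarrow> 'k::comm_semiring_1"
  by (induction n) auto

text \<open>Polynomials are handled as functions, which loses nothing over an infinite field. The
  generators are functions on an arbitrary type, so one notion serves for coordinate rings,
  pull-backs and products.\<close>

inductive_set subalg :: "('a \<Rightarrow> 'k::comm_ring_1) set \<Rightarrow> ('a \<Rightarrow> 'k) set" for \<Phi> where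
  subalg_const: "(\<lambda>_. c) \<in> subalg \<Phi>"
| subalg_base: "\<phi> \<in> \<Phi> \<Longrightarrow> \<phi> \<in> subalg \<Phi>"
| subalg_add: "f \<in> subalg \<Phi> \<Longrightarrow> g \<in> subalg \<Phi> \<Longrightarrow> (\<lambda>x. f x + g x) \<in> subalg \<Phi>"
| subalg_mult: "f \<in> subalg \<Phi> \<Longrightarrow> g \<in> subalg \<Phi> \<Longrightarrow> (\<lambda>x. f x * g x) \<in> subalg \<Phi>"

lemma subalg_uminus: "f \<in> subalg \<Phi> \<Longrightarrow> (\<lambda>x. - f x) \<in> subalg \<Phi>"
  using subalg_mult[OF subalg_const[of "-1"], of f] by simp

lemma subalg_diff: "f \<in> subalg \<Phi> \<Longrightarrow> g \<in> subalg \<Phi> \<Longrightarrow> (\<lambda>x. f x - g x) \<in> subalg \<Phi>"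
  using subalg_add[OF _ subalg_uminus, of f \<Phi> g] by simp

lemma subalg_sum: "(\<And>i. i \<in> A \<Longrightarrow> f i \<in> subalg \<Phi>) \<Longrightarrow> (\<lambda>x. \<Sum>i\<in>A. f i x) \<in> subalg \<Phi>"
  by (induction A rule: infinite_finite_induct) (auto intro: subalg_const subalg_add)

lemma subalg_prod: "(\<And>i. i \<in> A \<Longrightarrow> f i \<in> subalg \<Phi>) \<Longrightarrow> (\<lambda>x. \<Prod>i\<in>A. f i x) \<in> subalg \<Phi>"
  by (induction A rule: infinite_finite_induct) (auto intro: subalg_const subalg_mult)

lemma subalg_power: "f \<in> subalg \<Phi> \<Longrightarrow> (\<lambda>x. f x ^ n) \<in> subalg \<Phi>"
  by (induction n) (auto intro: subalg_const subalg_mult)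

lemmas subalg_intros = subalg_const subalg_add subalg_mult subalg_uminus subalg_diff
  subalg_sum subalg_prod subalg_power

lemma subalg_fun_intros:
  "0 \<in> subalg \<Phi>" "1 \<in> subalg \<Phi>"
  "f \<in> subalg \<Phi> \<Longrightarrow> g \<in> subalg \<Phi> \<Longrightarrow> f + g \<in> subalg \<Phi>"
  "f \<in> subalg \<Phi> \<Longrightarrow> g \<in> subalg \<Phi> \<Longrightarrow> f - g \<in> subalg \<Phi>"
  "f \<in> subalg \<Phi> \<Longrightarrow> g \<in> subalg \<Phi> \<Longrightarrow> f * g \<in> subalg \<Phi>"
  "f \<in> subalg \<Phi> \<Longrightarrow> - f \<in> subalg \<Phi>"
  by (auto simp: zero_fun_def one_fun_def plus_fun_def times_fun_def fun_diff_def fun_Compl_def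
      intro: subalg_intros)

lemma subalg_fun_sum: "(\<And>i. i \<in> A \<Longrightarrow> f i \<in> subalg \<Phi>) \<Longrightarrow> (\<Sum>i\<in>A. f i) \<in> subalg \<Phi>"
  by (induction A rule: infinite_finite_induct) (auto intro: subalg_fun_intros)

lemma subalg_subst:
  assumes "f \<in> subalg \<Phi>" "\<And>\<phi>. \<phi> \<in> \<Phi> \<Longrightarrow> (\<lambda>x. \<phi> (h x)) \<in> subalg \<Psi>"
  shows "(\<lambda>x. f (h x)) \<in> subalg \<Psi>"
  using assms(1) by induction (auto intro: subalg_intros assms(2))

lemma subalg_trans: "f \<in> subalg \<Phi> \<Longrightarrow> \<Phi> \<subseteq> subalg \<Psi> \<Longrightarrow> f \<in> subalg \<Psi>"
  using subalg_subst[of f \<Phi> "\<lambda>x. x" \<Psi>] by auto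

lemma subalg_mono: "f \<in> subalg \<Phi> \<Longrightarrow> \<Phi> \<subseteq> \<Psi> \<Longrightarrow> f \<in> subalg \<Psi>"
  by (auto intro: subalg_trans subalg_base)

section \<open>Coordinate functions and polynomial substitution\<close>

definition coords :: "'i set \<Rightarrow> (('i \<Rightarrow> 'k) \<Rightarrow> 'k) set" where
  "coords I = (\<lambda>i x. x i) ` I"

lemma coord_in_coords [intro]: "i \<in> I \<Longrightarrow> (\<lambda>x. x i) \<in> coords I"
  by (auto simp: coords_def)

lemma subalg_coord [intro]: "i \<in> I \<Longrightarrow> (\<lambda>x. x i) \<in> subalg (coords I)"
  by (rule subalg_base) auto

lemma coords_mono: "I \<subseteq> J \<Longrightarrow> coords I \<subseteq> coords J"
  by (auto simp: coords_def)

lemma subalg_coords_mono: "f \<in> subalg (coords I) \<Longrightarrow> I \<subseteq> J \<Longrightarrow> f \<in> subalg (coords J)"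
  by (rule subalg_mono[OF _ coords_mono])

lemma subalg_coords_subst:
  assumes "f \<in> subalg (coords I)" "\<And>i. i \<in> I \<Longrightarrow> (\<lambda>x. h x i) \<in> subalg \<Psi>"
  shows "(\<lambda>x. f (h x)) \<in> subalg \<Psi>"
  by (rule subalg_subst[OF assms(1)]) (auto simp: coords_def assms(2))

lemma subalg_coords_cong:
  assumes "f \<in> subalg (coords I)" "\<And>i. i \<in> I \<Longrightarrow> x i = y i"
  shows "f x = f y"
  using assms(1) by induction (auto simp: coords_def assms(2))

lemma subalg_image_coords:
  assumes "f \<in> subalg (h ` I)"
  obtains s where "s \<in> subalg (coords I)" "f = (\<lambda>x. s (\<lambda>i. h i x))"
proof -
  from assms have "\<exists>s\<in>subalg (coords I). f = (\<lambda>x. s (\<lambda>i. h i x))"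
  proof induction
    case (subalg_const c)
    then show ?case by (intro bexI[of _ "\<lambda>_. c"]) (auto intro: subalg_intros)
  next
    case (subalg_base \<phi>)
    then obtain i where "i \<in> I" "\<phi> = h i" by auto
    then show ?case by (intro bexI[of _ "\<lambda>x. x i"]) auto
  next
    case (subalg_add f g)
    then obtain s t where "s \<in> subalg (coords I)" "f = (\<lambda>x. s (\<lambda>i. h i x))"
      "t \<in> subalg (coords I)" "g = (\<lambda>x. t (\<lambda>i. h i x))" by blast
    then show ?case by (intro bexI[of _ "\<lambda>x. s x + t x"]) (auto intro: subalg_intros)
  next
    case (subalg_mult f g)
    then obtain s t where "s \<in> subalg (coords I)" "f = (\<lambda>x. s (\<lambda>i. h i x))"
      "t \<in> subalg (coords I)" "g = (\<lambda>x. t (\<lambda>i. h i x))" by blast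
    then show ?case by (intro bexI[of _ "\<lambda>x. s x * t x"]) (auto intro: subalg_intros)
  qed
  with that show ?thesis by blast
qed

lemma subalg_coords_curve:
  fixes f :: "('i \<Rightarrow> 'k::comm_ring_1) \<Rightarrow> 'k"
  assumes "f \<in> subalg (coords I)"
  obtains p where "\<And>t. f (\<lambda>i. poly (\<gamma> i) t) = poly p t"
proof -
  from assms have "\<exists>p. \<forall>t. f (\<lambda>i. poly (\<gamma> i) t) = poly p t"
  proof induction
    case (subalg_const c)
    then show ?case by (intro exI[of _ "[:c:]"]) auto
  next
    case (subalg_base \<phi>)
    then show ?case by (auto simp: coords_def)
  next
    case (subalg_add f g)
    then show ?case by (metis poly_add)
  next
    case (subalg_mult f g)
    then show ?case by (metis poly_mult)
  qed
  with that show ?thesis by blast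
qed

lemma subalg_coords_line:
  fixes f :: "('i \<Rightarrow> 'k::comm_ring_1) \<Rightarrow> 'k"
  assumes "f \<in> subalg (coords I)"
  obtains p where "\<And>t. f (\<lambda>i. a i + t * b i) = poly p t"
  by (rule subalg_coords_curve[OF assms, of "\<lambda>i. [:a i, b i:]"]) (use that in auto)

section \<open>Nonvanishing of polynomials and generic parameters\<close>

lemma poly_nonzero_at:
  fixes p :: "'k::field_char_0 poly"
  assumes "p \<noteq> 0"
  obtains t where "poly p t \<noteq> 0"
  using poly_all_0_iff_0[of p] assms by blast

lemma poly_eq_fun: "(\<And>t. poly p t = poly q t) \<Longrightarrow> p = q" for p :: "'k::field_char_0 poly"
  using poly_eq_poly_eq_iff by blast

text \<open>On the line through \<open>a\<close> and \<open>b\<close> both functions become nonzero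
  polynomials in one variable, and the product of these has a nonroot. This is the irreducibility of
  affine space, and the reason why generic conditions can be combined.\<close>

lemma subalg_coords_nonzero:
  fixes f g :: "('i \<Rightarrow> 'k::field_char_0) \<Rightarrow> 'k"
  assumes "f \<in> subalg (coords I)" "f a \<noteq> 0" "g \<in> subalg (coords J)" "g b \<noteq> 0"
  shows "\<exists>c. f c \<noteq> 0 \<and> g c \<noteq> 0"
proof -
  obtain p where p: "\<And>t. f (\<lambda>i. a i + t * (b i - a i)) = poly p t"
    using subalg_coords_line[OF assms(1), of a "\<lambda>i. b i - a i"] by blast
  obtain q where q: "\<And>t. g (\<lambda>i. a i + t * (b i - a i)) = poly q t"
    using subalg_coords_line[OF assms(3), of a "\<lambda>i. b i - a i"] by blast
  have "p \<noteq> 0" "q \<noteq> 0" using p[of 0] q[of 1] assms(2,4) by auto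
  then have "p * q \<noteq> 0" by simp
  then obtain t where "poly (p * q) t \<noteq> 0" by (rule poly_nonzero_at)
  then have "f (\<lambda>i. a i + t * (b i - a i)) \<noteq> 0 \<and> g (\<lambda>i. a i + t * (b i - a i)) \<noteq> 0"
    by (simp add: p q)
  then show ?thesis by blast
qed

text \<open>The condition holds on a nonempty principal open set of the parameter space. The index
  type is arbitrary, so that conditions on different coefficients can be imposed on one common
  array.\<close>

definition generic :: "(('i \<Rightarrow> 'k::field_char_0) \<Rightarrow> bool) \<Rightarrow> bool" where
  "generic P \<longleftrightarrow> (\<exists>Q\<in>subalg (coords UNIV). (\<exists>c. Q c \<noteq> 0) \<and> (\<forall>c. Q c \<noteq> 0 \<longrightarrow> P c))"

lemma genericI: "Q \<in> subalg (coords I) \<Longrightarrow> Q c \<noteq> 0 \<Longrightarrow> (\<And>c. Q c \<noteq> 0 \<Longrightarrow> P c) \<Longrightarrow> generic P"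
  unfolding generic_def by (blast intro: subalg_coords_mono)

lemma generic_ex: "generic P \<Longrightarrow> \<exists>c. P c"
  by (auto simp: generic_def)

lemma generic_mono: "generic P \<Longrightarrow> (\<And>c. P c \<Longrightarrow> Q c) \<Longrightarrow> generic Q"
  by (auto simp: generic_def)

lemma generic_True: "generic (\<lambda>_. True)"
  by (rule genericI[where Q = "\<lambda>_. 1" and I = UNIV]) (auto intro: subalg_const)

lemma generic_conj:
  assumes "generic P" "generic Q"
  shows "generic (\<lambda>c. P c \<and> Q c)"
proof -
  obtain p a where p: "p \<in> subalg (coords UNIV)" "p a \<noteq> 0" "\<And>c. p c \<noteq> 0 \<Longrightarrow> P c"
    using assms(1) by (auto simp: generic_def)
  obtain q b where q: "q \<in> subalg (coords UNIV)" "q b \<noteq> 0" "\<And>c. q c \<noteq> 0 \<Longrightarrow> Q c"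
    using assms(2) by (auto simp: generic_def)
  obtain c where "p c \<noteq> 0" "q c \<noteq> 0"
    using subalg_coords_nonzero[OF p(1,2) q(1,2)] by blast
  with p q show ?thesis
    unfolding generic_def
    by (intro bexI[of _ "\<lambda>x. p x * q x"] conjI exI[of _ c]) (auto intro: subalg_mult)
qed

lemma generic_Ball:
  assumes "finite A" "\<And>a. a \<in> A \<Longrightarrow> generic (P a)"
  shows "generic (\<lambda>c. \<forall>a\<in>A. P a c)"
  using assms by (induction A) (auto intro: generic_True generic_conj)

subsection \<open>Degrees\<close>

text \<open>This bounds the degree of some expression of the function in the generators. Expressions
  are not unique, so it is a filtration of \<open>subalg \<Phi>\<close> and not a degree
  function.\<close>

inductive deg_le :: "('a \<Rightarrow> 'k::comm_ring_1) set \<Rightarrow> nat \<Rightarrow> ('a \<Rightarrow> 'k) \<Rightarrow> bool" for \<Phi> where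
  deg_le_const: "deg_le \<Phi> s (\<lambda>_. c)"
| deg_le_add: "deg_le \<Phi> s f \<Longrightarrow> deg_le \<Phi> s g \<Longrightarrow> deg_le \<Phi> s (\<lambda>x. f x + g x)"
| deg_le_Suc: "\<phi> \<in> \<Phi> \<Longrightarrow> deg_le \<Phi> s f \<Longrightarrow> deg_le \<Phi> (Suc s) (\<lambda>x. \<phi> x * f x)"

lemma deg_le_mono: "deg_le \<Phi> s f \<Longrightarrow> s \<le> t \<Longrightarrow> deg_le \<Phi> t f"
proof (induction arbitrary: t rule: deg_le.induct)
  case (deg_le_Suc \<phi> s f)
  then show ?case by (cases t) (auto intro: deg_le.deg_le_Suc)
qed (auto intro: deg_le.intros)

lemma deg_le_base: "\<phi> \<in> \<Phi> \<Longrightarrow> deg_le \<Phi> (Suc 0) \<phi>"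
  using deg_le_Suc[of \<phi> \<Phi> 0 "\<lambda>_. 1"] by (simp add: deg_le_const)

lemma deg_le_scale: "deg_le \<Phi> s f \<Longrightarrow> deg_le \<Phi> s (\<lambda>x. c * f x)"
proof (induction rule: deg_le.induct)
  case (deg_le_Suc \<phi> s f)
  have "(\<lambda>x. c * (\<phi> x * f x)) = (\<lambda>x. \<phi> x * (c * f x))" by (simp add: mult_ac)
  with deg_le_Suc show ?case by (simp add: deg_le.deg_le_Suc)
qed (auto intro: deg_le.intros simp: distrib_left)

lemma deg_le_mult: "deg_le \<Phi> s f \<Longrightarrow> deg_le \<Phi> t g \<Longrightarrow> deg_le \<Phi> (s + t) (\<lambda>x. f x * g x)"
proof (induction rule: deg_le.induct)
  case (deg_le_const s c)
  then show ?case by (auto intro: deg_le_scale deg_le_mono)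
qed (auto intro: deg_le.intros simp: distrib_right mult.assoc)

lemma deg_le_power: "deg_le \<Phi> s f \<Longrightarrow> deg_le \<Phi> (n * s) (\<lambda>x. f x ^ n)"
  by (induction n) (auto intro: deg_le.intros deg_le_mult)

lemma deg_le_prod:
  "(\<And>i. i \<in> A \<Longrightarrow> deg_le \<Phi> (s i) (f i)) \<Longrightarrow> deg_le \<Phi> (\<Sum>i\<in>A. s i) (\<lambda>x. \<Prod>i\<in>A. f i x)"
  by (induction A rule: infinite_finite_induct) (auto intro: deg_le.intros deg_le_mult)

lemma deg_le_subst:
  assumes "deg_le \<Phi> s f" "\<And>\<phi>. \<phi> \<in> \<Phi> \<Longrightarrow> deg_le \<Psi> k (\<lambda>x. \<phi> (h x))"
  shows "deg_le \<Psi> (s * k) (\<lambda>x. f (h x))"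
  using assms(1)
proof induction
  case (deg_le_Suc \<phi> s f)
  then show ?case using deg_le_mult[OF assms(2) deg_le_Suc.IH] by simp
qed (auto intro: deg_le.intros)

lemma deg_le_imp_subalg: "deg_le \<Phi> s f \<Longrightarrow> f \<in> subalg \<Phi>"
  by (induction rule: deg_le.induct) (auto intro: subalg.intros)

lemma subalg_imp_deg_le: "f \<in> subalg \<Phi> \<Longrightarrow> \<exists>s. deg_le \<Phi> s f"
proof (induction rule: subalg.induct)
  case (subalg_add f g)
  then obtain s t where "deg_le \<Phi> s f" "deg_le \<Phi> t g" by auto
  then have "deg_le \<Phi> (max s t) f" "deg_le \<Phi> (max s t) g"
    by (auto intro: deg_le_mono)
  then show ?case by (auto intro: deg_le.intros)
qed (auto intro: deg_le.intros deg_le_base deg_le_mult)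

lemma subalg_common_degree:
  assumes "finite A" "\<And>a. a \<in> A \<Longrightarrow> f a \<in> subalg \<Phi>"
  obtains s where "\<And>a. a \<in> A \<Longrightarrow> deg_le \<Phi> s (f a)"
proof -
  have "\<forall>a\<in>A. \<exists>s. deg_le \<Phi> s (f a)" using assms subalg_imp_deg_le by blast
  then obtain s where "\<And>a. a \<in> A \<Longrightarrow> deg_le \<Phi> (s a) (f a)" by metis
  then have "\<And>a. a \<in> A \<Longrightarrow> deg_le \<Phi> (Max (s ` A)) (f a)"
    using assms(1) by (meson Max_ge deg_le_mono finite_imageI imageI)
  with that show ?thesis by blast
qed

subsection \<open>Polynomials as functions and Zariski closed sets\<close>

lemma mpols_add: "p \<in> mpols n \<Longrightarrow> q \<in> mpols n \<Longrightarrow> p + q \<in> mpols n"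
  unfolding mpols_def using Poly_Mapping.keys_add[of p q] by blast

lemma mpols_const: "Poly_Mapping.single 0 c \<in> mpols n"
  by (auto simp: mpols_def)

definition mvar :: "nat \<Rightarrow> 'k::comm_ring_1 mpol" where
  "mvar i = Poly_Mapping.single (Poly_Mapping.single i 1) 1"

lemma mpols_mvar: "i < n \<Longrightarrow> mvar i \<in> mpols n"
  by (auto simp: mpols_def mvar_def)

lemma mp_eval_const [simp]: "mp_eval (Poly_Mapping.single 0 c) x = c"
  by (simp add: mp_eval_single mon_eval_def)

lemma mp_eval_mvar [simp]: "mp_eval (mvar i) x = x i"
  by (simp add: mp_eval_single mon_eval_def mvar_def)

lemma subalg_imp_mpol: "f \<in> subalg (coords {..<n}) \<Longrightarrow> \<exists>p\<in>mpols n. f = mp_eval p"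
proof (induction rule: subalg.induct)
  case (subalg_const c)
  then show ?case by (intro bexI[OF _ mpols_const]) auto
next
  case (subalg_base \<phi>)
  then obtain i where "i < n" "\<phi> = (\<lambda>x. x i)" by (auto simp: coords_def)
  then show ?case by (intro bexI[OF _ mpols_mvar]) auto
next
  case (subalg_add f g)
  then obtain p q where "p \<in> mpols n" "f = mp_eval p" "q \<in> mpols n" "g = mp_eval q" by blast
  then show ?case by (intro bexI[of _ "p + q"] mpols_add) (auto simp: mp_eval_add)
next
  case (subalg_mult f g)
  then obtain p q where "p \<in> mpols n" "f = mp_eval p" "q \<in> mpols n" "g = mp_eval q" by blast
  then show ?case by (intro bexI[of _ "p * q"] mpols_mult) (auto simp: mp_eval_mult)
qed

lemma mpol_imp_subalg: "p \<in> mpols n \<Longrightarrow> mp_eval p \<in> subalg (coords {..<n})"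
  unfolding mp_eval_def[abs_def] mon_eval_def mpols_def
  by (intro subalg_intros subalg_coord) auto

lemma closedin_zariski_iff:
  "closedin (zariski n) Z \<longleftrightarrow>
    (\<exists>S\<subseteq>subalg (coords {..<n}). Z = {x \<in> affine_space n. \<forall>f\<in>S. f x = 0})"
proof
  assume "closedin (zariski n) Z"
  then obtain S where "S \<subseteq> mpols n" "Z = zero_locus n S" by (auto simp: closedin_zariski)
  then show "\<exists>S\<subseteq>subalg (coords {..<n}). Z = {x \<in> affine_space n. \<forall>f\<in>S. f x = 0}"
    by (intro exI[of _ "mp_eval ` S"]) (auto simp: zero_locus_def intro: mpol_imp_subalg)
next
  assume "\<exists>S\<subseteq>subalg (coords {..<n}). Z = {x \<in> affine_space n. \<forall>f\<in>S. f x = 0}"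
  then obtain S where S: "S \<subseteq> subalg (coords {..<n})" "Z = {x \<in> affine_space n. \<forall>f\<in>S. f x = 0}"
    by blast
  obtain T where T: "T \<subseteq> mpols n" "S = mp_eval ` T"
  proof
    show "S = mp_eval ` {p \<in> mpols n. mp_eval p \<in> S}"
      using subalg_imp_mpol[of _ n] S(1) by (auto simp: image_iff)
  qed auto
  then have "Z = zero_locus n T"
    unfolding S(2) zero_locus_def by simp
  then show "closedin (zariski n) Z" using T(1) unfolding closedin_zariski by blast
qed

lemma closedin_zariskiI:
  "S \<subseteq> subalg (coords {..<n}) \<Longrightarrow> closedin (zariski n) {x \<in> affine_space n. \<forall>f\<in>S. f x = 0}"
  by (auto simp: closedin_zariski_iff)

lemma closed_sub_affine: "closedin (zariski n) Z \<Longrightarrow> Z \<subseteq> affine_space n"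
  by (auto simp: closedin_zariski_iff)

definition vanish :: "nat \<Rightarrow> (nat \<Rightarrow> 'k::comm_ring_1) set \<Rightarrow> ((nat \<Rightarrow> 'k) \<Rightarrow> 'k) set" where
  "vanish n Z = {f \<in> subalg (coords {..<n}). \<forall>x\<in>Z. f x = 0}"

lemma closed_vanish:
  assumes "closedin (zariski n) Z"
  shows "Z = {x \<in> affine_space n. \<forall>f\<in>vanish n Z. f x = 0}"
  using assms unfolding closedin_zariski_iff vanish_def by fast

lemma closed_memI:
  "closedin (zariski n) Z \<Longrightarrow> x \<in> affine_space n \<Longrightarrow> (\<And>f. f \<in> vanish n Z \<Longrightarrow> f x = 0) \<Longrightarrow> x \<in> Z"
  using closed_vanish[of n Z] by blast

lemma closedin_zariski_vimage:
  assumes "closedin (zariski m) W" "\<And>i. i < m \<Longrightarrow> (\<lambda>x. h x i) \<in> subalg (coords {..<n})"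
    "\<And>x. x \<in> affine_space n \<Longrightarrow> h x \<in> affine_space m"
  shows "closedin (zariski n) {x \<in> affine_space n. h x \<in> W}"
proof -
  obtain S where S: "S \<subseteq> subalg (coords {..<m})" "W = {x \<in> affine_space m. \<forall>f\<in>S. f x = 0}"
    using assms(1) by (auto simp: closedin_zariski_iff)
  have "{x \<in> affine_space n. h x \<in> W} = {x \<in> affine_space n. \<forall>g\<in>(\<lambda>f x. f (h x)) ` S. g x = 0}"
    using assms(3) unfolding S(2) by auto
  also have "closedin (zariski n) \<dots>"
  proof (intro closedin_zariskiI image_subsetI)
    fix f assume "f \<in> S"
    then have "f \<in> subalg (coords {..<m})" using S(1) by blast
    then show "(\<lambda>x. f (h x)) \<in> subalg (coords {..<n})"
      by (rule subalg_coords_subst) (use assms(2) in simp)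
  qed
  finally show ?thesis .
qed

section \<open>Growth of the spaces of polynomial functions\<close>

interpretation fvs: vector_space "\<lambda>(c::'k::field) (f::'a \<Rightarrow> 'k) x. c * f x"
  by standard (auto simp: fun_eq_iff algebra_simps)

text \<open>Asking for agreement on \<open>X\<close> only replaces the passage to the quotient by
  the functions that vanish on \<open>X\<close>.\<close>

definition span_on :: "'a set \<Rightarrow> ('a \<Rightarrow> 'k::field) set \<Rightarrow> ('a \<Rightarrow> 'k) set" where
  "span_on X B = {f. \<exists>g\<in>fvs.span B. \<forall>x\<in>X. f x = g x}"

lemma subspace_span_on: "fvs.subspace (span_on X B)"
proof (rule fvs.subspaceI)
  show "0 \<in> span_on X B" unfolding span_on_def mem_Collect_eq by (rule bexI[OF _ fvs.span_zero]) simp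
next
  fix f g assume "f \<in> span_on X B" "g \<in> span_on X B"
  then obtain f' g' where "f' \<in> fvs.span B" "\<And>x. x \<in> X \<Longrightarrow> f x = f' x"
    "g' \<in> fvs.span B" "\<And>x. x \<in> X \<Longrightarrow> g x = g' x" by (auto simp: span_on_def)
  then show "f + g \<in> span_on X B"
    unfolding span_on_def mem_Collect_eq by (intro bexI[OF _ fvs.span_add[of f' B g']]) simp_all
next
  fix c f assume "f \<in> span_on X B"
  then obtain f' where "f' \<in> fvs.span B" "\<And>x. x \<in> X \<Longrightarrow> f x = f' x" by (auto simp: span_on_def)
  then show "(\<lambda>x. c * f x) \<in> span_on X B"
    unfolding span_on_def mem_Collect_eq by (intro bexI[OF _ fvs.span_scale[of f' B c]]) simp_all
qed

text \<open>An upper bound for the Hilbert function: the restrictions to \<open>X\<close> of the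
  functions of degree at most \<open>s\<close> span a space whose dimension grows at most like the
  power \<open>d\<close> of \<open>s\<close>. The base is \<open>s + 1\<close> so that degree 0 is
  covered.\<close>

definition hdim_le :: "'a set \<Rightarrow> ('a \<Rightarrow> 'k::field) set \<Rightarrow> nat \<Rightarrow> bool" where
  "hdim_le X \<Phi> d \<longleftrightarrow> (\<exists>C. \<forall>s. \<exists>B. finite B \<and> card B \<le> C * (s + 1) ^ d \<and>
     (\<forall>f. deg_le \<Phi> s f \<longrightarrow> f \<in> span_on X B))"

lemma hdim_leD:
  assumes "hdim_le X \<Phi> d"
  shows "\<exists>C B. \<forall>s. finite (B s) \<and> card (B s) \<le> C * (s + 1) ^ d \<and>
     (\<forall>f. deg_le \<Phi> s f \<longrightarrow> f \<in> span_on X (B s))"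
proof -
  obtain C where C: "\<forall>s. \<exists>B. finite B \<and> card B \<le> C * (s + 1) ^ d \<and>
     (\<forall>f. deg_le \<Phi> s f \<longrightarrow> f \<in> span_on X B)"
    using assms unfolding hdim_le_def by (elim exE)
  show ?thesis by (rule exI[of _ C], rule choice[OF C])
qed

lemma span_on_subset: "f \<in> span_on X B \<Longrightarrow> Y \<subseteq> X \<Longrightarrow> f \<in> span_on Y B"
  by (auto simp: span_on_def)

lemma hdim_le_subset:
  assumes "hdim_le X \<Phi> d" "Y \<subseteq> X"
  shows "hdim_le Y \<Phi> d"
proof -
  obtain C where C: "\<forall>s. \<exists>B. finite B \<and> card B \<le> C * (s + 1) ^ d \<and>
     (\<forall>f. deg_le \<Phi> s f \<longrightarrow> f \<in> span_on X B)"
    using assms(1) unfolding hdim_le_def by (elim exE)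
  show ?thesis unfolding hdim_le_def
  proof (intro exI[of _ C] allI)
    fix s
    from C obtain B where "finite B" "card B \<le> C * (s + 1) ^ d"
      "\<forall>f. deg_le \<Phi> s f \<longrightarrow> f \<in> span_on X B" by (elim allE[of _ s] exE conjE)
    then show "\<exists>B. finite B \<and> card B \<le> C * (s + 1) ^ d \<and>
        (\<forall>f. deg_le \<Phi> s f \<longrightarrow> f \<in> span_on Y B)"
      using span_on_subset[OF _ assms(2)] by (intro exI[of _ B]) auto
  qed
qed

lemma span_comp:
  assumes "g \<in> fvs.span B"
  shows "(\<lambda>y. g (\<sigma> y)) \<in> fvs.span ((\<lambda>b y. b (\<sigma> y)) ` B)"
  using assms
proof (induction rule: fvs.span_induct_alt)
  case base
  then show ?case using fvs.span_zero by (simp add: zero_fun_def)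
next
  case (step c b g)
  have "(\<lambda>y. b (\<sigma> y)) \<in> fvs.span ((\<lambda>b y. b (\<sigma> y)) ` B)"
    using step(1) by (auto intro: fvs.span_base)
  from fvs.span_add[OF fvs.span_scale[OF this, of c] step(2)]
  show ?case by (simp add: plus_fun_def)
qed

text \<open>Pulling back along \<open>h\<close> multiplies degrees by at most \<open>k\<close>, and
  \<open>s * k + 1\<close> is at most \<open>(k + 1) * (s + 1)\<close>, so only the constant
  changes.\<close>

lemma hdim_le_image:
  assumes "hdim_le X \<Phi> d" "\<And>\<psi>. \<psi> \<in> \<Psi> \<Longrightarrow> deg_le \<Phi> k (\<lambda>x. \<psi> (h x))" "Y \<subseteq> h ` X"
  shows "hdim_le Y \<Psi> d"
proof -
  obtain C B where "\<forall>s. finite (B s) \<and> card (B s) \<le> C * (s + 1) ^ d \<and>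
      (\<forall>f. deg_le \<Phi> s f \<longrightarrow> f \<in> span_on X (B s))"
    using hdim_leD[OF assms(1)] by (elim exE)
  then have B: "finite (B s)" "card (B s) \<le> C * (s + 1) ^ d"
    "deg_le \<Phi> s f \<Longrightarrow> f \<in> span_on X (B s)" for s f by blast+
  \<comment> \<open>A section of \<open>h\<close> over \<open>Y\<close> carries a spanning family on
    \<open>X\<close> to one on \<open>Y\<close>.\<close>
  define \<sigma> where "\<sigma> = inv_into X h"
  have \<sigma>: "\<sigma> y \<in> X" "h (\<sigma> y) = y" if "y \<in> Y" for y
    using that assms(3) by (auto simp: \<sigma>_def inv_into_into f_inv_into_f subset_iff)
  have "\<exists>A. finite A \<and> card A \<le> (C * (k + 1) ^ d) * (s + 1) ^ d \<and>
     (\<forall>f. deg_le \<Psi> s f \<longrightarrow> f \<in> span_on Y A)" for s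
  proof (intro exI conjI allI impI)
    show "finite ((\<lambda>b y. b (\<sigma> y)) ` B (s * k))" using B(1) by simp
    have "card ((\<lambda>b y. b (\<sigma> y)) ` B (s * k)) \<le> C * (s * k + 1) ^ d"
      using card_image_le[OF B(1)] B(2) order_trans by blast
    also have "\<dots> \<le> C * ((k + 1) * (s + 1)) ^ d"
      by (intro mult_left_mono power_mono) (auto simp: algebra_simps)
    finally show "card ((\<lambda>b y. b (\<sigma> y)) ` B (s * k)) \<le> (C * (k + 1) ^ d) * (s + 1) ^ d"
      by (simp only: power_mult_distrib mult.assoc)
    fix f assume "deg_le \<Psi> s f"
    then have "deg_le \<Phi> (s * k) (\<lambda>x. f (h x))" using deg_le_subst assms(2) by blast
    then obtain g where g: "g \<in> fvs.span (B (s * k))" "\<And>x. x \<in> X \<Longrightarrow> f (h x) = g x"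
      using B(3) unfolding span_on_def by blast
    then show "f \<in> span_on Y ((\<lambda>b y. b (\<sigma> y)) ` B (s * k))"
      unfolding span_on_def using \<sigma> by (auto intro!: bexI[OF _ span_comp[OF g(1)]]) metis
  qed
  then show ?thesis unfolding hdim_le_def by (intro exI[of _ "C * (k + 1) ^ d"] allI)
qed

definition tensor :: "('a \<Rightarrow> 'k::field) set \<Rightarrow> ('b \<Rightarrow> 'k) set \<Rightarrow> ('a \<times> 'b \<Rightarrow> 'k) set" where
  "tensor \<Phi> \<Psi> = (\<lambda>\<phi> p. \<phi> (fst p)) ` \<Phi> \<union> (\<lambda>\<psi> p. \<psi> (snd p)) ` \<Psi>"

lemma subalg_tensor_fst: "f \<in> subalg \<Phi> \<Longrightarrow> (\<lambda>p. f (fst p)) \<in> subalg (tensor \<Phi> \<Psi>)"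
  by (rule subalg_subst) (auto simp: tensor_def intro: subalg_base)

lemma subalg_tensor_snd: "f \<in> subalg \<Psi> \<Longrightarrow> (\<lambda>p. f (snd p)) \<in> subalg (tensor \<Phi> \<Psi>)"
  by (rule subalg_subst) (auto simp: tensor_def intro: subalg_base)

lemma span_tensor:
  assumes "f \<in> fvs.span B" "g \<in> fvs.span B'"
  shows "(\<lambda>p. f (fst p) * g (snd p)) \<in> fvs.span ((\<lambda>(b, b') p. b (fst p) * b' (snd p)) ` (B \<times> B'))"
    (is "_ \<in> fvs.span ?T")
  using assms(1)
proof (induction rule: fvs.span_induct_alt)
  case base
  then show ?case using fvs.span_zero by (simp add: zero_fun_def)
next
  case (step c b f)
  have "(\<lambda>p. b (fst p) * g (snd p)) \<in> fvs.span ?T"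
    using assms(2)
  proof (induction rule: fvs.span_induct_alt)
    case base
    then show ?case using fvs.span_zero by (simp add: zero_fun_def)
  next
    case (step c' b' g)
    have "(\<lambda>p. b (fst p) * b' (snd p)) \<in> fvs.span ?T"
      using \<open>b \<in> B\<close> step(1) by (auto intro: fvs.span_base)
    from fvs.span_add[OF fvs.span_scale[OF this, of c'] step(2)]
    show ?case by (simp add: plus_fun_def algebra_simps)
  qed
  from fvs.span_add[OF fvs.span_scale[OF this, of c] step(2)]
  show ?case by (simp add: plus_fun_def algebra_simps)
qed

lemma deg_le_tensor:
  assumes "deg_le (tensor \<Phi> \<Psi>) s f"
  shows "f \<in> fvs.span {\<lambda>p. u (fst p) * v (snd p) | u v. deg_le \<Phi> s u \<and> deg_le \<Psi> s v}"
    (is "_ \<in> fvs.span (?T s)")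
  using assms
proof induction
  case (deg_le_const s c)
  have "(\<lambda>p. (\<lambda>_. c) (fst p) * (\<lambda>_. 1) (snd p)) \<in> ?T s"
    by (intro CollectI exI conjI) (rule refl deg_le.deg_le_const)+
  from fvs.span_base[OF this] show ?case by simp
next
  case (deg_le_add s f g)
  then show ?case using fvs.span_add[of f "?T s" g] by (simp add: plus_fun_def)
next
  case (deg_le_Suc \<phi> s f)
  have *: "(\<lambda>p. \<phi> p * b p) \<in> ?T (Suc s)" if "b \<in> ?T s" for b
  proof -
    from that obtain u v where uv: "b = (\<lambda>p. u (fst p) * v (snd p))" "deg_le \<Phi> s u" "deg_le \<Psi> s v"
      by blast
    from \<open>\<phi> \<in> tensor \<Phi> \<Psi>\<close> consider \<phi>' where "\<phi>' \<in> \<Phi>" "\<phi> = (\<lambda>p. \<phi>' (fst p))"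
      | \<psi>' where "\<psi>' \<in> \<Psi>" "\<phi> = (\<lambda>p. \<psi>' (snd p))" by (auto simp: tensor_def)
    then show ?thesis
    proof cases
      case 1
      then show ?thesis using uv
        by (auto simp: mult_ac intro!: exI[of _ "\<lambda>x. \<phi>' x * u x"] exI[of _ v]
          intro: deg_le.deg_le_Suc deg_le_mono[of _ s])
    next
      case 2
      then show ?thesis using uv
        by (auto simp: mult_ac intro!: exI[of _ u] exI[of _ "\<lambda>x. \<psi>' x * v x"]
          intro: deg_le.deg_le_Suc deg_le_mono[of _ s])
    qed
  qed
  from deg_le_Suc.IH show ?case
  proof (induction rule: fvs.span_induct_alt)
    case base
    then show ?case using fvs.span_zero by (simp add: zero_fun_def)
  next
    case (step c b f)
    from fvs.span_add[OF fvs.span_scale[OF fvs.span_base[OF *[OF step(1)]], of c] step(2)]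
    show ?case by (simp add: plus_fun_def algebra_simps)
  qed
qed

text \<open>Products of spanning functions of the two factors span, so the cardinalities multiply
  and the exponents add.\<close>

lemma hdim_le_Times:
  assumes "hdim_le X \<Phi> d" "hdim_le Y \<Psi> e"
  shows "hdim_le (X \<times> Y) (tensor \<Phi> \<Psi>) (d + e)"
proof -
  obtain C B where "\<forall>s. finite (B s) \<and> card (B s) \<le> C * (s + 1) ^ d \<and>
      (\<forall>f. deg_le \<Phi> s f \<longrightarrow> f \<in> span_on X (B s))"
    using hdim_leD[OF assms(1)] by (elim exE)
  then have B: "finite (B s)" "card (B s) \<le> C * (s + 1) ^ d"
    "deg_le \<Phi> s f \<Longrightarrow> f \<in> span_on X (B s)" for s f by blast+
  obtain C' B' where "\<forall>s. finite (B' s) \<and> card (B' s) \<le> C' * (s + 1) ^ e \<and>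
      (\<forall>f. deg_le \<Psi> s f \<longrightarrow> f \<in> span_on Y (B' s))"
    using hdim_leD[OF assms(2)] by (elim exE)
  then have B': "finite (B' s)" "card (B' s) \<le> C' * (s + 1) ^ e"
    "deg_le \<Psi> s f \<Longrightarrow> f \<in> span_on Y (B' s)" for s f by blast+
  let ?T = "\<lambda>s. (\<lambda>(b, b') p. b (fst p) * b' (snd p)) ` (B s \<times> B' s)"
  have "finite (?T s) \<and> card (?T s) \<le> (C * C') * (s + 1) ^ (d + e) \<and>
      (\<forall>f. deg_le (tensor \<Phi> \<Psi>) s f \<longrightarrow> f \<in> span_on (X \<times> Y) (?T s))" for s
  proof (intro conjI allI impI)
    show "finite (?T s)" using B(1) B'(1) by simp
    have "card (?T s) \<le> card (B s) * card (B' s)"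
      using card_image_le[OF finite_cartesian_product[OF B(1)[of s] B'(1)[of s]]]
      by (simp only: card_cartesian_product)
    also have "\<dots> \<le> (C * (s + 1) ^ d) * (C' * (s + 1) ^ e)"
      by (rule mult_mono[OF B(2) B'(2)]) auto
    finally show "card (?T s) \<le> (C * C') * (s + 1) ^ (d + e)"
      by (simp only: power_add mult_ac)
    fix f assume "deg_le (tensor \<Phi> \<Psi>) s f"
    then have "f \<in> fvs.span {\<lambda>p. u (fst p) * v (snd p) | u v. deg_le \<Phi> s u \<and> deg_le \<Psi> s v}"
      by (rule deg_le_tensor)
    also have "\<dots> \<subseteq> span_on (X \<times> Y) (?T s)"
    proof (rule fvs.span_minimal[OF _ subspace_span_on], clarify)
      fix u v assume "deg_le \<Phi> s u" "deg_le \<Psi> s v"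
      then obtain u' v' where uv: "u' \<in> fvs.span (B s)" "\<forall>x\<in>X. u x = u' x"
        "v' \<in> fvs.span (B' s)" "\<forall>x\<in>Y. v x = v' x"
        using B(3)[of s u] B'(3)[of s v] unfolding span_on_def by blast
      then show "(\<lambda>p. u (fst p) * v (snd p)) \<in> span_on (X \<times> Y) (?T s)"
        unfolding span_on_def by (auto intro!: bexI[OF _ span_tensor[OF uv(1,3)]])
    qed
    finally show "f \<in> span_on (X \<times> Y) (?T s)" .
  qed
  then show ?thesis unfolding hdim_le_def by (intro exI allI)
qed

text \<open>Monomials are counted by the box of exponents at most \<open>s\<close> instead of the
  simplex; this gives \<open>(s + 1) ^ card K\<close> without binomial coefficients.\<close>

lemma hdim_le_coords:
  assumes "finite K"
  shows "hdim_le X (coords K :: (('i \<Rightarrow> 'k::field) \<Rightarrow> 'k) set) (card K)"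
proof -
  let ?m = "\<lambda>e (x :: 'i \<Rightarrow> 'k). \<Prod>i\<in>K. x i ^ e i"
  let ?M = "\<lambda>s::nat. ?m ` (K \<rightarrow>\<^sub>E {..s})"
  have span: "f \<in> fvs.span (?M s)" if "deg_le (coords K) s f" for s f
    using that
  proof induction
    case (deg_le_const s c)
    have "?m (\<lambda>i\<in>K. 0) \<in> ?M s" by (intro imageI) auto
    from fvs.span_scale[OF fvs.span_base[OF this], of c] show ?case by simp
  next
    case (deg_le_add s f g)
    then show ?case using fvs.span_add[of f "?M s" g] by (simp add: plus_fun_def)
  next
    case (deg_le_Suc \<phi> s f)
    obtain i where i: "i \<in> K" "\<phi> = (\<lambda>x. x i)" using deg_le_Suc(1) by (auto simp: coords_def)
    have *: "(\<lambda>x. \<phi> x * b x) \<in> ?M (Suc s)" if "b \<in> ?M s" for b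
    proof -
      from that obtain e where e: "e \<in> K \<rightarrow>\<^sub>E {..s}" "b = ?m e" by blast
      have "(\<lambda>x. \<phi> x * b x) = ?m (e(i := Suc (e i)))"
        using i assms by (auto simp: e(2) fun_eq_iff prod.remove[OF assms i(1)] intro!: prod.cong)
      moreover have "e(i := Suc (e i)) \<in> K \<rightarrow>\<^sub>E {..Suc s}"
        using e(1) i(1) by (fastforce simp: PiE_def Pi_def extensional_def)
      ultimately show ?thesis by blast
    qed
    from deg_le_Suc.IH show ?case
    proof (induction rule: fvs.span_induct_alt)
      case base
      then show ?case using fvs.span_zero by (simp add: zero_fun_def)
    next
      case (step c b f)
      from fvs.span_add[OF fvs.span_scale[OF fvs.span_base[OF *[OF step(1)]], of c] step(2)]
      show ?case by (simp add: plus_fun_def algebra_simps)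
    qed
  qed
  have "finite (?M s)" "card (?M s) \<le> 1 * (s + 1) ^ card K" for s
  proof -
    have fin: "finite (K \<rightarrow>\<^sub>E {..s})" using assms by (simp add: finite_PiE)
    then show "finite (?M s)" by simp
    show "card (?M s) \<le> 1 * (s + 1) ^ card K"
      using card_image_le[OF fin, of ?m] assms by (simp add: card_PiE)
  qed
  moreover have "f \<in> span_on X (?M s)" if "deg_le (coords K) s f" for s f
    using span[OF that] by (auto simp: span_on_def)
  ultimately show ?thesis unfolding hdim_le_def by (intro exI allI conjI impI)
qed

subsection \<open>Algebraic dependence\<close>

lemma span_family_dependent:
  fixes g :: "'e \<Rightarrow> 'a \<Rightarrow> 'k::field"
  assumes "finite E" "finite B" "card B < card E" "g ` E \<subseteq> fvs.span B"
  obtains a where "\<exists>e\<in>E. a e \<noteq> 0" "\<And>x. (\<Sum>e\<in>E. a e * g e x) = 0"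
proof (cases "inj_on g E")
  case True
  have "fvs.dependent (g ` E)"
    using fvs.independent_span_bound[of B "g ` E"] assms card_image[OF True] by auto
  then obtain u where u: "\<exists>v\<in>g ` E. u v \<noteq> 0" "(\<Sum>v\<in>g ` E. (\<lambda>x. u v * v x)) = 0"
    using fvs.dependent_finite[of "g ` E"] assms(1) by auto
  have "(\<Sum>e\<in>E. u (g e) * g e x) = 0" for x
  proof -
    have "(\<Sum>v\<in>g ` E. (\<lambda>x. u v * v x)) x = 0" using u(2) by simp
    then show ?thesis by (simp add: sum_fun_apply sum.reindex[OF True])
  qed
  with that[of "u \<circ> g"] u(1) show ?thesis by auto
next
  case False
  \<comment> \<open>Dependence of the image set says nothing about a repeated member; there the
    relation is the difference of the two equal members.\<close>
  then obtain e e' where e: "e \<in> E" "e' \<in> E" "e \<noteq> e'" "g e = g e'" by (auto simp: inj_on_def)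
  have "(\<Sum>f\<in>E. (if f = e then 1 else if f = e' then -1 else 0) * g f x) = 0" for x
  proof -
    have "(\<Sum>f\<in>E. (if f = e then 1 else if f = e' then -1 else 0) * g f x) =
      (\<Sum>f\<in>E. (if f = e then g e x else 0) - (if f = e' then g e' x else 0))"
      using e by (intro sum.cong) auto
    also have "\<dots> = 0" using e assms(1) by (simp add: sum_subtractf)
    finally show ?thesis .
  qed
  with that[of "\<lambda>f. if f = e then 1 else if f = e' then -1 else 0"] e(1) show ?thesis
    by (metis one_neq_zero)
qed

text \<open>By induction on the variables: at a point \<open>y\<close> where the coefficient of one
  power of the new variable does not vanish, the sum is a nonzero polynomial in that
  variable.\<close>

lemma monomials_independent:
  fixes a :: "('i \<Rightarrow> nat) \<Rightarrow> 'k::field_char_0"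
  assumes "finite I" "e \<in> I \<rightarrow>\<^sub>E {..s}" "a e \<noteq> 0"
  shows "\<exists>y. (\<Sum>e\<in>I \<rightarrow>\<^sub>E {..s}. a e * (\<Prod>i\<in>I. y i ^ e i)) \<noteq> 0"
  using assms
proof (induction I arbitrary: a e rule: finite_induct)
  case empty
  then show ?case by auto
next
  case (insert j I)
  let ?P = "I \<rightarrow>\<^sub>E {..s}"
  have upd: "e = (restrict e I)(j := e j)" "restrict e I \<in> ?P" "e j \<le> s"
    using insert.prems(1) by (auto simp: PiE_def extensional_def restrict_def fun_eq_iff)
  obtain y where y: "(\<Sum>f\<in>?P. a (f(j := e j)) * (\<Prod>i\<in>I. y i ^ f i)) \<noteq> 0"
    using insert.IH[of "restrict e I" "\<lambda>f. a (f(j := e j))", folded upd(1)] upd(2) insert.prems(2)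
    by blast
  define p where "p = (\<Sum>t\<le>s. monom (\<Sum>f\<in>?P. a (f(j := t)) * (\<Prod>i\<in>I. y i ^ f i)) t)"
  have "coeff p (e j) \<noteq> 0" using y upd(3) by (simp add: p_def coeff_sum)
  then have "p \<noteq> 0" by auto
  then obtain t where t: "poly p t \<noteq> 0" by (rule poly_nonzero_at)
  have inj: "inj_on (\<lambda>(t, f). f(j := t)) ({..s} \<times> ?P)"
    using insert.hyps(2) by (rule inj_combinator)
  have "(\<Sum>e\<in>insert j I \<rightarrow>\<^sub>E {..s}. a e * (\<Prod>i\<in>insert j I. (y(j := t)) i ^ e i)) =
      (\<Sum>(u, f)\<in>{..s} \<times> ?P. a (f(j := u)) * (\<Prod>i\<in>insert j I. (y(j := t)) i ^ (f(j := u)) i))"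
    unfolding PiE_insert_eq by (subst sum.reindex[OF inj]) (auto intro!: sum.cong)
  also have "\<dots> = (\<Sum>(u, f)\<in>{..s} \<times> ?P. a (f(j := u)) * (t ^ u * (\<Prod>i\<in>I. y i ^ f i)))"
  proof (intro sum.cong refl, clarify)
    fix u f
    have "(\<Prod>i\<in>I. (y(j := t)) i ^ (f(j := u)) i) = (\<Prod>i\<in>I. y i ^ f i)"
      using insert.hyps(2) by (intro prod.cong) auto
    then show "a (f(j := u)) * (\<Prod>i\<in>insert j I. (y(j := t)) i ^ (f(j := u)) i) =
      a (f(j := u)) * (t ^ u * (\<Prod>i\<in>I. y i ^ f i))"
      using insert.hyps by simp
  qed
  also have "\<dots> = (\<Sum>u\<le>s. \<Sum>f\<in>?P. a (f(j := u)) * (t ^ u * (\<Prod>i\<in>I. y i ^ f i)))"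
    by (simp add: sum.cartesian_product)
  also have "\<dots> = poly p t"
    by (simp add: p_def poly_sum poly_monom sum_distrib_left mult_ac)
  finally show ?case using t by metis
qed

lemma algebraic_dependence:
  fixes N :: "'i \<Rightarrow> 'a \<Rightarrow> 'k::field_char_0"
  assumes "hdim_le X \<Phi> D" "finite I" "D < card I"
    "\<And>i. i \<in> I \<Longrightarrow> N i \<in> subalg \<Phi>" "u \<in> subalg \<Phi>"
  shows "\<exists>Q c. Q \<in> subalg (coords I) \<and> Q c \<noteq> 0 \<and>
    (\<forall>x\<in>X. u x \<noteq> 0 \<longrightarrow> Q (\<lambda>i. N i x / u x) = 0)"
proof -
  obtain C B where "\<forall>s. finite (B s) \<and> card (B s) \<le> C * (s + 1) ^ D \<and>
      (\<forall>f. deg_le \<Phi> s f \<longrightarrow> f \<in> span_on X (B s))"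
    using hdim_leD[OF assms(1)] by (elim exE)
  then have B: "finite (B s)" "card (B s) \<le> C * (s + 1) ^ D"
    "deg_le \<Phi> s f \<Longrightarrow> f \<in> span_on X (B s)" for s f by blast+
  obtain \<delta> where \<delta>: "deg_le \<Phi> \<delta> u" "\<And>i. i \<in> I \<Longrightarrow> deg_le \<Phi> \<delta> (N i)"
  proof -
    obtain s where "\<And>f. f \<in> insert u (N ` I) \<Longrightarrow> deg_le \<Phi> s f"
      using subalg_common_degree[of "insert u (N ` I)" "\<lambda>f. f" \<Phi>] assms by auto
    with that show ?thesis by blast
  qed
  define M where "M = card I"
  \<comment> \<open>With this \<open>s\<close> the spanning set has at most
    \<open>C * (S + 1) ^ D \<le> s * (s + 1) ^ D\<close> elements, fewer than
    \<open>(s + 1) ^ Suc D\<close>.\<close>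
  define s where "s = C * (M * \<delta> + 1) ^ D"
  define E where "E = I \<rightarrow>\<^sub>E {..s}"
  define S where "S = M * (s * \<delta>)"
  \<comment> \<open>The monomial \<open>e\<close> in the fractions, times
    \<open>u ^ (M * s)\<close>; every factor has degree at most \<open>s * \<delta>\<close>,
    whatever its exponent.\<close>
  define w where "w e x = (\<Prod>i\<in>I. N i x ^ e i * u x ^ (s - e i))" for e x
  have finE: "finite E" and cardE: "card E = (s + 1) ^ M"
    using assms(2) by (simp_all add: E_def M_def finite_PiE card_PiE)
  have "card (B S) \<le> C * (S + 1) ^ D" by (rule B)
  also have "S + 1 \<le> (M * \<delta> + 1) * (s + 1)" by (simp add: S_def algebra_simps)
  then have "C * (S + 1) ^ D \<le> C * ((M * \<delta> + 1) * (s + 1)) ^ D"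
    by (intro mult_left_mono power_mono) auto
  also have "\<dots> = s * (s + 1) ^ D" by (simp only: s_def power_mult_distrib mult.assoc)
  also have "\<dots> < (s + 1) * (s + 1) ^ D" by (intro mult_strict_right_mono) auto
  also have "\<dots> = (s + 1) ^ Suc D" by simp
  also have "\<dots> \<le> (s + 1) ^ M" using assms(3) by (intro power_increasing) (auto simp: M_def)
  finally have card: "card (B S) < card E" by (simp only: cardE)
  have "w e \<in> span_on X (B S)" if "e \<in> E" for e
  proof (rule B(3))
    have "deg_le \<Phi> (\<Sum>i\<in>I. e i * \<delta> + (s - e i) * \<delta>) (w e)"
      unfolding w_def[abs_def] by (intro deg_le_prod deg_le_mult deg_le_power \<delta>)
    also have "(\<Sum>i\<in>I. e i * \<delta> + (s - e i) * \<delta>) = (\<Sum>i\<in>I. s * \<delta>)"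
    proof (intro sum.cong refl)
      fix i assume "i \<in> I"
      then have "e i \<le> s" using that by (auto simp: E_def PiE_def Pi_def)
      then show "e i * \<delta> + (s - e i) * \<delta> = s * \<delta>" by (simp flip: add_mult_distrib)
    qed
    also have "\<dots> = S" by (simp add: S_def M_def)
    finally show "deg_le \<Phi> S (w e)" .
  qed
  then have "\<forall>e\<in>E. \<exists>g. g \<in> fvs.span (B S) \<and> (\<forall>x\<in>X. w e x = g x)"
    unfolding span_on_def by blast
  from bchoice[OF this] obtain g where
    g: "\<forall>e\<in>E. g e \<in> fvs.span (B S) \<and> (\<forall>x\<in>X. w e x = g e x)" by blast
  then have "g ` E \<subseteq> fvs.span (B S)" by blast
  from span_family_dependent[OF finE B(1) card this] obtain a where
    a: "\<exists>e\<in>E. a e \<noteq> 0" "\<And>x. (\<Sum>e\<in>E. a e * g e x) = 0" by blast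
  define Q where "Q y = (\<Sum>e\<in>E. a e * (\<Prod>i\<in>I. y i ^ e i))" for y
  show ?thesis
  proof -
    have "Q \<in> subalg (coords I)"
      unfolding Q_def[abs_def] by (intro subalg_intros subalg_coord)
    moreover obtain y where "Q y \<noteq> 0"
      using a(1) monomials_independent[OF assms(2), of _ s a] unfolding Q_def E_def by blast
    moreover have "Q (\<lambda>i. N i x / u x) = 0" if x: "x \<in> X" "u x \<noteq> 0" for x
    proof -
      have "(\<Prod>i\<in>I. (N i x / u x) ^ e i) * u x ^ (M * s) = w e x" if "e \<in> E" for e
      proof -
        have "(\<Prod>i\<in>I. (N i x / u x) ^ e i) * u x ^ (M * s) =
            (\<Prod>i\<in>I. (N i x / u x) ^ e i * u x ^ s)"
          by (simp add: prod.distrib M_def power_mult mult.commute flip: power_mult)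
        also have "\<dots> = w e x" unfolding w_def
        proof (intro prod.cong refl)
          fix i assume "i \<in> I"
          then have "e i \<le> s" using that by (auto simp: E_def PiE_def Pi_def)
          then have "u x ^ s = u x ^ e i * u x ^ (s - e i)" by (simp flip: power_add)
          then show "(N i x / u x) ^ e i * u x ^ s = N i x ^ e i * u x ^ (s - e i)"
            using x(2) by (simp add: power_divide)
        qed
        finally show ?thesis .
      qed
      then have "Q (\<lambda>i. N i x / u x) * u x ^ (M * s) = (\<Sum>e\<in>E. a e * w e x)"
        by (simp add: Q_def sum_distrib_right mult.assoc)
      also have "\<dots> = (\<Sum>e\<in>E. a e * g e x)" using g x(1) by (intro sum.cong) auto
      also have "\<dots> = 0" by (rule a)
      finally show ?thesis using x(2) by simp
    qed
    ultimately show ?thesis by blast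
  qed
qed

section \<open>Generic linear combinations\<close>

text \<open>If all the sums vanish at a point \<open>x\<close>, row \<open>r\<close> can be solved
  for its pivot coefficient \<open>c (r, \<kappa> r)\<close>. So all coefficients are rational
  functions on the product of \<open>X\<close> with the space of the remaining ones, whose growth
  \<open>D + card K\<close> is less than their number because \<open>D < card R\<close>. The
  relation \<open>Q\<close> between them excludes the bad \<open>c\<close>.\<close>

lemma generic_avoid_pivot:
  fixes H :: "'r \<Rightarrow> 'j \<Rightarrow> 'a \<Rightarrow> 'k::field_char_0"
  assumes "hdim_le X \<Phi> D" "finite R" "finite J" "D < card R"
    and H: "\<And>r j. r \<in> R \<Longrightarrow> j \<in> J \<Longrightarrow> H r j \<in> subalg \<Phi>"
    and \<kappa>: "\<And>r. r \<in> R \<Longrightarrow> \<kappa> r \<in> J"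
  shows "generic (\<lambda>c. \<forall>x\<in>X. (\<forall>r\<in>R. H r (\<kappa> r) x \<noteq> 0) \<longrightarrow> (\<exists>r\<in>R. (\<Sum>j\<in>J. c (r, j) * H r j x) \<noteq> 0))"
proof -
  define K where "K = R \<times> J - (\<lambda>r. (r, \<kappa> r)) ` R"
  define \<Psi> where "\<Psi> = tensor \<Phi> (coords K :: (('r \<times> 'j \<Rightarrow> 'k) \<Rightarrow> 'k) set)"
  have img: "(\<lambda>r. (r, \<kappa> r)) ` R \<subseteq> R \<times> J" "card ((\<lambda>r. (r, \<kappa> r)) ` R) = card R"
    using \<kappa> by (auto intro!: card_image inj_onI)
  have finK: "finite K" using assms by (simp add: K_def)
  have "card K = card (R \<times> J) - card R"
    unfolding K_def using img assms by (simp add: card_Diff_subset finite_subset)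
  moreover have "card R \<le> card (R \<times> J)"
    using img assms by (metis card_mono finite_cartesian_product)
  ultimately have card: "D + card K < card (R \<times> J)" using assms(4) by linarith
  have dim: "hdim_le (X \<times> UNIV) \<Psi> (D + card K)"
    unfolding \<Psi>_def by (intro hdim_le_Times assms hdim_le_coords finK)
  define u where "u p = (\<Prod>r\<in>R. H r (\<kappa> r) (fst p))" for p :: "'a \<times> ('r \<times> 'j \<Rightarrow> 'k)"
  \<comment> \<open>\<open>N i / u\<close> is to be the coefficient \<open>i\<close>: a free one is
    itself, a pivot is the solution of its row; \<open>u\<close> is the product of all pivot
    entries.\<close>
  define N where "N i p = (if snd i \<noteq> \<kappa> (fst i) then snd p i * u p
    else - (\<Sum>j\<in>J - {\<kappa> (fst i)}. snd p (fst i, j) * H (fst i) j (fst p)) *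
      (\<Prod>r\<in>R - {fst i}. H r (\<kappa> r) (fst p)))" for i and p :: "'a \<times> ('r \<times> 'j \<Rightarrow> 'k)"
  have Hs: "(\<lambda>p. H r j (fst p)) \<in> subalg \<Psi>" if "r \<in> R" "j \<in> J" for r j
    unfolding \<Psi>_def using that by (intro subalg_tensor_fst H)
  have cs: "(\<lambda>p. snd p (r, j)) \<in> subalg \<Psi>" if "r \<in> R" "j \<in> J" "j \<noteq> \<kappa> r" for r j
    unfolding \<Psi>_def using that
    by (intro subalg_tensor_snd[of "\<lambda>c. c (r, j)"] subalg_coord) (auto simp: K_def)
  have u: "u \<in> subalg \<Psi>"
    unfolding u_def[abs_def] by (intro subalg_intros Hs \<kappa>)
  have N: "N i \<in> subalg \<Psi>" if "i \<in> R \<times> J" for i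
  proof (cases "snd i = \<kappa> (fst i)")
    case True
    then have "N i = (\<lambda>p. - (\<Sum>j\<in>J - {\<kappa> (fst i)}. snd p (fst i, j) * H (fst i) j (fst p)) *
      (\<Prod>r\<in>R - {fst i}. H r (\<kappa> r) (fst p)))" by (simp add: N_def fun_eq_iff)
    also have "\<dots> \<in> subalg \<Psi>"
      by (intro subalg_mult subalg_uminus subalg_sum subalg_prod Hs cs) (use that \<kappa> in auto)
    finally show ?thesis .
  next
    case False
    then have "N i = (\<lambda>p. snd p (fst i, snd i) * u p)" by (simp add: N_def fun_eq_iff)
    also have "\<dots> \<in> subalg \<Psi>"
      by (intro subalg_mult cs u) (use that False in auto)
    finally show ?thesis .
  qed
  obtain Q c0 where Q: "Q \<in> subalg (coords (R \<times> J))" "Q c0 \<noteq> 0"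
    "\<forall>p\<in>X \<times> UNIV. u p \<noteq> 0 \<longrightarrow> Q (\<lambda>i. N i p / u p) = 0"
  proof -
    have "\<exists>Q c. Q \<in> subalg (coords (R \<times> J)) \<and> Q c \<noteq> 0 \<and>
        (\<forall>p\<in>X \<times> UNIV. u p \<noteq> 0 \<longrightarrow> Q (\<lambda>i. N i p / u p) = 0)"
      by (rule algebraic_dependence[OF dim finite_cartesian_product[OF assms(2,3)] card N u])
    then show ?thesis by (elim exE conjE) (rule that)
  qed
  show ?thesis
  proof (rule genericI[where Q = Q and c = c0 and I = "R \<times> J", OF Q(1,2)], intro ballI impI, rule ccontr)
    fix c x assume c: "Q c \<noteq> 0" and x: "x \<in> X" "\<forall>r\<in>R. H r (\<kappa> r) x \<noteq> 0"
      and "\<not> (\<exists>r\<in>R. (\<Sum>j\<in>J. c (r, j) * H r j x) \<noteq> 0)"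
    then have z: "(\<Sum>j\<in>J. c (r, j) * H r j x) = 0" if "r \<in> R" for r using that by blast
    have ux: "u (x, c) \<noteq> 0" using x(2) assms(2) by (simp add: u_def)
    have "Q (\<lambda>i. N i (x, c) / u (x, c)) = Q c"
    proof (rule subalg_coords_cong[OF Q(1)])
      fix i assume "i \<in> R \<times> J"
      then obtain r j where i: "i = (r, j)" "r \<in> R" "j \<in> J" by auto
      show "N i (x, c) / u (x, c) = c i"
      proof (cases "j = \<kappa> r")
        case True
        have "c (r, j) * H r j x + (\<Sum>j\<in>J - {\<kappa> r}. c (r, j) * H r j x) = 0"
          using z[OF i(2)] sum.remove[OF assms(3) i(3), of "\<lambda>j. c (r, j) * H r j x"] True by simp
        then have "- (\<Sum>j\<in>J - {\<kappa> r}. c (r, j) * H r j x) = c (r, j) * H r (\<kappa> r) x"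
          using True by (metis add.commute minus_unique minus_minus)
        moreover have "u (x, c) = H r (\<kappa> r) x * (\<Prod>r\<in>R - {r}. H r (\<kappa> r) x)"
          using prod.remove[OF assms(2) i(2)] by (simp add: u_def)
        ultimately show ?thesis using ux True i(1) by (simp add: N_def)
      next
        case False
        then show ?thesis using ux i(1) by (simp add: N_def)
      qed
    qed
    moreover have "Q (\<lambda>i. N i (x, c) / u (x, c)) = 0" using Q(3) x(1) ux by simp
    ultimately show False using c by simp
  qed
qed

text \<open>The nonzero entry of a row depends on the point, but there are only finitely many
  choices \<kappa> of one column per row, and finitely many generic conditions can be
  combined.\<close>

lemma generic_avoid:
  fixes H :: "'r \<Rightarrow> 'j \<Rightarrow> 'a \<Rightarrow> 'k::field_char_0"
  assumes "hdim_le X \<Phi> D" "finite R" "finite J" "D < card R"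
    and H: "\<And>r j. r \<in> R \<Longrightarrow> j \<in> J \<Longrightarrow> H r j \<in> subalg \<Phi>"
    and nz: "\<And>x r. x \<in> X \<Longrightarrow> r \<in> R \<Longrightarrow> \<exists>j\<in>J. H r j x \<noteq> 0"
  shows "generic (\<lambda>c. \<forall>x\<in>X. \<exists>r\<in>R. (\<Sum>j\<in>J. c (r, j) * H r j x) \<noteq> 0)"
proof -
  have "generic (\<lambda>c. \<forall>\<kappa>\<in>R \<rightarrow>\<^sub>E J. \<forall>x\<in>X. (\<forall>r\<in>R. H r (\<kappa> r) x \<noteq> 0) \<longrightarrow>
      (\<exists>r\<in>R. (\<Sum>j\<in>J. c (r, j) * H r j x) \<noteq> 0))"
    by (intro generic_Ball finite_PiE assms generic_avoid_pivot[OF assms(1)]) auto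
  then show ?thesis
  proof (rule generic_mono, intro ballI)
    fix c x assume c: "\<forall>\<kappa>\<in>R \<rightarrow>\<^sub>E J. \<forall>x\<in>X. (\<forall>r\<in>R. H r (\<kappa> r) x \<noteq> 0) \<longrightarrow>
      (\<exists>r\<in>R. (\<Sum>j\<in>J. c (r, j) * H r j x) \<noteq> 0)" and x: "x \<in> X"
    have "\<forall>r\<in>R. \<exists>j. j \<in> J \<and> H r j x \<noteq> 0" using nz[OF x] by blast
    from bchoice[OF this] obtain k where k: "\<forall>r\<in>R. k r \<in> J \<and> H r (k r) x \<noteq> 0" by blast
    then have "restrict k R \<in> R \<rightarrow>\<^sub>E J" by auto
    from bspec[OF c this] x k show "\<exists>r\<in>R. (\<Sum>j\<in>J. c (r, j) * H r j x) \<noteq> 0" by simp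
  qed
qed

text \<open>For sets stable under scaling one row less suffices: the additional row \<open>\<rho>\<close> imposes an
  inhomogeneous equation, which can be met by rescaling.\<close>

lemma generic_avoid_cone:
  fixes H :: "'r \<Rightarrow> 'j \<Rightarrow> 'a \<Rightarrow> 'k::field_char_0" and sc :: "'k \<Rightarrow> 'a \<Rightarrow> 'a"
  assumes "hdim_le X \<Phi> D" "finite R" "finite J" "D \<le> card R" "\<rho> \<notin> R"
    "jc \<in> J" "jd \<in> J" "jc \<noteq> jd" "finite P"
    and H: "\<And>r j. r \<in> R \<Longrightarrow> j \<in> J \<Longrightarrow> H r j \<in> subalg \<Phi>"
    and nz: "\<And>x r. x \<in> X \<Longrightarrow> r \<in> R \<Longrightarrow> \<exists>j\<in>J. H r j x \<noteq> 0"
    and P: "P \<subseteq> subalg \<Phi>" "\<And>x. x \<in> X \<Longrightarrow> \<exists>l\<in>P. l x \<noteq> 0"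
    and sc: "\<And>t x. t \<noteq> 0 \<Longrightarrow> x \<in> X \<Longrightarrow> sc t x \<in> X"
      "\<And>t x l. x \<in> X \<Longrightarrow> l \<in> P \<Longrightarrow> l (sc t x) = t * l x"
      "\<And>t x r j. x \<in> X \<Longrightarrow> r \<in> R \<Longrightarrow> j \<in> J \<Longrightarrow> H r j (sc t x) = t * H r j x"
  shows "generic (\<lambda>c. \<forall>x\<in>X. \<exists>r\<in>R. (\<Sum>j\<in>J. c (r, j) * H r j x) \<noteq> 0)"
proof -
  \<comment> \<open>The additional row has the entry \<open>l\<close> at \<open>jc\<close> and the
    constant 1 at \<open>jd\<close>; unlike the other rows it is not homogeneous under
    \<open>sc\<close>.\<close>
  define H' where "H' l r j = (if r = \<rho> then if j = jc then l else if j = jd then (\<lambda>_. 1)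
    else (\<lambda>_. 0) else H r j)" for l r j
  define X' where "X' l = {x \<in> X. l x \<noteq> 0}" for l :: "'a \<Rightarrow> 'k"
  have "generic (\<lambda>c. \<forall>x\<in>X' l. \<exists>r\<in>insert \<rho> R. (\<Sum>j\<in>J. c (r, j) * H' l r j x) \<noteq> 0)"
    if l: "l \<in> P" for l
  proof (rule generic_avoid)
    show "hdim_le (X' l) \<Phi> D"
      by (rule hdim_le_subset[OF assms(1)]) (auto simp: X'_def)
    show "D < card (insert \<rho> R)" using assms by simp
    show "H' l r j \<in> subalg \<Phi>" if "r \<in> insert \<rho> R" "j \<in> J" for r j
      using that l P(1) H by (auto simp: H'_def intro: subalg_const)
    show "\<exists>j\<in>J. H' l r j x \<noteq> 0" if "x \<in> X' l" "r \<in> insert \<rho> R" for x r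
    proof (cases "r = \<rho>")
      case True
      then show ?thesis using assms(7,8) by (intro bexI[of _ jd]) (auto simp: H'_def)
    qed (use that nz in \<open>auto simp: H'_def X'_def\<close>)
  qed (use assms in auto)
  moreover have "generic (\<lambda>c :: 'r \<times> 'j \<Rightarrow> 'k. c (\<rho>, j) \<noteq> 0)" for j
    by (rule genericI[where Q = "\<lambda>c. c (\<rho>, j)" and I = UNIV and c = "\<lambda>_. 1"]) auto
  ultimately have "generic (\<lambda>c. (\<forall>l\<in>P. \<forall>x\<in>X' l. \<exists>r\<in>insert \<rho> R. (\<Sum>j\<in>J. c (r, j) * H' l r j x) \<noteq> 0)
      \<and> c (\<rho>, jc) \<noteq> 0 \<and> c (\<rho>, jd) \<noteq> 0)"
    using assms(9) by (intro generic_conj generic_Ball[of P])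
  note gen = this
  show ?thesis
  proof (rule generic_mono[OF gen], intro ballI, rule ccontr)
    fix c x
    assume "(\<forall>l\<in>P. \<forall>x\<in>X' l. \<exists>r\<in>insert \<rho> R. (\<Sum>j\<in>J. c (r, j) * H' l r j x) \<noteq> 0) \<and>
      c (\<rho>, jc) \<noteq> 0 \<and> c (\<rho>, jd) \<noteq> 0"
    then have c: "\<forall>l\<in>P. \<forall>x\<in>X' l. \<exists>r\<in>insert \<rho> R. (\<Sum>j\<in>J. c (r, j) * H' l r j x) \<noteq> 0"
      "c (\<rho>, jc) \<noteq> 0" "c (\<rho>, jd) \<noteq> 0" by blast+
    assume x: "x \<in> X"
      and "\<not> (\<exists>r\<in>R. (\<Sum>j\<in>J. c (r, j) * H r j x) \<noteq> 0)"
    then have z: "(\<Sum>j\<in>J. c (r, j) * H r j x) = 0" if "r \<in> R" for r using that by blast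
    obtain l where l: "l \<in> P" "l x \<noteq> 0" using P(2) x by blast
    \<comment> \<open>The rescaling for which the additional row vanishes at \<open>sc t x\<close>;
      the other rows vanish there by homogeneity.\<close>
    define t where "t = - c (\<rho>, jd) / (c (\<rho>, jc) * l x)"
    have t: "t \<noteq> 0" using c l by (simp add: t_def)
    have tx: "sc t x \<in> X' l" using sc(1)[OF t x] sc(2)[OF x l(1)] l t by (simp add: X'_def)
    then obtain r where r: "r \<in> insert \<rho> R" "(\<Sum>j\<in>J. c (r, j) * H' l r j (sc t x)) \<noteq> 0"
      using c(1) l(1) by blast
    show False
    proof (cases "r = \<rho>")
      case True
      have "(\<Sum>j\<in>J. c (\<rho>, j) * H' l \<rho> j (sc t x)) =
        (\<Sum>j\<in>J. (if j = jc then c (\<rho>, jc) * (t * l x) else 0) + (if j = jd then c (\<rho>, jd) else 0))"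
        using assms(8) sc(2)[OF x l(1)] by (intro sum.cong) (auto simp: H'_def)
      also have "\<dots> = c (\<rho>, jc) * (t * l x) + c (\<rho>, jd)"
        using assms(3,6,7) by (simp add: sum.distrib)
      also have "\<dots> = 0" using c l by (simp add: t_def)
      finally show False using r(2) True by simp
    next
      case False
      then have "(\<Sum>j\<in>J. c (r, j) * H' l r j (sc t x)) = (\<Sum>j\<in>J. t * (c (r, j) * H r j x))"
        using r(1) sc(3)[OF x] by (intro sum.cong) (auto simp: H'_def)
      also have "\<dots> = 0" using z[of r] False r(1) by (simp flip: sum_distrib_left)
      finally show False using r(2) by simp
    qed
  qed
qed

text \<open>Surjectivity of \<open>h\<close> ensures that the polynomial pulled back along it is not
  identically zero.\<close>

lemma generic_comp:
  assumes "generic P" "\<And>i. (\<lambda>c. h c i) \<in> subalg (coords UNIV)" "surj h"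
  shows "generic (\<lambda>c. P (h c))"
proof -
  obtain Q c where Q: "Q \<in> subalg (coords UNIV)" "Q c \<noteq> 0" "\<And>c. Q c \<noteq> 0 \<Longrightarrow> P c"
    using assms(1) by (auto simp: generic_def)
  obtain c' where c': "c = h c'" using assms(3) by blast
  show ?thesis
  proof (rule genericI[where Q = "\<lambda>c. Q (h c)" and I = UNIV and c = c'])
    show "(\<lambda>c. Q (h c)) \<in> subalg (coords UNIV)"
      by (rule subalg_coords_subst[OF Q(1)]) (rule assms(2))
  qed (use Q c' in auto)
qed

text \<open>The nonzero vectors \<open>b\<close> form a cone of dimension \<open>card R\<close>, and
  each column in \<open>J\<close> is one equation on them. Invariance under scaling makes
  \<open>card R \<le> card J\<close> sufficient, so square matrices are covered. The array is
  transposed, since here the columns are the conditions.\<close>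

lemma generic_independent_rows:
  assumes "finite R" "finite J" "card R \<le> card J" "\<rho> \<notin> J" "ra \<in> R" "rb \<in> R" "ra \<noteq> rb"
  shows "generic (\<lambda>c :: 'r \<times> 'j \<Rightarrow> 'k::field_char_0.
    \<forall>b. (\<exists>r\<in>R. b r \<noteq> 0) \<longrightarrow> (\<exists>j\<in>J. (\<Sum>r\<in>R. c (r, j) * b r) \<noteq> 0))"
proof -
  let ?X = "{b :: 'r \<Rightarrow> 'k. \<exists>r\<in>R. b r \<noteq> 0}"
  have "generic (\<lambda>c :: 'j \<times> 'r \<Rightarrow> 'k. \<forall>b\<in>?X. \<exists>j\<in>J. (\<Sum>r\<in>R. c (j, r) * b r) \<noteq> 0)"
  proof (rule generic_avoid_cone[where P = "coords R" and sc = "\<lambda>t b r. t * b r" and \<rho> = \<rho>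
      and jc = ra and jd = rb and H = "\<lambda>_ r b. b r" and X = ?X and D = "card R" and \<Phi> = "coords R" and R = J])
    show "hdim_le ?X (coords R) (card R)" by (rule hdim_le_coords) (rule assms)
    show "finite (coords R :: (('r \<Rightarrow> 'k) \<Rightarrow> 'k) set)" using assms(1) by (simp add: coords_def)
  qed (use assms in \<open>auto simp: coords_def intro: subalg_base\<close>)
  then have "generic (\<lambda>c :: 'r \<times> 'j \<Rightarrow> 'k.
      \<forall>b\<in>?X. \<exists>j\<in>J. (\<Sum>r\<in>R. (\<lambda>(j, r). c (r, j)) (j, r) * b r) \<noteq> 0)"
  proof (rule generic_comp[where h = "\<lambda>c (j, r). c (r, j)"])
    show "surj (\<lambda>(c :: 'r \<times> 'j \<Rightarrow> 'k) (j, r). c (r, j))"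
      by (rule surjI[of _ "\<lambda>c (r, j). c (j, r)"]) auto
  qed (auto simp: split_def)
  then show ?thesis by (rule generic_mono) auto
qed

subsection \<open>Leading forms\<close>

lemma coeff_mult_top:
  fixes p q :: "'r::comm_ring_1 poly"
  assumes "degree p \<le> i" "degree q \<le> j"
  shows "coeff (p * q) (i + j) = coeff p i * coeff q j"
proof -
  have "coeff (p * q) (i + j) = (\<Sum>k\<le>i + j. coeff p k * coeff q (i + j - k))" by (rule coeff_mult)
  also have "\<dots> = (\<Sum>k\<in>{i}. coeff p k * coeff q (i + j - k))"
  proof (rule sum.mono_neutral_right)
    show "\<forall>k\<in>{..i + j} - {i}. coeff p k * coeff q (i + j - k) = 0"
    proof
      fix k assume "k \<in> {..i + j} - {i}"
      then have "k > degree p \<or> i + j - k > degree q" using assms by auto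
      then show "coeff p k * coeff q (i + j - k) = 0" by (auto simp: coeff_eq_0)
    qed
  qed auto
  finally show ?thesis by simp
qed

lemma poly_eq_sum_le: "degree p \<le> D \<Longrightarrow> poly p x = (\<Sum>k\<le>D. coeff p k * x ^ k)"
  for p :: "'r::comm_ring_1 poly"
  unfolding poly_altdef by (rule sum.mono_neutral_left) (auto simp: coeff_eq_0)

lemma poly_fun_apply:
  fixes G :: "('a \<Rightarrow> 'k::comm_ring_1) poly"
  assumes "degree G \<le> D"
  shows "poly G \<xi> x = (\<Sum>k\<le>D. coeff G k x * \<xi> x ^ k)"
  by (simp add: poly_eq_sum_le[OF assms] sum_fun_apply power_fun_apply)

text \<open>Forms of degree \<open>d\<close> in the variables \<open>I1\<close> whose coefficients
  are polynomials in the variables \<open>I0\<close>.\<close>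

inductive hom :: "'i set \<Rightarrow> 'i set \<Rightarrow> nat \<Rightarrow> (('i \<Rightarrow> 'k::comm_ring_1) \<Rightarrow> 'k) \<Rightarrow> bool" for I0 I1 where
  hom_zero: "hom I0 I1 d (\<lambda>_. 0)"
| hom_const: "hom I0 I1 0 (\<lambda>_. c)"
| hom_coef: "i \<in> I0 \<Longrightarrow> hom I0 I1 0 (\<lambda>x. x i)"
| hom_var: "i \<in> I1 \<Longrightarrow> hom I0 I1 1 (\<lambda>x. x i)"
| hom_add: "hom I0 I1 d f \<Longrightarrow> hom I0 I1 d g \<Longrightarrow> hom I0 I1 d (\<lambda>x. f x + g x)"
| hom_mult: "hom I0 I1 d f \<Longrightarrow> hom I0 I1 e g \<Longrightarrow> hom I0 I1 (d + e) (\<lambda>x. f x * g x)"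

lemma hom_imp_subalg: "hom I0 I1 d f \<Longrightarrow> f \<in> subalg (coords (I0 \<union> I1))"
  by (induction rule: hom.induct) (auto intro: subalg.intros)

lemma hom_decomposition:
  assumes "deg_le (coords (I0 \<union> I1)) s f"
  shows "\<exists>F. (\<forall>i. hom I0 I1 i (F i)) \<and> (\<forall>x. f x = (\<Sum>i\<le>s. F i x))"
  using assms
proof induction
  case (deg_le_const s c)
  have "c = (\<Sum>i\<le>s. if i = 0 then c else 0)" by (subst sum.delta) auto
  then show ?case
    by (intro exI[of _ "\<lambda>i _. if i = 0 then c else 0"]) (auto intro: hom.intros)
next
  case (deg_le_add s f g)
  then obtain F G where "\<forall>i. hom I0 I1 i (F i)" "\<forall>x. f x = (\<Sum>i\<le>s. F i x)"
    "\<forall>i. hom I0 I1 i (G i)" "\<forall>x. g x = (\<Sum>i\<le>s. G i x)" by blast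
  then show ?case
    by (intro exI[of _ "\<lambda>i x. F i x + G i x"]) (auto intro: hom_add simp: sum.distrib)
next
  case (deg_le_Suc \<phi> s f)
  then obtain F where F: "\<forall>i. hom I0 I1 i (F i)" "\<forall>x. f x = (\<Sum>i\<le>s. F i x)" by blast
  from deg_le_Suc(1) obtain i where i: "\<phi> = (\<lambda>x. x i)" "i \<in> I0 \<union> I1" by (auto simp: coords_def)
  show ?case
  proof (cases "i \<in> I0")
    case True
    have "hom I0 I1 k (\<lambda>x. x i * F k x)" for k
      using hom_mult[OF hom_coef[OF True], of I1 k "F k"] F(1) by simp
    then have "hom I0 I1 k (\<lambda>x. if k \<le> s then x i * F k x else 0)" for k
      by (cases "k \<le> s") (simp_all add: hom_zero)
    then have "\<forall>k. hom I0 I1 k (\<lambda>x. if k \<le> s then x i * F k x else 0)" ..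
    moreover have "\<forall>x. \<phi> x * f x = (\<Sum>k\<le>Suc s. if k \<le> s then x i * F k x else 0)"
      by (simp add: i F(2) sum_distrib_left)
    ultimately show ?thesis by (intro exI[of _ "\<lambda>k x. if k \<le> s then x i * F k x else 0"] conjI)
  next
    case False
    define G where "G k = (case k of 0 \<Rightarrow> (\<lambda>_. 0) | Suc k \<Rightarrow> (\<lambda>x. x i * F k x))" for k
    have "hom I0 I1 k (G k)" for k
    proof (cases k)
      case (Suc m)
      then show ?thesis
        using hom_mult[OF hom_var, of i I1 I0 m "F m"] False i(2) F(1) by (simp add: G_def)
    qed (simp add: G_def hom_zero)
    moreover have "\<phi> x * f x = (\<Sum>k\<le>Suc s. G k x)" for x
      by (subst sum.atMost_Suc_shift) (simp add: G_def i F(2) sum_distrib_left)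
    ultimately show ?thesis by blast
  qed
qed

lemma hom_scale:
  assumes "hom I0 I1 d f" "I0 \<inter> I1 = {}"
  shows "f (\<lambda>i. if i \<in> I1 then t * x i else x i) = t ^ d * f x"
  using assms(1) by induction (use assms(2) in \<open>auto simp: algebra_simps power_add\<close>)

text \<open>The shear adds \<open>\<eta> i\<close> times the variable \<open>z\<close> to every
  other variable \<open>i\<close> of \<open>I1\<close>, so the coefficient of the top power of
  \<open>z\<close> is the value of the form at \<eta>. It may depend on the variables
  \<open>I0\<close>, but no longer on \<open>I1\<close>.\<close>

lemma hom_shear:
  fixes f :: "('i \<Rightarrow> 'k::comm_ring_1) \<Rightarrow> 'k"
  assumes "hom I0 I1 d f" "I0 \<inter> I1 = {}" "z \<in> I1" "\<eta> z = 1"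
  shows "\<exists>G. (\<forall>k. coeff G k \<in> subalg (coords (I0 \<union> (I1 - {z})))) \<and> degree G \<le> d \<and>
    coeff G d = (\<lambda>x. f (\<lambda>i. if i \<in> I1 then \<eta> i else x i)) \<and>
    (\<lambda>x. f (\<lambda>i. if i \<in> I1 - {z} then x i + \<eta> i * x z else x i)) = poly G (\<lambda>x. x z)"
    (is "\<exists>G. ?P G d f")
  using assms(1)
proof induction
  case (hom_zero d)
  show ?case by (rule exI[of _ 0]) (auto simp: zero_fun_def intro: subalg_const)
next
  case (hom_const c)
  show ?case by (rule exI[of _ "[:\<lambda>_. c:]"])
    (auto simp: zero_fun_def coeff_pCons intro: subalg_const split: nat.split)
next
  case (hom_coef i)
  then have "i \<notin> I1" using assms(2) by auto
  with hom_coef show ?case by (intro exI[of _ "[:\<lambda>x. x i:]"])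
    (auto simp: coeff_pCons intro: subalg_const subalg_fun_intros split: nat.split)
next
  case (hom_var i)
  show ?case
  proof (cases "i = z")
    case True
    then show ?thesis using assms(3,4) by (intro exI[of _ "[:0, 1:]"])
      (auto simp: coeff_pCons fun_eq_iff intro: subalg_fun_intros split: nat.split)
  next
    case False
    then show ?thesis using hom_var by (intro exI[of _ "[:\<lambda>x. x i, \<lambda>_. \<eta> i:]"])
      (auto simp: coeff_pCons fun_eq_iff intro: subalg_fun_intros subalg_const split: nat.split)
  qed
next
  case (hom_add d f g)
  then obtain F G where F: "?P F d f" and G: "?P G d g" by blast
  have "?P (F + G) d (\<lambda>x. f x + g x)"
  proof (intro conjI allI)
    show "degree (F + G) \<le> d" using F G by (simp add: degree_add_le)
  qed (use F G in \<open>auto simp: fun_eq_iff intro: subalg_add\<close>)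
  then show ?case by blast
next
  case (hom_mult d f e g)
  then obtain F G where F: "?P F d f" and G: "?P G e g" by blast
  have "?P (F * G) (d + e) (\<lambda>x. f x * g x)"
  proof (intro conjI allI)
    show "degree (F * G) \<le> d + e" using F G degree_mult_le[of F G] by linarith
    show "coeff (F * G) (d + e) = (\<lambda>x. f (\<lambda>i. if i \<in> I1 then \<eta> i else x i) * g (\<lambda>i. if i \<in> I1 then \<eta> i else x i))"
      using F G by (subst coeff_mult_top) (auto simp: fun_eq_iff)
    show "coeff (F * G) k \<in> subalg (coords (I0 \<union> (I1 - {z})))" for k
      unfolding coeff_mult using F G by (intro subalg_fun_sum subalg_fun_intros) auto
  qed (use F G in \<open>auto simp: fun_eq_iff\<close>)
  then show ?case by blast
qed

text \<open>A direction \<eta> at which the leading form in \<open>I1\<close> does not vanish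
  identically in \<open>I0\<close> makes \<open>Q\<close> monic in \<open>z\<close>, up to a factor
  in the variables \<open>I0\<close> alone. This is the shear of Noether normalization, with
  parameters.\<close>

lemma leading_form:
  fixes Q :: "('i \<Rightarrow> 'k::field_char_0) \<Rightarrow> 'k"
  assumes "Q \<in> subalg (coords (I0 \<union> I1))" "Q c \<noteq> 0" "I0 \<inter> I1 = {}" "z \<in> I1"
  shows "\<exists>\<eta> D G. \<eta> z = 1 \<and> (\<forall>k. coeff G k \<in> subalg (coords (I0 \<union> (I1 - {z})))) \<and> degree G \<le> D \<and>
    coeff G D \<in> subalg (coords I0) \<and> (\<exists>x. coeff G D x \<noteq> 0) \<and>
    (\<lambda>x. Q (\<lambda>i. if i \<in> I1 - {z} then x i + \<eta> i * x z else x i)) = poly G (\<lambda>x. x z)"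
proof -
  obtain s where "deg_le (coords (I0 \<union> I1)) s Q" using subalg_imp_deg_le[OF assms(1)] by blast
  from hom_decomposition[OF this] obtain F where
    F: "\<And>i. hom I0 I1 i (F i)" "\<And>x. Q x = (\<Sum>i\<le>s. F i x)" by blast
  define S where "S = {i. i \<le> s \<and> (\<exists>x. F i x \<noteq> 0)}"
  have "S \<noteq> {}"
  proof
    assume "S = {}"
    then have "Q c = 0" by (auto simp: F(2) S_def)
    with assms(2) show False by simp
  qed
  have finS: "finite S" by (simp add: S_def)
  define D where "D = Max S"
  have D: "D \<in> S" "\<And>i. i \<in> S \<Longrightarrow> i \<le> D" using finS \<open>S \<noteq> {}\<close> by (auto simp: D_def)
  have QD: "Q x = (\<Sum>i\<le>D. F i x)" for x
  proof -
    have "(\<Sum>i\<le>s. F i x) = (\<Sum>i\<le>D. F i x)"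
    proof (rule sum.mono_neutral_right)
      show "\<forall>i\<in>{..s} - {..D}. F i x = 0" using D(2) unfolding S_def by force
    qed (use D(1) in \<open>auto simp: S_def\<close>)
    then show ?thesis by (simp add: F(2))
  qed
  obtain a where a: "F D a \<noteq> 0" using D(1) by (auto simp: S_def)
  \<comment> \<open>A point where both the leading form and the coordinate \<open>z\<close> are
    nonzero; by homogeneity it can be rescaled to \<open>\<eta> z = 1\<close>.\<close>
  obtain b where b: "F D b \<noteq> 0" "b z \<noteq> 0"
    using subalg_coords_nonzero[OF hom_imp_subalg[OF F(1)] a, of "\<lambda>x. x z" UNIV "\<lambda>_. 1"] by auto
  define \<eta> where "\<eta> i = inverse (b z) * b i" for i
  have \<eta>z: "\<eta> z = 1" using b(2) by (simp add: \<eta>_def)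
  have "\<forall>i. \<exists>G. (\<forall>k. coeff G k \<in> subalg (coords (I0 \<union> (I1 - {z})))) \<and> degree G \<le> i \<and>
    coeff G i = (\<lambda>x. F i (\<lambda>j. if j \<in> I1 then \<eta> j else x j)) \<and>
    (\<lambda>x. F i (\<lambda>j. if j \<in> I1 - {z} then x j + \<eta> j * x z else x j)) = poly G (\<lambda>x. x z)"
    by (intro allI hom_shear F assms \<eta>z)
  from choice[OF this] obtain G where G: "\<And>i k. coeff (G i) k \<in> subalg (coords (I0 \<union> (I1 - {z})))"
    "\<And>i. degree (G i) \<le> i"
    "\<And>i. coeff (G i) i = (\<lambda>x. F i (\<lambda>j. if j \<in> I1 then \<eta> j else x j))"
    "\<And>i. (\<lambda>x. F i (\<lambda>j. if j \<in> I1 - {z} then x j + \<eta> j * x z else x j)) = poly (G i) (\<lambda>x. x z)"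
    by auto
  have top: "coeff (\<Sum>i\<le>D. G i) D = coeff (G D) D"
  proof -
    have "coeff (\<Sum>i\<le>D. G i) D = (\<Sum>i\<in>{D}. coeff (G i) D)"
      unfolding coeff_sum
    proof (rule sum.mono_neutral_right)
      show "\<forall>i\<in>{..D} - {D}. coeff (G i) D = 0"
      proof
        fix i assume "i \<in> {..D} - {D}"
        then have "degree (G i) < D" using G(2)[of i] by auto
        then show "coeff (G i) D = 0" by (rule coeff_eq_0)
      qed
    qed auto
    then show ?thesis by simp
  qed
  have "coeff (G D) D b = F D (\<lambda>j. if j \<in> I1 then inverse (b z) * b j else b j)"
    unfolding G(3) \<eta>_def ..
  also have "\<dots> = inverse (b z) ^ D * F D b" by (rule hom_scale[OF F(1) assms(3)])
  finally have nz: "coeff (G D) D b \<noteq> 0" using b by simp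
  show ?thesis
  proof (intro exI conjI allI)
    show "\<eta> z = 1" by (rule \<eta>z)
    show "coeff (\<Sum>i\<le>D. G i) k \<in> subalg (coords (I0 \<union> (I1 - {z})))" for k
      unfolding coeff_sum by (intro subalg_fun_sum G)
    show "degree (\<Sum>i\<le>D. G i) \<le> D"
    proof (rule degree_sum_le)
      fix i assume "i \<in> {..D}"
      then show "degree (G i) \<le> D" using G(2)[of i] by simp
    qed simp
    show "coeff (\<Sum>i\<le>D. G i) D \<in> subalg (coords I0)"
      unfolding top G(3)
    proof (rule subalg_coords_subst[OF hom_imp_subalg[OF F(1)]])
      fix i assume "i \<in> I0 \<union> I1"
      then show "(\<lambda>x. if i \<in> I1 then \<eta> i else x i) \<in> subalg (coords I0)"
        by (cases "i \<in> I1") (auto intro: subalg_const)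
    qed
    show "coeff (\<Sum>i\<le>D. G i) D b \<noteq> 0" using nz by (simp only: top not_False_eq_True)
    show "(\<lambda>x. Q (\<lambda>i. if i \<in> I1 - {z} then x i + \<eta> i * x z else x i)) = poly (\<Sum>i\<le>D. G i) (\<lambda>x. x z)"
      unfolding poly_sum G(4)[symmetric] QD by (simp add: fun_eq_iff sum_fun_apply)
  qed
qed

section \<open>Integrality over generic linear combinations\<close>

definition integral_on :: "'a set \<Rightarrow> ('a \<Rightarrow> 'k::comm_ring_1) set \<Rightarrow> ('a \<Rightarrow> 'k) \<Rightarrow> bool" where
  "integral_on X A \<xi> \<longleftrightarrow> (\<exists>D a. (\<forall>i<D. a i \<in> A) \<and> (\<forall>x\<in>X. \<xi> x ^ D + (\<Sum>i<D. a i x * \<xi> x ^ i) = 0))"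

text \<open>The functions \<open>c (r, j)\<close> and \<open>\<Sum>j. c (r, j) * H j\<close> on pairs \<open>(x, c)\<close> are algebraically
  dependent for reasons of dimension. A shear of the rows makes the dependence relation monic,
  up to a factor that depends only on \<open>c\<close>.\<close>

lemma generic_integral:
  fixes H :: "'j \<Rightarrow> 'a \<Rightarrow> 'k::field_char_0"
  assumes "hdim_le X \<Phi> d" "finite R" "d \<le> card R" "\<rho> \<notin> R" "finite J" "j' \<notin> J"
    and H: "\<And>j. j \<in> J \<Longrightarrow> H j \<in> subalg \<Phi>"
  shows "generic (\<lambda>c :: 'r \<times> 'j \<Rightarrow> 'k.
    integral_on X (subalg ((\<lambda>r x. \<Sum>j\<in>J. c (r, j) * H j x) ` R)) (\<lambda>x. \<Sum>j\<in>J. c (\<rho>, j) * H j x))"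
proof -
  define R' where "R' = insert \<rho> R"
  \<comment> \<open>\<open>I0\<close> indexes the coefficients; \<open>I1\<close> indexes one
    variable for the value of each combination, in the extra column \<open>j'\<close>. There are
    \<open>card R + 1 > d\<close> of the latter.\<close>
  define I0 I1 where "I0 = R' \<times> J" and "I1 = R' \<times> {j'}"
  define z where "z = (\<rho>, j')"
  have fin: "finite I0" "finite I1" using assms by (auto simp: I0_def I1_def R'_def)
  have disj: "I0 \<inter> I1 = {}" using assms(6) by (auto simp: I0_def I1_def)
  have z: "z \<in> I1" by (simp add: z_def I1_def R'_def)
  define \<Psi> where "\<Psi> = tensor \<Phi> (coords I0 :: (('r \<times> 'j \<Rightarrow> 'k) \<Rightarrow> 'k) set)"
  have dim: "hdim_le (X \<times> UNIV) \<Psi> (d + card I0)"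
    unfolding \<Psi>_def by (intro hdim_le_Times assms hdim_le_coords fin)
  have "card I1 = Suc (card R)" using assms by (simp add: I1_def R'_def)
  then have card: "d + card I0 < card (I0 \<union> I1)"
    using assms(3) fin disj by (simp add: card_Un_disjoint)
  define L where "L c r x = (\<Sum>j\<in>J. c (r, j) * H j x)" for c :: "'r \<times> 'j \<Rightarrow> 'k" and r x
  define N where "N i p = (if i \<in> I0 then snd p i else L (snd p) (fst i) (fst p))"
    for i :: "'r \<times> 'j" and p :: "'a \<times> ('r \<times> 'j \<Rightarrow> 'k)"
  have N: "N i \<in> subalg \<Psi>" if "i \<in> I0 \<union> I1" for i
  proof (cases "i \<in> I0")
    case True
    then show ?thesis unfolding \<Psi>_def N_def[abs_def]
      using subalg_tensor_snd[OF subalg_coord[OF True]] by simp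
  next
    case False
    then have "fst i \<in> R'" using that by (auto simp: I1_def)
    then have "(\<lambda>p. snd p (fst i, j)) \<in> subalg \<Psi>" if "j \<in> J" for j
      unfolding \<Psi>_def using that by (intro subalg_tensor_snd subalg_coord) (auto simp: I0_def)
    moreover have "(\<lambda>p. H j (fst p)) \<in> subalg \<Psi>" if "j \<in> J" for j
      unfolding \<Psi>_def using that by (intro subalg_tensor_fst H)
    ultimately show ?thesis
      using False unfolding N_def[abs_def] L_def by (simp add: subalg_sum subalg_mult)
  qed
  obtain Q c0 where Q: "Q \<in> subalg (coords (I0 \<union> I1))" "Q c0 \<noteq> 0"
    "\<forall>p\<in>X \<times> UNIV. (1::'k) \<noteq> 0 \<longrightarrow> Q (\<lambda>i. N i p / 1) = 0"
  proof -
    have "\<exists>Q c. Q \<in> subalg (coords (I0 \<union> I1)) \<and> Q c \<noteq> 0 \<and>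
        (\<forall>p\<in>X \<times> UNIV. (1::'k) \<noteq> 0 \<longrightarrow> Q (\<lambda>i. N i p / 1) = 0)"
      by (rule algebraic_dependence[OF dim finite_UnI[OF fin] card N subalg_const])
    then show ?thesis by (elim exE conjE) (rule that)
  qed
  obtain \<eta> D G where \<eta>: "\<eta> z = 1" and G: "\<And>k. coeff G k \<in> subalg (coords (I0 \<union> (I1 - {z})))"
    "degree G \<le> D" "coeff G D \<in> subalg (coords I0)" and nz: "\<exists>x. coeff G D x \<noteq> 0"
    and QG: "(\<lambda>x. Q (\<lambda>i. if i \<in> I1 - {z} then x i + \<eta> i * x z else x i)) = poly G (\<lambda>x. x z)"
    using leading_form[OF Q(1,2) disj z] by blast
  \<comment> \<open>The shear of the value variables is realized by a change of coefficients:
    replacing \<open>c\<close> by \<open>T c\<close> adds a multiple of the combination \<rho> to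
    every combination in \<open>R\<close>.\<close>
  define T where "T c i = (if i \<in> R \<times> J then c i + \<eta> (fst i, j') * c (\<rho>, snd i) else c i)"
    for c :: "'r \<times> 'j \<Rightarrow> 'k" and i
  have LT: "L (T c) r x = L c r x + \<eta> (r, j') * L c \<rho> x" if "r \<in> R" for c r x
    using that by (simp add: L_def T_def sum.distrib sum_distrib_left algebra_simps)
  have LT': "L (T c) \<rho> x = L c \<rho> x" for c x
    using assms(4) by (simp add: L_def T_def)
  obtain x0 where x0: "coeff G D x0 \<noteq> 0" using nz by blast
  \<comment> \<open>A preimage of \<open>x0\<close> under \<open>T\<close>; it shows that
    \<open>coeff G D (T c)\<close> is not identically zero in \<open>c\<close>.\<close>
  define c1 where "c1 i = (if i \<in> R \<times> J then x0 i - \<eta> (fst i, j') * x0 (\<rho>, snd i) else x0 i)" for i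
  have "T c1 = x0" using assms(4) by (auto simp: T_def c1_def fun_eq_iff)
  show ?thesis
  proof (rule genericI[where Q = "\<lambda>c. coeff G D (T c)" and I = UNIV and c = c1])
    show "coeff G D (T c1) \<noteq> 0" using x0 \<open>T c1 = x0\<close> by simp
    show "(\<lambda>c. coeff G D (T c)) \<in> subalg (coords UNIV)"
    proof (rule subalg_coords_subst[OF G(3)])
      fix i show "(\<lambda>c. T c i) \<in> subalg (coords UNIV)"
        unfolding T_def by (cases "i \<in> R \<times> J") (auto intro!: subalg_intros)
    qed
  next
    fix c assume c: "coeff G D (T c) \<noteq> 0"
    \<comment> \<open>The sheared coefficients \<open>T c\<close> are inserted for the variables
      \<open>I0\<close>, the unsheared values \<open>L c r x\<close> for the variables
      \<open>I1\<close>.\<close>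
    define pt where "pt x i = (if i \<in> I1 then L c (fst i) x else T c i)" for x i
    define a where "a k x = inverse (coeff G D (T c)) * coeff G k (pt x)" for k x
    have ptz: "pt x z = L c \<rho> x" for x using z by (simp add: pt_def z_def)
    have "a k \<in> subalg (L c ` R)" for k
      unfolding a_def[abs_def]
    proof (intro subalg_mult subalg_const subalg_coords_subst[OF G(1)])
      fix i assume "i \<in> I0 \<union> (I1 - {z})"
      then consider "i \<in> I0" "i \<notin> I1" | "i \<in> I1" "fst i \<in> R"
        using disj by (auto simp: I1_def z_def R'_def)
      then show "(\<lambda>x. pt x i) \<in> subalg (L c ` R)"
        by cases (auto simp: pt_def intro: subalg_const subalg_base)
    qed
    moreover have "L c \<rho> x ^ D + (\<Sum>k<D. a k x * L c \<rho> x ^ k) = 0" if x: "x \<in> X" for x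
    proof -
      have "coeff G D (pt x) = coeff G D (T c)"
        using disj by (intro subalg_coords_cong[OF G(3)]) (auto simp: pt_def)
      moreover have "(\<Sum>k\<le>D. coeff G k (pt x) * L c \<rho> x ^ k) = 0"
      proof -
        have "(\<Sum>k\<le>D. coeff G k (pt x) * L c \<rho> x ^ k) = poly G (\<lambda>x. x z) (pt x)"
          by (simp add: poly_fun_apply[OF G(2)] ptz)
        also have "\<dots> = Q (\<lambda>i. if i \<in> I1 - {z} then pt x i + \<eta> i * pt x z else pt x i)"
          by (simp only: QG[symmetric])
        also have "\<dots> = Q (\<lambda>i. N i (x, T c) / 1)"
        proof (rule subalg_coords_cong[OF Q(1)])
          fix i assume "i \<in> I0 \<union> I1"
          then consider "i \<in> I0" "i \<notin> I1" | "i = z" | r where "i = (r, j')" "r \<in> R" "i \<noteq> z"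
            using disj by (auto simp: I1_def z_def R'_def)
          then show "(if i \<in> I1 - {z} then pt x i + \<eta> i * pt x z else pt x i) = N i (x, T c) / 1"
          proof cases
            case 1
            then show ?thesis by (simp add: N_def pt_def)
          next
            case 2
            then have "i \<notin> I0" using z disj by auto
            then show ?thesis using 2 ptz by (simp add: N_def LT' z_def)
          next
            case 3
            then have "i \<in> I1" "i \<notin> I0" using disj by (auto simp: I1_def R'_def)
            then show ?thesis using 3 ptz LT by (simp add: N_def pt_def)
          qed
        qed
        also have "\<dots> = 0" using Q(3) x by simp
        finally show ?thesis .
      qed
      ultimately have "coeff G D (T c) * L c \<rho> x ^ D + (\<Sum>k<D. coeff G k (pt x) * L c \<rho> x ^ k) = 0"
        by (simp flip: lessThan_Suc_atMost add: add.commute)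
      then have "inverse (coeff G D (T c)) * (coeff G D (T c) * L c \<rho> x ^ D +
          (\<Sum>k<D. coeff G k (pt x) * L c \<rho> x ^ k)) = 0" by simp
      then show ?thesis using c
        by (simp add: distrib_left sum_distrib_left a_def flip: mult.assoc)
    qed
    ultimately have "integral_on X (subalg (L c ` R)) (L c \<rho>)"
      unfolding integral_on_def by blast
    then show "integral_on X (subalg ((\<lambda>r x. \<Sum>j\<in>J. c (r, j) * H j x) ` R))
        (\<lambda>x. \<Sum>j\<in>J. c (\<rho>, j) * H j x)"
      by (simp add: L_def[abs_def])
  qed
qed

section \<open>Elimination\<close>

definition polys_over :: "'r::comm_ring_1 set \<Rightarrow> 'r poly set" where
  "polys_over A = {p. \<forall>i. coeff p i \<in> A}"

text \<open>While the degree of \<open>u\<close> exceeds \<open>D\<close>, a multiple of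
  \<open>h\<close> cancels its top coefficient. That coefficient vanishes under \<open>ev\<close>,
  so under \<open>ev\<close> the step only multiplies \<open>u\<close> by the nonzero constant
  \<open>ev (coeff h (Suc D))\<close>.\<close>

lemma elimination_reduce:
  fixes J :: "'r::comm_ring_1 poly set" and ev :: "'r \<Rightarrow> 'k::field"
  assumes ev: "\<And>a b. ev (a - b) = ev a - ev b" "\<And>a b. ev (a * b) = ev a * ev b"
    and J: "J \<subseteq> polys_over A" "\<And>u v. u \<in> J \<Longrightarrow> v \<in> J \<Longrightarrow> u - v \<in> J"
      "\<And>u c. u \<in> J \<Longrightarrow> c \<in> A \<Longrightarrow> smult c u \<in> J" "\<And>u k. u \<in> J \<Longrightarrow> monom 1 k * u \<in> J"
    and h: "h \<in> J" "degree h \<le> Suc D" "ev (coeff h (Suc D)) \<noteq> 0"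
    and u: "u \<in> J" "degree u \<le> E" "ev (coeff u D) \<noteq> 0" "\<And>i. i > D \<Longrightarrow> ev (coeff u i) = 0"
  shows "\<exists>v\<in>J. degree v \<le> D \<and> ev (coeff v D) \<noteq> 0"
  using u
proof (induction E arbitrary: u)
  case 0
  then show ?case by (intro bexI[of _ u]) auto
next
  case (Suc E)
  show ?case
  proof (cases "Suc E \<le> D")
    case True
    then show ?thesis using Suc.prems by (intro bexI[of _ u]) auto
  next
    case False
    define v where "v = smult (coeff h (Suc D)) u - smult (coeff u (Suc E)) (monom 1 (E - D) * h)"
    have top: "coeff (monom 1 (E - D) * h) (Suc E) = coeff h (Suc D)"
      using coeff_mult_top[of "monom 1 (E - D)" "E - D" h "Suc D"] h(2) False
      by (simp add: degree_monom_le)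
    have dm: "degree (monom 1 (E - D) * h) \<le> Suc E"
      using degree_mult_le[of "monom 1 (E - D)" h] degree_monom_le[of "1::'r" "E - D"] h(2) False
      by linarith
    show ?thesis
    proof (rule Suc.IH)
      show "v \<in> J" unfolding v_def
        using Suc.prems(1) h(1) J unfolding polys_over_def by (intro J) blast+
      show "degree v \<le> E"
      proof (rule degree_le, intro allI impI)
        fix i assume "E < i"
        then consider "i = Suc E" | "i > Suc E" by linarith
        then show "coeff v i = 0"
        proof cases
          case 1
          then show ?thesis using top by (simp add: v_def)
        next
          case 2
          then show ?thesis using dm Suc.prems(2) by (simp add: v_def coeff_eq_0)
        qed
      qed
      have "ev (coeff u (Suc E)) = 0" using Suc.prems(4) False by simp
      then have ev_v: "ev (coeff v i) = ev (coeff h (Suc D)) * ev (coeff u i)" for i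
        by (simp add: v_def ev)
      show "ev (coeff v D) \<noteq> 0" using h(3) Suc.prems(3) by (simp add: ev_v)
      show "ev (coeff v i) = 0" if "i > D" for i using Suc.prems(4)[OF that] by (simp add: ev_v)
    qed
  qed
qed

text \<open>A determinant-free form of Nakayama's lemma: an element of \<open>J\<close> of degree \<open>c\<close> whose leading
  coefficient does not vanish under \<open>ev\<close> shows that, locally, \<open>1, x, \<dots>, x\<^sup>c\<^sup>-\<^sup>1\<close> generate the
  quotient by \<open>J\<close> as soon as they generate its reduction.\<close>

lemma elimination:
  fixes J :: "'r::comm_ring_1 poly set" and ev :: "'r \<Rightarrow> 'k::field"
  assumes ev: "\<And>a b. ev (a - b) = ev a - ev b" "\<And>a b. ev (a * b) = ev a * ev b"
    and J: "J \<subseteq> polys_over A" "\<And>u v. u \<in> J \<Longrightarrow> v \<in> J \<Longrightarrow> u - v \<in> J"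
      "\<And>u c. u \<in> J \<Longrightarrow> c \<in> A \<Longrightarrow> smult c u \<in> J" "\<And>u k. u \<in> J \<Longrightarrow> monom 1 k * u \<in> J"
    and h: "h \<in> J" "degree h \<le> D" "ev (coeff h D) \<noteq> 0"
    and f: "f \<in> J" "ev (coeff f c) \<noteq> 0" "\<And>i. i > c \<Longrightarrow> ev (coeff f i) = 0" "c \<le> D"
  shows "\<exists>v\<in>J. degree v \<le> c \<and> ev (coeff v c) \<noteq> 0"
  using h f(4)
proof (induction D arbitrary: h)
  case 0
  then show ?case by (intro bexI[of _ h]) auto
next
  case (Suc D)
  have ev0: "ev 0 = 0" using ev(1)[of 0 0] by simp
  show ?case
  proof (cases "c = Suc D")
    case True
    then show ?thesis using Suc.prems by (intro bexI[of _ h]) auto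
  next
    case False
    then have c: "c \<le> D" using Suc.prems by simp
    \<comment> \<open>Multiplication by a power of the variable moves the last nonvanishing
      coefficient of \<open>f\<close> under \<open>ev\<close> from degree \<open>c\<close> to degree
      \<open>D\<close>.\<close>
    let ?u = "monom 1 (D - c) * f"
    have "\<exists>v\<in>J. degree v \<le> D \<and> ev (coeff v D) \<noteq> 0"
    proof (rule elimination_reduce[OF ev J, of h D ?u "degree ?u"])
      show "ev (coeff ?u D) \<noteq> 0" using f(2) c by (simp add: coeff_monom_mult)
      show "ev (coeff ?u i) = 0" if "i > D" for i
        using that c f(3)[of "i - (D - c)"] ev0 by (simp add: coeff_monom_mult)
    qed (use Suc.prems f(1) J in auto)
    then show ?thesis using Suc.IH c by blast
  qed
qed

section \<open>Ideals seen as polynomials in the last variable\<close>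

definition ideal_of :: "nat \<Rightarrow> ((nat \<Rightarrow> 'k::comm_ring_1) \<Rightarrow> 'k) set \<Rightarrow> bool" where
  "ideal_of n I \<longleftrightarrow> I \<subseteq> subalg (coords {..<n}) \<and> (\<lambda>_. 0) \<in> I \<and>
     (\<forall>f\<in>I. \<forall>g\<in>I. (\<lambda>x. f x + g x) \<in> I) \<and>
     (\<forall>f\<in>I. \<forall>g\<in>subalg (coords {..<n}). (\<lambda>x. g x * f x) \<in> I)"

lemma ideal_ofD:
  assumes "ideal_of n I"
  shows "f \<in> I \<Longrightarrow> f \<in> subalg (coords {..<n})"
    and "(\<lambda>_. 0) \<in> I"
    and "f \<in> I \<Longrightarrow> g \<in> I \<Longrightarrow> (\<lambda>x. f x + g x) \<in> I"
    and "f \<in> I \<Longrightarrow> g \<in> subalg (coords {..<n}) \<Longrightarrow> (\<lambda>x. g x * f x) \<in> I"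
  using assms by (simp_all add: ideal_of_def subset_iff)

lemma ideal_of_vanish: "ideal_of n (vanish n Z)"
  by (simp add: ideal_of_def vanish_def subset_iff subalg_const subalg_add subalg_mult)

lemma ideal_of_diff:
  assumes "ideal_of n I" "f \<in> I" "g \<in> I"
  shows "(\<lambda>x. f x - g x) \<in> I"
  using ideal_ofD(3)[OF assms(1,2) ideal_ofD(4)[OF assms(1,3) subalg_const[of "-1"]]] by simp

text \<open>The coefficients remain functions on the whole space that depend on the first
  \<open>n\<close> coordinates only, so no second ring of functions is introduced.\<close>

definition last_polys :: "nat \<Rightarrow> ((nat \<Rightarrow> 'k::comm_ring_1) \<Rightarrow> 'k) set \<Rightarrow> ((nat \<Rightarrow> 'k) \<Rightarrow> 'k) poly set" where
  "last_polys n I = {F \<in> polys_over (subalg (coords {..<n})). poly F (\<lambda>x. x n) \<in> I}"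

lemma subalg_Suc_poly:
  assumes "f \<in> subalg (coords {..<Suc n})"
  shows "\<exists>F\<in>polys_over (subalg (coords {..<n})). poly F (\<lambda>x. x n) = f"
  using assms
proof induction
  case (subalg_const c)
  show ?case by (rule bexI[of _ "[:\<lambda>_. c:]"])
    (auto simp: polys_over_def coeff_pCons fun_eq_iff intro: subalg_intros subalg_fun_intros
      split: nat.split)
next
  case (subalg_base \<phi>)
  then obtain i where i: "i < Suc n" "\<phi> = (\<lambda>x. x i)" by (auto simp: coords_def)
  show ?case
  proof (cases "i = n")
    case True
    then show ?thesis using i by (intro bexI[of _ "[:0, 1:]"])
      (auto simp: polys_over_def coeff_pCons fun_eq_iff intro: subalg_fun_intros split: nat.split)
  next
    case False
    then show ?thesis using i by (intro bexI[of _ "[:\<lambda>x. x i:]"])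
      (auto simp: polys_over_def coeff_pCons fun_eq_iff intro: subalg_fun_intros split: nat.split)
  qed
next
  case (subalg_add f g)
  then obtain F G where "F \<in> polys_over (subalg (coords {..<n}))" "poly F (\<lambda>x. x n) = f"
    "G \<in> polys_over (subalg (coords {..<n}))" "poly G (\<lambda>x. x n) = g" by blast
  then show ?case
    by (intro bexI[of _ "F + G"])
      (simp_all add: polys_over_def subalg_fun_intros fun_eq_iff)
next
  case (subalg_mult f g)
  then obtain F G where F: "F \<in> polys_over (subalg (coords {..<n}))" "poly F (\<lambda>x. x n) = f"
    and G: "G \<in> polys_over (subalg (coords {..<n}))" "poly G (\<lambda>x. x n) = g" by blast
  have "F * G \<in> polys_over (subalg (coords {..<n}))"
    using F G by (auto simp: polys_over_def coeff_mult intro!: subalg_fun_sum subalg_fun_intros)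
  moreover have "poly (F * G) (\<lambda>x. x n) = (\<lambda>x. f x * g x)" using F G by (auto simp: times_fun_def)
  ultimately show ?case by blast
qed

abbreviation fibre :: "(nat \<Rightarrow> 'k) \<Rightarrow> ((nat \<Rightarrow> 'k::comm_ring_1) \<Rightarrow> 'k) poly \<Rightarrow> 'k poly" where
  "fibre a \<equiv> map_poly (\<lambda>c. c a)"

lemma coeff_fibre [simp]: "coeff (fibre a F) i = coeff F i a"
  by (simp add: coeff_map_poly)

lemma poly_fibre:
  assumes "F \<in> polys_over (subalg (coords {..<n}))"
  shows "poly (fibre a F) t = poly F (\<lambda>x. x n) (a(n := t))"
proof -
  have "degree (fibre a F) \<le> degree F" by (rule degree_le) (simp add: coeff_eq_0)
  then have "poly (fibre a F) t = (\<Sum>k\<le>degree F. coeff F k a * t ^ k)"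
    by (simp add: poly_eq_sum_le)
  also have "\<dots> = (\<Sum>k\<le>degree F. coeff F k (a(n := t)) * t ^ k)"
  proof (intro sum.cong refl)
    fix k
    have "coeff F k \<in> subalg (coords {..<n})" using assms by (auto simp: polys_over_def)
    then have "coeff F k a = coeff F k (a(n := t))" by (rule subalg_coords_cong) auto
    then show "coeff F k a * t ^ k = coeff F k (a(n := t)) * t ^ k" by simp
  qed
  also have "\<dots> = poly F (\<lambda>x. x n) (a(n := t))" by (simp add: poly_fun_apply[OF order_refl])
  finally show ?thesis .
qed

lemma last_polys_closed:
  assumes "ideal_of (Suc n) I"
  shows "last_polys n I \<subseteq> polys_over (subalg (coords {..<n}))"
    and "u \<in> last_polys n I \<Longrightarrow> v \<in> last_polys n I \<Longrightarrow> u - v \<in> last_polys n I"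
    and "u \<in> last_polys n I \<Longrightarrow> c \<in> subalg (coords {..<n}) \<Longrightarrow> smult c u \<in> last_polys n I"
    and "u \<in> last_polys n I \<Longrightarrow> monom 1 k * u \<in> last_polys n I"
    and "0 \<in> last_polys n I"
proof -
  show "last_polys n I \<subseteq> polys_over (subalg (coords {..<n}))" by (auto simp: last_polys_def)
  show "0 \<in> last_polys n I" using assms
    by (simp add: last_polys_def polys_over_def ideal_of_def zero_fun_def subalg_const)
  show "u - v \<in> last_polys n I" if "u \<in> last_polys n I" "v \<in> last_polys n I"
    using that ideal_of_diff[OF assms, of "poly u (\<lambda>x. x n)" "poly v (\<lambda>x. x n)"]
    by (simp add: last_polys_def polys_over_def subalg_fun_intros fun_diff_def[of "poly u (\<lambda>x. x n)"])
  show "smult c u \<in> last_polys n I" if "u \<in> last_polys n I" "c \<in> subalg (coords {..<n})"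
  proof -
    have "c \<in> subalg (coords {..<Suc n})" by (rule subalg_coords_mono[OF that(2)]) auto
    then have "(\<lambda>x. c x * poly u (\<lambda>x. x n) x) \<in> I"
      using that(1) by (intro ideal_ofD(4)[OF assms]) (simp add: last_polys_def)
    then show ?thesis using that
      by (simp add: last_polys_def polys_over_def subalg_fun_intros times_fun_def[of c "poly u (\<lambda>x. x n)"])
  qed
  show "monom 1 k * u \<in> last_polys n I" if "u \<in> last_polys n I"
  proof -
    have "(\<lambda>x :: nat \<Rightarrow> 'a. x n ^ k) \<in> subalg (coords {..<Suc n})" by (intro subalg_power subalg_coord) auto
    then have "(\<lambda>x. x n ^ k * poly u (\<lambda>x. x n) x) \<in> I"
      using that(1) by (intro ideal_ofD(4)[OF assms]) (simp add: last_polys_def)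
    moreover have "poly (monom 1 k * u) (\<lambda>x. x n) = (\<lambda>x. x n ^ k * poly u (\<lambda>x. x n) x)"
      by (simp add: poly_monom fun_eq_iff power_fun_apply)
    moreover have "monom 1 k * u \<in> polys_over (subalg (coords {..<n}))"
      using that by (simp add: last_polys_def polys_over_def coeff_monom_mult subalg_fun_intros)
    ultimately show ?thesis by (auto simp: last_polys_def)
  qed
qed

lemma last_polys_elimination:
  fixes I :: "((nat \<Rightarrow> 'k::field) \<Rightarrow> 'k) set"
  assumes "ideal_of (Suc n) I" "G \<in> last_polys n I" "degree G \<le> D" "coeff G D a \<noteq> 0"
    "F \<in> last_polys n I" "coeff F c a \<noteq> 0" "\<And>i. i > c \<Longrightarrow> coeff F i a = 0" "c \<le> D"
  shows "\<exists>H\<in>last_polys n I. degree H \<le> c \<and> coeff H c a \<noteq> 0"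
  by (rule elimination[where ev = "\<lambda>f. f a", OF _ _ last_polys_closed(1-4)[OF assms(1)] assms(2-8)]) auto

text \<open>Division with remainder by a nonzero element of least degree.\<close>

lemma poly_ideal_generator:
  fixes S :: "'k::field poly set"
  assumes "S \<noteq> {}" "\<And>p q. p \<in> S \<Longrightarrow> q \<in> S \<Longrightarrow> p - q \<in> S" "\<And>p q. p \<in> S \<Longrightarrow> q * p \<in> S"
  shows "\<exists>g\<in>S. \<forall>p\<in>S. g dvd p"
proof (cases "S \<subseteq> {0}")
  case True
  then show ?thesis using assms(1) by auto
next
  case False
  then obtain p0 where "p0 \<in> S \<and> p0 \<noteq> 0" by blast
  from ex_has_least_nat[of "\<lambda>g. g \<in> S \<and> g \<noteq> 0", OF this, of degree]
  obtain g where g: "g \<in> S" "g \<noteq> 0" "\<And>h. h \<in> S \<Longrightarrow> h \<noteq> 0 \<Longrightarrow> degree g \<le> degree h"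
    by blast
  have "g dvd p" if "p \<in> S" for p
  proof -
    have "p mod g = p - (p div g) * g" by (simp add: minus_div_mult_eq_mod)
    then have "p mod g \<in> S" using assms(2)[OF that assms(3)[OF g(1)]] by simp
    then have "p mod g = 0" using g(2) g(3)[of "p mod g"] degree_mod_less[of g p] by linarith
    then show ?thesis by auto
  qed
  with g(1) show ?thesis by blast
qed

text \<open>The restrictions to the line over \<open>a\<close> form an ideal of polynomials in one
  variable. It is principal, and its generator is itself the restriction of an element of
  \<open>I\<close>.\<close>

lemma fibre_generator:
  fixes I :: "((nat \<Rightarrow> 'k::field) \<Rightarrow> 'k) set"
  assumes "ideal_of (Suc n) I"
  shows "\<exists>F\<in>last_polys n I. \<forall>G\<in>last_polys n I. fibre a F dvd fibre a G"
proof -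
  note closed = last_polys_closed[OF assms]
  let ?S = "fibre a ` last_polys n I"
  have "\<exists>g\<in>?S. \<forall>p\<in>?S. g dvd p"
  proof (rule poly_ideal_generator)
    show "?S \<noteq> {}" using closed(5) by blast
    fix p assume "p \<in> ?S"
    then obtain F where F: "F \<in> last_polys n I" "p = fibre a F" by blast
    show "p - q \<in> ?S" if "q \<in> ?S" for q
    proof -
      from that obtain G where G: "G \<in> last_polys n I" "q = fibre a G" by blast
      have "p - q = fibre a (F - G)" using F G by (intro poly_eqI) simp
      then show ?thesis using closed(2)[OF F(1) G(1)] by blast
    qed
    show "q * p \<in> ?S" for q
    proof (induction q)
      case 0
      have "(0 :: 'k poly) = fibre a 0" by simp
      then show ?case using closed(5) by (metis image_eqI mult_zero_left)
    next
      case (pCons c q)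
      then obtain H where H: "H \<in> last_polys n I" "q * p = fibre a H" by blast
      let ?H = "smult (\<lambda>_. c) F - smult (\<lambda>_. -1) (monom 1 1 * H)"
      have "?H \<in> last_polys n I" using H F closed by (intro closed subalg_const) auto
      moreover have "pCons c q * p = smult c p + pCons 0 (q * p)" by simp
      then have "pCons c q * p = fibre a ?H"
        by (intro poly_eqI) (simp add: H(2)[unfolded F(2)] F(2) coeff_monom_mult coeff_pCons split: nat.split)
      ultimately show ?case by blast
    qed
  qed
  then show ?thesis by blast
qed

text \<open>Without a common zero over \<open>a\<close>, the generator of the restricted ideal has
  no root and is a nonzero constant. Elimination against \<open>G\<close>, whose top coefficient is
  nonzero at \<open>a\<close>, then lowers the degree in the last variable to 0.\<close>

lemma elimination_no_root:
  fixes I :: "((nat \<Rightarrow> 'k::alg_closed_field) \<Rightarrow> 'k) set"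
  assumes "ideal_of (Suc n) I" "G \<in> last_polys n I" "degree G \<le> D" "coeff G D a \<noteq> 0"
    "\<And>t. \<exists>f\<in>I. f (a(n := t)) \<noteq> 0"
  shows "\<exists>f\<in>I \<inter> subalg (coords {..<n}). f a \<noteq> 0"
proof -
  obtain F where F: "F \<in> last_polys n I" "\<And>H. H \<in> last_polys n I \<Longrightarrow> fibre a F dvd fibre a H"
    using fibre_generator[OF assms(1), of a] by blast
  have no_root: "poly (fibre a F) t \<noteq> 0" for t
  proof
    assume 0: "poly (fibre a F) t = 0"
    obtain f where f: "f \<in> I" "f (a(n := t)) \<noteq> 0" using assms(5) by blast
    have "f \<in> subalg (coords {..<Suc n})" by (rule ideal_ofD(1)[OF assms(1) f(1)])
    from subalg_Suc_poly[OF this] obtain H where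
      H: "H \<in> polys_over (subalg (coords {..<n}))" "poly H (\<lambda>x. x n) = f" by blast
    then have "H \<in> last_polys n I" using f(1) by (simp add: last_polys_def)
    then have "poly (fibre a H) t = 0" using F(2) 0 by (metis dvdE mult_zero_left poly_mult)
    then show False using poly_fibre[OF H(1), of a t] H(2) f(2) by simp
  qed
  then have "degree (fibre a F) = 0" using alg_closed_imp_poly_has_root by blast
  moreover have "fibre a F \<noteq> 0" using no_root by auto
  ultimately have c: "coeff (fibre a F) 0 \<noteq> 0" "\<And>i. i > 0 \<Longrightarrow> coeff (fibre a F) i = 0"
    using leading_coeff_0_iff[of "fibre a F"] coeff_eq_0[of "fibre a F"] by simp_all
  have "\<exists>H\<in>last_polys n I. degree H \<le> 0 \<and> coeff H 0 a \<noteq> 0"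
    by (rule last_polys_elimination[OF assms(1-4) F(1)]) (use c in simp_all)
  then obtain H where H: "H \<in> last_polys n I" "degree H \<le> 0" "coeff H 0 a \<noteq> 0" by blast
  then have "poly H (\<lambda>x. x n) = coeff H 0" by (simp add: poly_eq_sum_le[OF H(2)])
  then have "coeff H 0 \<in> I \<inter> subalg (coords {..<n})" using H(1) by (auto simp: last_polys_def polys_over_def)
  then show ?thesis using H(3) by blast
qed

section \<open>The Nullstellensatz and closed projections\<close>

definition shear :: "nat \<Rightarrow> (nat \<Rightarrow> 'k::comm_ring_1) \<Rightarrow> (nat \<Rightarrow> 'k) \<Rightarrow> nat \<Rightarrow> 'k" where
  "shear n \<eta> x = (\<lambda>i. if i < n then x i + \<eta> i * x n else x i)"

lemma shear_shear: "shear n (\<lambda>i. - \<eta> i) (shear n \<eta> x) = x" "shear n \<eta> (shear n (\<lambda>i. - \<eta> i) x) = x"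
  by (auto simp: shear_def)

lemma shear_affine: "x \<in> affine_space (Suc n) \<Longrightarrow> shear n \<eta> x \<in> affine_space (Suc n)"
  by (auto simp: shear_def affine_space_def)

lemma subalg_shear: "i \<le> n \<Longrightarrow> (\<lambda>x. shear n \<eta> x i) \<in> subalg (coords {..<Suc n})"
  unfolding shear_def by (cases "i < n") (auto intro!: subalg_intros)

text \<open>The case of \<open>leading_form\<close> without parameters: the top coefficient depends
  on no variable, hence equals its value at an arbitrary point, here
  \<open>undefined\<close>.\<close>

lemma monic_shear:
  fixes P :: "(nat \<Rightarrow> 'k::field_char_0) \<Rightarrow> 'k"
  assumes "P \<in> subalg (coords {..<Suc n})" "P c \<noteq> 0"
  shows "\<exists>\<eta> D G. G \<in> polys_over (subalg (coords {..<n})) \<and> degree G \<le> D \<and>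
    (\<forall>a. coeff G D a = coeff G D undefined) \<and> coeff G D undefined \<noteq> 0 \<and>
    (\<lambda>x. P (shear n \<eta> x)) = poly G (\<lambda>x. x n)"
proof -
  have eq: "{..<Suc n} - {n} = {..<n}" by auto
  obtain \<eta> D G where G: "\<forall>k. coeff G k \<in> subalg (coords {..<n})" "degree G \<le> D"
    "coeff G D \<in> subalg (coords {})" "\<exists>x. coeff G D x \<noteq> 0"
    "(\<lambda>x. P (\<lambda>i. if i \<in> {..<n} then x i + \<eta> i * x n else x i)) = poly G (\<lambda>x. x n)"
    using leading_form[of P "{}" "{..<Suc n}" c n] assms by (auto simp: eq)
  have *: "coeff G D a = coeff G D undefined" for a
    by (rule subalg_coords_cong[OF G(3)]) auto
  show ?thesis
  proof (intro exI conjI allI)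
    show "G \<in> polys_over (subalg (coords {..<n}))" using G(1) by (simp add: polys_over_def)
    show "coeff G D undefined \<noteq> 0" using G(4) * by metis
    show "(\<lambda>x. P (shear n \<eta> x)) = poly G (\<lambda>x. x n)" using G(5) by (simp add: shear_def)
  qed (use G * in auto)
qed

text \<open>The weak form, by induction on \<open>n\<close>: after a shear the ideal contains an
  element that is monic in the last variable up to a constant, so its elimination ideal in
  \<open>n\<close> variables has no common zero either.\<close>

theorem nullstellensatz:
  fixes I :: "((nat \<Rightarrow> 'k::{alg_closed_field, field_char_0}) \<Rightarrow> 'k) set"
  assumes "ideal_of n I" "\<And>x. \<exists>f\<in>I. f x \<noteq> 0"
  shows "(\<lambda>_. 1) \<in> I"
  using assms
proof (induction n arbitrary: I)
  case 0
  obtain f where f: "f \<in> I" "f undefined \<noteq> 0" using "0.prems"(2) by blast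
  have "f \<in> subalg (coords {})" using ideal_ofD(1)[OF "0.prems"(1) f(1)] by simp
  then have *: "f x = f undefined" for x by (rule subalg_coords_cong) auto
  have "(\<lambda>x. inverse (f undefined) * f x) \<in> I"
    by (rule ideal_ofD(4)[OF "0.prems"(1) f(1) subalg_const])
  also have "(\<lambda>x. inverse (f undefined) * f x) = (\<lambda>_. 1)"
    using f(2) by (subst *) simp
  finally show ?case .
next
  case (Suc n)
  obtain P where P: "P \<in> I" "P undefined \<noteq> 0" using Suc.prems(2) by blast
  have "P \<in> subalg (coords {..<Suc n})" by (rule ideal_ofD(1)[OF Suc.prems(1) P(1)])
  from monic_shear[OF this P(2)] obtain \<eta> D G where
    G: "G \<in> polys_over (subalg (coords {..<n}))" "degree G \<le> D"
    "\<forall>a. coeff G D a = coeff G D undefined" "coeff G D undefined \<noteq> 0"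
    "(\<lambda>x. P (shear n \<eta> x)) = poly G (\<lambda>x. x n)" by (elim exE conjE)
  have sub: "(\<lambda>x. f (shear n \<theta> x)) \<in> subalg (coords {..<Suc n})"
    if "f \<in> subalg (coords {..<Suc n})" for f :: "(nat \<Rightarrow> 'k) \<Rightarrow> 'k" and \<theta>
    by (rule subalg_coords_subst[OF that]) (rule subalg_shear, simp)
  define I' where "I' = {f. (\<lambda>x. f (shear n (\<lambda>i. - \<eta> i) x)) \<in> I}"
  have I': "ideal_of (Suc n) I'"
    unfolding ideal_of_def
  proof (intro conjI ballI subsetI)
    fix f assume "f \<in> I'"
    then have "(\<lambda>x. f (shear n (\<lambda>i. - \<eta> i) x)) \<in> subalg (coords {..<Suc n})"
      using ideal_ofD(1)[OF Suc.prems(1)] by (simp add: I'_def)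
    from sub[OF this, of \<eta>] show "f \<in> subalg (coords {..<Suc n})" by (simp add: shear_shear)
  next
    fix f g :: "(nat \<Rightarrow> 'k) \<Rightarrow> 'k" assume "f \<in> I'" "g \<in> subalg (coords {..<Suc n})"
    then show "(\<lambda>x. g x * f x) \<in> I'"
      using ideal_ofD(4)[OF Suc.prems(1) _ sub[of g]] by (simp add: I'_def)
  qed (simp_all add: I'_def ideal_ofD(2,3)[OF Suc.prems(1)])
  have "poly G (\<lambda>x. x n) \<in> I'"
    using P(1) unfolding I'_def G(5)[symmetric] by (simp add: shear_shear)
  then have GI: "G \<in> last_polys n I'" using G(1) by (simp add: last_polys_def)
  have nz: "\<exists>f\<in>I'. f x \<noteq> 0" for x
  proof -
    obtain f where f: "f \<in> I" "f (shear n \<eta> x) \<noteq> 0" using Suc.prems(2) by blast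
    then show ?thesis
      by (intro bexI[of _ "\<lambda>x. f (shear n \<eta> x)"]) (auto simp: I'_def shear_shear)
  qed
  let ?I = "I' \<inter> subalg (coords {..<n})"
  have "(\<lambda>_. 1) \<in> ?I"
  proof (rule Suc.IH)
    have sub': "f \<in> subalg (coords {..<n}) \<Longrightarrow> f \<in> subalg (coords {..<Suc n})"
      for f :: "(nat \<Rightarrow> 'k) \<Rightarrow> 'k" by (erule subalg_coords_mono) auto
    show "ideal_of n ?I"
      using ideal_ofD[OF I'] sub' by (simp add: ideal_of_def subalg_const subalg_add subalg_mult)
    show "\<exists>f\<in>?I. f x \<noteq> 0" for x
    proof (rule elimination_no_root[OF I' GI G(2)])
      show "coeff G D x \<noteq> 0" using G(3,4) by metis
    qed (rule nz)
  qed
  then show ?case by (simp add: I'_def)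
qed

text \<open>If no point of \<open>W\<close> lies over \<open>y\<close>, elimination provides an
  equation of \<open>W\<close> in the first \<open>n\<close> variables that does not vanish at
  \<open>y\<close>. Without an equation like \<open>G\<close> the image need not be closed, as for a
  hyperbola projected along an asymptote.\<close>

lemma closed_projection:
  fixes W :: "(nat \<Rightarrow> 'k::alg_closed_field) set"
  assumes "closedin (zariski (Suc n)) W" "G \<in> last_polys n (vanish (Suc n) W)" "degree G \<le> D"
    "\<And>a. coeff G D a \<noteq> 0"
  shows "closedin (zariski n) ((\<lambda>x. x(n := 0)) ` W)"
proof -
  let ?V = "vanish (Suc n) W" and ?pr = "\<lambda>x :: nat \<Rightarrow> 'k. x(n := 0)"
  let ?S = "?V \<inter> subalg (coords {..<n})"
  have "?pr ` W = {x \<in> affine_space n. \<forall>f\<in>?S. f x = 0}"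
  proof (intro equalityI subsetI)
    fix y assume "y \<in> ?pr ` W"
    then obtain x where x: "x \<in> W" "y = ?pr x" by blast
    have "y \<in> affine_space n"
      using closed_sub_affine[OF assms(1)] x by (auto simp: affine_space_def)
    moreover have "f y = 0" if "f \<in> ?S" for f
    proof -
      have "f y = f x" using that x(2) by (intro subalg_coords_cong[of f "{..<n}"]) auto
      then show ?thesis using that x(1) by (auto simp: vanish_def)
    qed
    ultimately show "y \<in> {x \<in> affine_space n. \<forall>f\<in>?S. f x = 0}" by blast
  next
    fix y assume y: "y \<in> {x \<in> affine_space n. \<forall>f\<in>?S. f x = 0}"
    show "y \<in> ?pr ` W"
    proof (rule ccontr)
      assume ny: "y \<notin> ?pr ` W"
      have "\<exists>f\<in>?V. f (y(n := t)) \<noteq> 0" for t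
      proof (rule ccontr)
        assume "\<not> ?thesis"
        then have "y(n := t) \<in> W"
          using y by (intro closed_memI[OF assms(1)]) (auto simp: affine_space_def)
        moreover have "?pr (y(n := t)) = y" using y by (auto simp: affine_space_def)
        ultimately have "y \<in> ?pr ` W" by (metis image_eqI)
        then show False using ny by contradiction
      qed
      from elimination_no_root[OF ideal_of_vanish assms(2,3,4) this]
      show False using y by blast
    qed
  qed
  then show ?thesis by (simp add: closedin_zariskiI)
qed

section \<open>Noetherian rings of polynomial functions\<close>

text \<open>The ring is a subset \<open>A\<close> of a type, so that it can consist of the functions
  of the first \<open>n\<close> variables only.\<close>

inductive_set idl :: "'r::comm_ring_1 set \<Rightarrow> 'r set \<Rightarrow> 'r set" for A S where
  idl_zero: "0 \<in> idl A S"
| idl_step: "x \<in> idl A S \<Longrightarrow> a \<in> A \<Longrightarrow> s \<in> S \<Longrightarrow> x + a * s \<in> idl A S"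

definition is_subring :: "'r::comm_ring_1 set \<Rightarrow> bool" where
  "is_subring A \<longleftrightarrow> 0 \<in> A \<and> 1 \<in> A \<and> (\<forall>a\<in>A. - a \<in> A) \<and> (\<forall>a\<in>A. \<forall>b\<in>A. a + b \<in> A \<and> a * b \<in> A)"

lemma idl_add: "y \<in> idl A S \<Longrightarrow> x \<in> idl A S \<Longrightarrow> x + y \<in> idl A S"
  by (induction rule: idl.induct) (auto simp flip: add.assoc intro: idl.intros)

lemma idl_mult: "is_subring A \<Longrightarrow> x \<in> idl A S \<Longrightarrow> c \<in> A \<Longrightarrow> c * x \<in> idl A S"
  by (rotate_tac, induction rule: idl.induct)
    (auto simp: distrib_left is_subring_def simp flip: mult.assoc intro: idl.intros)

lemma idl_base: "is_subring A \<Longrightarrow> s \<in> S \<Longrightarrow> s \<in> idl A S"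
  using idl_step[OF idl_zero, of 1 A s S] by (simp add: is_subring_def)

lemma idl_diff: "is_subring A \<Longrightarrow> x \<in> idl A S \<Longrightarrow> y \<in> idl A S \<Longrightarrow> x - y \<in> idl A S"
  using idl_add[OF idl_mult[of A y S "-1"], of x] by (simp add: is_subring_def)

lemma idl_trans: "x \<in> idl A S \<Longrightarrow> is_subring A \<Longrightarrow> S \<subseteq> idl A T \<Longrightarrow> x \<in> idl A T"
  by (induction rule: idl.induct) (auto intro: idl_zero idl_add idl_mult)

lemma idl_mono: "x \<in> idl A S \<Longrightarrow> S \<subseteq> T \<Longrightarrow> x \<in> idl A T"
  by (induction rule: idl.induct) (auto intro: idl.intros)

lemma idl_subset: "x \<in> idl A S \<Longrightarrow> is_subring A \<Longrightarrow> S \<subseteq> A \<Longrightarrow> x \<in> A"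
  by (induction rule: idl.induct) (auto simp: is_subring_def)

lemma idl_finite: "x \<in> idl A S \<Longrightarrow> \<exists>T\<subseteq>S. finite T \<and> x \<in> idl A T"
proof (induction rule: idl.induct)
  case (idl_step x a s)
  then obtain T where "T \<subseteq> S" "finite T" "x \<in> idl A T" by blast
  then show ?case using idl_step
    by (intro exI[of _ "insert s T"]) (auto intro: idl.idl_step idl_mono)
qed (auto intro: idl_zero)

definition noetherian :: "'r::comm_ring_1 set \<Rightarrow> bool" where
  "noetherian A \<longleftrightarrow> (\<forall>S\<subseteq>A. \<exists>T\<subseteq>S. finite T \<and> S \<subseteq> idl A T)"

lemma is_subring_polys_over: "is_subring A \<Longrightarrow> is_subring (polys_over A)"
proof -
  assume A: "is_subring A"
  have sum: "(\<Sum>i\<in>X. f i) \<in> A" if "\<And>i. i \<in> X \<Longrightarrow> f i \<in> A" for X :: "nat set" and f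
    using that A by (induction X rule: infinite_finite_induct) (auto simp: is_subring_def)
  show ?thesis using A unfolding is_subring_def polys_over_def
    by (auto simp: coeff_mult coeff_1 intro!: sum)
qed

text \<open>Otherwise there is a sequence of elements \<open>f k\<close>, each of least degree
  outside the ideal of its predecessors, so that degrees increase weakly. Some leading coefficient
  \<open>a N\<close> is a combination of earlier ones; a combination of earlier members then has the
  same leading term as \<open>f N\<close>, and the difference contradicts minimality.\<close>

theorem hilbert_basis:
  fixes A :: "'r::comm_ring_1 set"
  assumes A: "is_subring A" and noeth: "noetherian A"
  shows "noetherian (polys_over A)"
  unfolding noetherian_def
proof (intro allI impI)
  fix S :: "'r poly set" assume S: "S \<subseteq> polys_over A"
  let ?P = "polys_over A"
  note P = is_subring_polys_over[OF A]
  define I where "I = idl ?P S"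
  have IP: "I \<subseteq> ?P" using idl_subset[OF _ P S] by (auto simp: I_def)
  have sub: "idl ?P T \<subseteq> I" if "T \<subseteq> I" for T
    using idl_trans[OF _ P] that unfolding I_def by blast
  have "\<exists>T\<subseteq>I. finite T \<and> I \<subseteq> idl ?P T"
  proof (rule ccontr)
    assume contr: "\<not> ?thesis"
    define p where "p T = arg_min degree (\<lambda>f. f \<in> I \<and> f \<notin> idl ?P T)" for T
    have p: "p T \<in> I" "p T \<notin> idl ?P T" "\<And>f. f \<in> I \<Longrightarrow> f \<notin> idl ?P T \<Longrightarrow> degree (p T) \<le> degree f"
      if T: "T \<subseteq> I" "finite T" for T
    proof -
      have "\<not> I \<subseteq> idl ?P T"
      proof
        assume "I \<subseteq> idl ?P T"
        then have "\<exists>T\<subseteq>I. finite T \<and> I \<subseteq> idl ?P T" using T by (intro exI[of _ T] conjI)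
        with contr show False by contradiction
      qed
      then obtain f where "f \<in> I \<and> f \<notin> idl ?P T" by (auto simp: subset_iff)
      from arg_min_natI[of "\<lambda>f. f \<in> I \<and> f \<notin> idl ?P T", OF this, of degree]
      show "p T \<in> I" "p T \<notin> idl ?P T" by (simp_all add: p_def)
      show "degree (p T) \<le> degree f" if "f \<in> I" "f \<notin> idl ?P T" for f
        unfolding p_def using that
        by (intro arg_min_nat_le[of "\<lambda>f. f \<in> I \<and> f \<notin> idl ?P T"]) simp
    qed
    define T where "T k = rec_nat {} (\<lambda>_ T. insert (p T) T) k" for k :: nat
    define f where "f k = p (T k)" for k
    have T_Suc: "T (Suc k) = insert (f k) (T k)" for k by (simp add: T_def f_def)
    have T: "T k \<subseteq> I \<and> finite (T k) \<and> T k = f ` {..<k}" for k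
    proof (induction k)
      case (Suc k)
      then show ?case using p(1)[of "T k"] by (auto simp: T_Suc lessThan_Suc f_def)
    qed (simp add: T_def)
    have f: "f k \<in> I" "f k \<notin> idl ?P (T k)" "\<And>g. g \<in> I \<Longrightarrow> g \<notin> idl ?P (T k) \<Longrightarrow> degree (f k) \<le> degree g"
      for k
    proof -
      have t: "T k \<subseteq> I" "finite (T k)" using T[of k] by auto
      show "f k \<in> I" "f k \<notin> idl ?P (T k)" unfolding f_def by (rule p(1)[OF t], rule p(2)[OF t])
      show "degree (f k) \<le> degree g" if "g \<in> I" "g \<notin> idl ?P (T k)" for g
        unfolding f_def by (rule p(3)[OF t that])
    qed
    define a where "a k = lead_coeff (f k)" for k
    have "range a \<subseteq> A"
    proof (intro image_subsetI)
      fix k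
      have "f k \<in> polys_over A" using f(1)[of k] IP by blast
      then show "a k \<in> A" by (simp add: a_def polys_over_def)
    qed
    from noeth[unfolded noetherian_def, rule_format, OF this]
    obtain T0 where T0: "T0 \<subseteq> range a" "finite T0" "range a \<subseteq> idl A T0" by (elim exE conjE)
    obtain C where C: "finite C" "T0 = a ` C" using finite_subset_image[OF T0(2,1)] by blast
    obtain N where N: "C \<subseteq> {..<N}" using C(1) finite_nat_iff_bounded by blast
    have aN: "a N \<in> idl A (a ` {..<N})"
      using T0(3) idl_mono[of "a N" A T0 "a ` {..<N}"] C N by blast
    define d where "d = degree (f N)"
    have dk: "degree (f k) \<le> d" if "k < N" for k
    proof -
      have "T k \<subseteq> T N" using T that by auto
      then have "f N \<notin> idl ?P (T k)" using f(2)[of N] idl_mono by blast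
      then show ?thesis using f(3)[OF f(1)] by (simp add: d_def)
    qed
    have "\<exists>g\<in>idl ?P (T N). degree g \<le> d \<and> coeff g d = x" if "x \<in> idl A (a ` {..<N})" for x
      using that
    proof induction
      case idl_zero
      show ?case by (rule bexI[of _ 0]) (auto intro: idl.idl_zero)
    next
      case (idl_step x r s)
      then obtain g where g: "g \<in> idl ?P (T N)" "degree g \<le> d" "coeff g d = x" by blast
      obtain k where k: "k < N" "s = a k" using idl_step by blast
      let ?g = "g + monom r (d - degree (f k)) * f k"
      have "monom r (d - degree (f k)) \<in> ?P"
        using idl_step A by (auto simp: polys_over_def is_subring_def)
      moreover have "f k \<in> T N" using T k by auto
      ultimately have "?g \<in> idl ?P (T N)" by (rule idl.idl_step[OF g(1)])
      moreover have "degree ?g \<le> d"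
        using degree_mult_le[of "monom r (d - degree (f k))" "f k"]
          degree_monom_le[of r "d - degree (f k)"] dk[OF k(1)] g(2)
        by (intro degree_add_le) auto
      moreover have "coeff ?g d = x + r * s"
        using dk[OF k(1)] by (simp add: g(3) coeff_monom_mult k(2) a_def)
      ultimately show ?case by blast
    qed
    from this[OF aN] obtain g where g: "g \<in> idl ?P (T N)" "degree g \<le> d" "coeff g d = a N" by blast
    have gI: "g \<in> I" using g(1) sub T by blast
    have q: "f N - g \<in> I" "f N - g \<notin> idl ?P (T N)"
    proof -
      show "f N - g \<in> I" using f(1) gI idl_diff[OF P] by (simp add: I_def)
      show "f N - g \<notin> idl ?P (T N)"
      proof
        assume "f N - g \<in> idl ?P (T N)"
        from idl_add[OF g(1) this] f(2)[of N] show False by simp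
      qed
    qed
    have "coeff (f N - g) d = 0" using g(3) by (simp add: a_def d_def)
    moreover have "degree (f N - g) \<le> d" using g(2) by (intro degree_diff_le) (auto simp: d_def)
    moreover have "d \<le> degree (f N - g)" using f(3)[OF q] by (simp add: d_def)
    ultimately have "f N - g = 0" by (metis le_antisym leading_coeff_0_iff)
    with q(2) idl_zero show False by metis
  qed
  \<comment> \<open>\<open>T\<close> generates, but its members lie in the ideal rather than in
    \<open>S\<close>; each of them needs only finitely many members of \<open>S\<close>.\<close>
  then obtain T where T: "T \<subseteq> I" "finite T" "I \<subseteq> idl ?P T" by blast
  have "\<forall>t\<in>T. \<exists>U. U \<subseteq> S \<and> finite U \<and> t \<in> idl ?P U"
    using T(1) idl_finite unfolding I_def by blast
  from bchoice[OF this] obtain U where U: "\<forall>t\<in>T. U t \<subseteq> S \<and> finite (U t) \<and> t \<in> idl ?P (U t)" ..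
  have "T \<subseteq> idl ?P (\<Union>t\<in>T. U t)" using U idl_mono by blast
  then have "idl ?P T \<subseteq> idl ?P (\<Union>t\<in>T. U t)" using idl_trans[OF _ P] by blast
  moreover have "S \<subseteq> I" using idl_base[OF P] by (auto simp: I_def)
  ultimately have "S \<subseteq> idl ?P (\<Union>t\<in>T. U t)" using T(3) by blast
  then show "\<exists>T\<subseteq>S. finite T \<and> S \<subseteq> idl ?P T"
    using U T(2) by (intro exI[of _ "\<Union>t\<in>T. U t"]) auto
qed

lemma is_subring_subalg: "is_subring (subalg \<Phi>)"
  by (simp add: is_subring_def subalg_fun_intros)

lemma poly_last_subalg:
  assumes "F \<in> polys_over (subalg (coords {..<n}))"
  shows "poly F (\<lambda>x. x n) \<in> subalg (coords {..<Suc n})"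
proof -
  have "poly F (\<lambda>x. x n) = (\<lambda>x. \<Sum>k\<le>degree F. coeff F k x * x n ^ k)"
    by (rule ext) (simp add: poly_fun_apply[OF order_refl])
  also have "\<dots> \<in> subalg (coords {..<Suc n})"
  proof (intro subalg_sum subalg_mult subalg_power subalg_coord)
    fix k
    have "coeff F k \<in> subalg (coords {..<n})" using assms by (simp add: polys_over_def)
    then show "coeff F k \<in> subalg (coords {..<Suc n})" by (rule subalg_coords_mono) auto
  qed simp
  finally show ?thesis .
qed

text \<open>Evaluation at the last variable is a surjective homomorphism from the polynomials over
  the functions of the first \<open>n\<close> variables, and finite generation passes to images. For
  \<open>n = 0\<close> all functions are constant, and one nonzero element generates.\<close>

lemma noetherian_subalg: "noetherian (subalg (coords {..<n}) :: ((nat \<Rightarrow> 'k::field) \<Rightarrow> 'k) set)"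
proof (induction n)
  case 0
  show ?case unfolding noetherian_def
  proof (intro allI impI)
    fix S :: "((nat \<Rightarrow> 'k) \<Rightarrow> 'k) set" assume "S \<subseteq> subalg (coords {..<0})"
    then have const: "f x = f undefined" if "f \<in> S" for f x
      using that by (intro subalg_coords_cong[of f "{}"]) auto
    show "\<exists>T\<subseteq>S. finite T \<and> S \<subseteq> idl (subalg (coords {..<0})) T"
    proof (cases "S \<subseteq> {0}")
      case True
      then show ?thesis by (intro exI[of _ "{}"]) (auto intro: idl_zero)
    next
      case False
      then obtain s where s: "s \<in> S" "s \<noteq> 0" by blast
      then have s0: "s undefined \<noteq> 0" using const by (metis ext zero_fun_apply)
      have "f \<in> idl (subalg (coords {..<0})) {s}" if "f \<in> S" for f
      proof -
        have "f = 0 + (\<lambda>_. f undefined / s undefined) * s"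
        proof
          fix x
          have "f x = f undefined" "s x = s undefined" using const that s(1) by blast+
          with s0 show "f x = (0 + (\<lambda>_. f undefined / s undefined) * s) x" by simp
        qed
        also have "\<dots> \<in> idl (subalg (coords {..<0})) {s}"
          by (intro idl_step idl_zero subalg_const) simp
        finally show ?thesis .
      qed
      then show ?thesis using s(1) by (intro exI[of _ "{s}"]) auto
    qed
  qed
next
  case (Suc n)
  let ?A = "subalg (coords {..<n}) :: ((nat \<Rightarrow> 'k) \<Rightarrow> 'k) set"
  let ?B = "subalg (coords {..<Suc n}) :: ((nat \<Rightarrow> 'k) \<Rightarrow> 'k) set"
  let ?\<phi> = "\<lambda>F. poly F (\<lambda>x :: nat \<Rightarrow> 'k. x n)"
  from hilbert_basis[OF is_subring_subalg Suc] have noeth: "noetherian (polys_over ?A)" .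
  show ?case unfolding noetherian_def
  proof (intro allI impI)
    fix S :: "((nat \<Rightarrow> 'k) \<Rightarrow> 'k) set" assume S: "S \<subseteq> ?B"
    let ?S = "{F \<in> polys_over ?A. ?\<phi> F \<in> S}"
    obtain T where T: "T \<subseteq> ?S" "finite T" "?S \<subseteq> idl (polys_over ?A) T"
      using noeth[unfolded noetherian_def, rule_format, of ?S] by blast
    have *: "?\<phi> F \<in> idl ?B (?\<phi> ` T)" if "F \<in> idl (polys_over ?A) T" for F
      using that
    proof induction
      case (idl_step F a s)
      have "?\<phi> F + ?\<phi> a * ?\<phi> s \<in> idl ?B (?\<phi> ` T)"
        by (intro idl.idl_step poly_last_subalg imageI) (use idl_step in auto)
      then show ?case by (simp only: poly_add poly_mult)
    qed (simp add: idl_zero flip: zero_fun_def)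
    have "f \<in> idl ?B (?\<phi> ` T)" if f: "f \<in> S" for f
    proof -
      have "f \<in> ?B" using S f by blast
      from subalg_Suc_poly[OF this] obtain F where "F \<in> polys_over ?A" "?\<phi> F = f" by (elim bexE)
      then show ?thesis using *[of F] T(3) f by auto
    qed
    moreover have "?\<phi> ` T \<subseteq> S" using T(1) by blast
    ultimately show "\<exists>T\<subseteq>S. finite T \<and> S \<subseteq> idl ?B T"
      using T(2) by (intro exI[of _ "?\<phi> ` T"]) auto
  qed
qed

lemma finite_equations:
  fixes S :: "((nat \<Rightarrow> 'k::field) \<Rightarrow> 'k) set"
  assumes "S \<subseteq> subalg (coords {..<n})"
  shows "\<exists>T\<subseteq>S. finite T \<and> (\<forall>x. (\<forall>f\<in>T. f x = 0) \<longrightarrow> (\<forall>f\<in>S. f x = 0))"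
proof -
  obtain T where T: "T \<subseteq> S" "finite T" "S \<subseteq> idl (subalg (coords {..<n})) T"
    using noetherian_subalg[of n, unfolded noetherian_def, rule_format, OF assms] by blast
  have "f x = 0" if "f \<in> idl (subalg (coords {..<n})) T" "\<forall>g\<in>T. g x = 0" for f x
    using that(1) by induction (use that(2) in auto)
  with T show ?thesis by blast
qed

text \<open>The descending chain condition: the equations of all members of a descending sequence
  follow from finitely many, and these already hold at some stage, where the sequence becomes
  stationary.\<close>

lemma closed_minimal:
  fixes \<F> :: "(nat \<Rightarrow> 'k::field) set set"
  assumes "\<F> \<noteq> {}" "\<And>C. C \<in> \<F> \<Longrightarrow> closedin (zariski n) C"
  shows "\<exists>C\<in>\<F>. \<forall>C'\<in>\<F>. C' \<subseteq> C \<longrightarrow> C' = C"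
proof (rule ccontr)
  assume "\<not> ?thesis"
  then have "\<forall>C\<in>\<F>. \<exists>C'. C' \<in> \<F> \<and> C' \<subset> C" by blast
  from bchoice[OF this] obtain h where h: "\<forall>C\<in>\<F>. h C \<in> \<F> \<and> h C \<subset> C" ..
  obtain C0 where C0: "C0 \<in> \<F>" using assms(1) by blast
  define C where "C k = (h ^^ k) C0" for k
  have C: "C k \<in> \<F>" for k using C0 h by (induction k) (auto simp: C_def)
  have dec: "C (Suc k) \<subset> C k" for k using h C[of k] by (simp add: C_def)
  have mono: "C k \<subseteq> C m" if "m \<le> k" for k m
    using lift_Suc_antimono_le[of C, OF _ that] dec by blast
  define S where "S = (\<Union>k. vanish n (C k))"
  have "S \<subseteq> subalg (coords {..<n})" by (auto simp: S_def vanish_def)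
  from finite_equations[OF this] obtain T where
    T: "T \<subseteq> S" "finite T" "\<And>x. \<forall>f\<in>T. f x = 0 \<Longrightarrow> \<forall>f\<in>S. f x = 0" by blast
  have "\<forall>f\<in>T. \<exists>k. f \<in> vanish n (C k)" using T(1) by (auto simp: S_def)
  from bchoice[OF this] obtain k where k: "\<forall>f\<in>T. f \<in> vanish n (C (k f))" ..
  obtain K where K: "\<forall>f\<in>T. k f \<le> K"
    using T(2) finite_nat_set_iff_bounded_le[of "k ` T"] by auto
  have "C K \<subseteq> C (Suc K)"
  proof
    fix x assume x: "x \<in> C K"
    have "\<forall>f\<in>T. f x = 0"
    proof
      fix f assume f: "f \<in> T"
      then have "x \<in> C (k f)" using x K mono by blast
      then show "f x = 0" using k f by (auto simp: vanish_def)
    qed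
    then have "\<forall>f\<in>S. f x = 0" by (rule T(3))
    moreover have "x \<in> affine_space n" using closed_sub_affine[OF assms(2)[OF C]] x by blast
    ultimately show "x \<in> C (Suc K)"
      by (intro closed_memI[OF assms(2)[OF C]]) (auto simp: S_def)
  qed
  with dec[of K] show False by blast
qed

section \<open>Noether normalization and dimension\<close>

text \<open>Division by the relation writes a function of degree \<open>s\<close> on
  \<open>Z\<close> as a combination of the powers \<open>x n ^ i\<close> with \<open>i < D\<close>,
  with coefficients of degree at most \<open>M * s\<close> in the first \<open>n\<close>
  coordinates. This changes the size of the spanning sets by a constant factor only.\<close>

lemma hdim_le_monic:
  fixes Z :: "(nat \<Rightarrow> 'k::field) set"
  assumes "hdim_le ((\<lambda>x. x(n := 0)) ` Z) (coords {..<n}) e" "Z \<noteq> {}"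
    and G: "G \<in> polys_over (subalg (coords {..<n}))" "degree G \<le> D" "\<And>a. coeff G D a = g" "g \<noteq> 0"
    and van: "\<And>x. x \<in> Z \<Longrightarrow> poly G (\<lambda>x. x n) x = 0"
  shows "hdim_le Z (coords {..<Suc n}) e"
proof -
  let ?pr = "\<lambda>x :: nat \<Rightarrow> 'k. x(n := 0)"
  have rel: "x n ^ D = - (\<Sum>i<D. inverse g * coeff G i x * x n ^ i)" if "x \<in> Z" for x
  proof -
    have "(\<Sum>i<D. coeff G i x * x n ^ i) + g * x n ^ D = 0"
      using van[OF that] by (simp add: poly_fun_apply[OF G(2)] G(3) flip: lessThan_Suc_atMost)
    then have "inverse g * ((\<Sum>i<D. coeff G i x * x n ^ i) + g * x n ^ D) = 0" by simp
    then have "(\<Sum>i<D. inverse g * coeff G i x * x n ^ i) + x n ^ D = 0"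
      using G(4) by (simp add: distrib_left sum_distrib_left flip: mult.assoc)
    then show ?thesis by (simp add: eq_neg_iff_add_eq_0 add.commute)
  qed
  have D: "D > 0"
  proof (rule ccontr)
    assume "\<not> D > 0"
    obtain x where "x \<in> Z" using assms(2) by blast
    from rel[OF this] \<open>\<not> D > 0\<close> show False by simp
  qed
  obtain M0 where M0: "\<And>i. i < D \<Longrightarrow> deg_le (coords {..<n}) M0 (coeff G i)"
    using subalg_common_degree[of "{..<D}" "coeff G" "coords {..<n}"] G(1)
    by (auto simp: polys_over_def)
  \<comment> \<open>The extra 1 absorbs multiplication by one of the first \<open>n\<close>
    coordinates: \<open>Suc (M * s) \<le> M * Suc s\<close>.\<close>
  define M where "M = Suc M0"
  have M: "deg_le (coords {..<n}) M (coeff G i)" if "i < D" for i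
    using deg_le_mono[OF M0[OF that]] by (simp add: M_def)
  have reduce: "\<exists>F. (\<forall>i<D. deg_le (coords {..<n}) (M * s) (F i)) \<and>
      (\<forall>x\<in>Z. f x = (\<Sum>i<D. F i x * x n ^ i))" if "deg_le (coords {..<Suc n}) s f" for s f
    using that
  proof induction
    case (deg_le_const s c)
    have "(\<Sum>i<D. (if i = 0 then c else 0) * x n ^ i) = c" for x :: "nat \<Rightarrow> 'k"
    proof -
      have "(\<Sum>i<D. (if i = 0 then c else 0) * x n ^ i) = (\<Sum>i<D. if i = 0 then c else 0)"
        by (intro sum.cong) auto
      then show ?thesis using D by simp
    qed
    then show ?case
      by (intro exI[of _ "\<lambda>i _. if i = 0 then c else 0"]) (auto intro: deg_le.intros)
  next
    case (deg_le_add s f f')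
    then obtain F F' where F: "\<forall>i<D. deg_le (coords {..<n}) (M * s) (F i)"
      "\<forall>x\<in>Z. f x = (\<Sum>i<D. F i x * x n ^ i)" "\<forall>i<D. deg_le (coords {..<n}) (M * s) (F' i)"
      "\<forall>x\<in>Z. f' x = (\<Sum>i<D. F' i x * x n ^ i)" by blast
    show ?case
    proof (intro exI[of _ "\<lambda>i x. F i x + F' i x"] conjI allI impI ballI)
      show "deg_le (coords {..<n}) (M * s) (\<lambda>x. F i x + F' i x)" if "i < D" for i
        using F that by (intro deg_le.deg_le_add) auto
    qed (use F in \<open>simp add: distrib_right sum.distrib\<close>)
  next
    case (deg_le_Suc \<phi> s f)
    then obtain F where F: "\<And>i. i < D \<Longrightarrow> deg_le (coords {..<n}) (M * s) (F i)"
      "\<And>x. x \<in> Z \<Longrightarrow> f x = (\<Sum>i<D. F i x * x n ^ i)" by blast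
    from deg_le_Suc(1) obtain j where j: "j < Suc n" "\<phi> = (\<lambda>x. x j)" by (auto simp: coords_def)
    show ?case
    proof (cases "j < n")
      case True
      show ?thesis
      proof (intro exI[of _ "\<lambda>i x. x j * F i x"] conjI allI impI ballI)
        fix i assume "i < D"
        then have "deg_le (coords {..<n}) (Suc (M * s)) (\<lambda>x. x j * F i x)"
          using True F(1) by (intro deg_le.deg_le_Suc) auto
        then show "deg_le (coords {..<n}) (M * Suc s) (\<lambda>x. x j * F i x)"
          by (rule deg_le_mono) (simp add: M_def)
      qed (simp add: j F(2) sum_distrib_left mult.assoc)
    next
      case False
      then have j: "\<phi> = (\<lambda>x. x n)" using j by (simp add: less_Suc_eq)
      \<comment> \<open>Multiplication by \<open>x n\<close> shifts the coefficients by one, and the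
        resulting power \<open>x n ^ D\<close> is rewritten by the relation.\<close>
      define F' where "F' i x = (if i = 0 then 0 else F (i - 1) x) +
        (- inverse g) * (F (D - 1) x * coeff G i x)" for i x
      show ?thesis
      proof (intro exI[of _ F'] conjI allI impI ballI)
        fix i assume i: "i < D"
        have "deg_le (coords {..<n}) (M * s + M) (\<lambda>x. if i = 0 then 0 else F (i - 1) x)"
          by (cases "i = 0") (use i in \<open>auto intro: deg_le.intros deg_le_mono[OF F(1)]\<close>)
        moreover have "deg_le (coords {..<n}) (M * s + M) (\<lambda>x. F (D - 1) x * coeff G i x)"
          using D i by (intro deg_le_mult F M) auto
        ultimately have "deg_le (coords {..<n}) (M * s + M) (F' i)"
          unfolding F'_def[abs_def] by (intro deg_le.deg_le_add deg_le_scale)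
        then show "deg_le (coords {..<n}) (M * Suc s) (F' i)" by (simp add: add.commute)
      next
        fix x assume x: "x \<in> Z"
        obtain D' where D': "D = Suc D'" using D by (cases D) auto
        have "\<phi> x * f x = (\<Sum>i<D. F i x * x n ^ Suc i)"
          by (simp add: j F(2)[OF x] sum_distrib_left mult_ac)
        also have "\<dots> = (\<Sum>i<D'. F i x * x n ^ Suc i) + F D' x * x n ^ D" by (simp add: D')
        also have "(\<Sum>i<D'. F i x * x n ^ Suc i) = (\<Sum>i<D. (if i = 0 then 0 else F (i - 1) x) * x n ^ i)"
          unfolding D' by (subst sum.lessThan_Suc_shift) simp
        also have "F D' x * x n ^ D = (\<Sum>i<D. (- inverse g) * (F (D - 1) x * coeff G i x) * x n ^ i)"
        proof -
          have "D - 1 = D'" by (simp add: D')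
          moreover have "F D' x * x n ^ D = - (\<Sum>i<D. F D' x * (inverse g * coeff G i x * x n ^ i))"
            by (subst rel[OF x]) (simp only: mult_minus_right sum_distrib_left)
          ultimately show ?thesis by (simp only: sum_negf[symmetric]) (intro sum.cong refl, simp)
        qed
        finally show "\<phi> x * f x = (\<Sum>i<D. F' i x * x n ^ i)"
          by (simp add: F'_def left_diff_distrib sum_subtractf sum_negf)
      qed
    qed
  qed
  obtain C B where "\<forall>s. finite (B s) \<and> card (B s) \<le> C * (s + 1) ^ e \<and>
      (\<forall>f. deg_le (coords {..<n}) s f \<longrightarrow> f \<in> span_on (?pr ` Z) (B s))"
    using hdim_leD[OF assms(1)] by (elim exE)
  then have B: "finite (B s)" "card (B s) \<le> C * (s + 1) ^ e"
    "deg_le (coords {..<n}) s f \<Longrightarrow> f \<in> span_on (?pr ` Z) (B s)" for s f by blast+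
  define P where "P = (\<lambda>i (t::'k). t ^ i) ` {..<D}"
  define \<sigma> where "\<sigma> x = (?pr x, x n)" for x
  define E where "E s = (\<lambda>b x. b (\<sigma> x)) ` (\<lambda>(b, b') p. b (fst p) * b' (snd p)) ` (B (M * s) \<times> P)" for s
  have "finite (E s) \<and> card (E s) \<le> (C * (M + 1) ^ e * D) * (s + 1) ^ e \<and>
      (\<forall>f. deg_le (coords {..<Suc n}) s f \<longrightarrow> f \<in> span_on Z (E s))" for s
  proof (intro conjI allI impI)
    have finP: "finite P" "card P \<le> D" using card_image_le[of "{..<D}"] by (auto simp: P_def)
    show "finite (E s)" using B(1) finP by (simp add: E_def)
    have "card (E s) \<le> card (B (M * s) \<times> P)"
      unfolding E_def by (rule order_trans[OF card_image_le card_image_le]) (use B(1) finP in auto)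
    also have "\<dots> \<le> C * (M * s + 1) ^ e * D"
      unfolding card_cartesian_product by (intro mult_mono B finP) auto
    also have "C * (M * s + 1) ^ e \<le> C * ((M + 1) * (s + 1)) ^ e"
      by (intro mult_left_mono power_mono) (auto simp: algebra_simps)
    then have "C * (M * s + 1) ^ e * D \<le> C * ((M + 1) * (s + 1)) ^ e * D" by simp
    also have "\<dots> = (C * (M + 1) ^ e * D) * (s + 1) ^ e" by (simp only: power_mult_distrib mult_ac)
    finally show "card (E s) \<le> (C * (M + 1) ^ e * D) * (s + 1) ^ e" .
    fix f :: "(nat \<Rightarrow> 'k) \<Rightarrow> 'k" assume "deg_le (coords {..<Suc n}) s f"
    from reduce[OF this] obtain F where F: "\<forall>i<D. deg_le (coords {..<n}) (M * s) (F i)"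
      "\<forall>x\<in>Z. f x = (\<Sum>i<D. F i x * x n ^ i)" by blast
    then have "\<forall>i\<in>{..<D}. \<exists>h. h \<in> fvs.span (B (M * s)) \<and> (\<forall>x\<in>?pr ` Z. F i x = h x)"
      using B(3)[of "M * s"] unfolding span_on_def by blast
    from bchoice[OF this] obtain h where
      h: "\<forall>i\<in>{..<D}. h i \<in> fvs.span (B (M * s)) \<and> (\<forall>x\<in>?pr ` Z. F i x = h i x)" ..
    have "(\<lambda>x. h i (?pr x) * x n ^ i) \<in> fvs.span (E s)" if "i < D" for i
    proof -
      have "h i \<in> fvs.span (B (M * s))" "(\<lambda>t. t ^ i) \<in> fvs.span P"
        using h that by (auto simp: P_def intro: fvs.span_base)
      from span_comp[OF span_tensor[OF this], of \<sigma>] show ?thesis by (simp add: E_def \<sigma>_def)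
    qed
    then have "(\<Sum>i<D. (\<lambda>x. h i (?pr x) * x n ^ i)) \<in> fvs.span (E s)"
      by (intro fvs.span_sum) simp
    moreover have "f x = (\<Sum>i<D. (\<lambda>x. h i (?pr x) * x n ^ i)) x" if x: "x \<in> Z" for x
    proof -
      have "F i x = h i (?pr x)" if "i < D" for i
      proof -
        have "F i \<in> subalg (coords {..<n})" using F(1) that deg_le_imp_subalg by blast
        then have "F i x = F i (?pr x)" by (rule subalg_coords_cong) auto
        then show ?thesis using h that x by auto
      qed
      then show ?thesis using F(2) x by (simp add: sum_fun_apply)
    qed
    ultimately show "f \<in> span_on Z (E s)" unfolding span_on_def by blast
  qed
  then show ?thesis unfolding hdim_le_def by (intro exI[of _ "C * (M + 1) ^ e * D"] allI exI)
qed

text \<open>A finite surjection onto affine space, of which topology and growth are recorded: \<pi>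
  is closed and continuous on \<open>Z\<close>, and \<open>Z\<close> grows no faster than its image.
  A proper closed subset satisfies some equation \<open>P\<close>, a shear makes \<open>P\<close>
  monic in the last variable up to a constant, and the projection that forgets this variable is
  treated by induction.\<close>

theorem noether_normalization:
  fixes Z :: "(nat \<Rightarrow> 'k::{alg_closed_field, field_char_0}) set"
  assumes "closedin (zariski n) Z" "Z \<noteq> {}"
  shows "\<exists>e (\<pi> :: (nat \<Rightarrow> 'k) \<Rightarrow> nat \<Rightarrow> 'k). \<pi> ` Z = affine_space e \<and>
    (\<forall>W. W \<subseteq> Z \<longrightarrow> closedin (zariski n) W \<longrightarrow> closedin (zariski e) (\<pi> ` W)) \<and>
    (\<forall>W. closedin (zariski e) W \<longrightarrow> closedin (zariski n) {z \<in> Z. \<pi> z \<in> W}) \<and>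
    hdim_le Z (coords {..<n}) e"
  using assms
proof (induction n arbitrary: Z)
  case (0 Z)
  have aff: "affine_space 0 = {(\<lambda>_. 0) :: nat \<Rightarrow> 'k}" by (auto simp: affine_space_def)
  have Z: "Z = affine_space 0" using closed_sub_affine[OF 0(1)] 0(2) unfolding aff by blast
  show ?case
  proof (intro exI[of _ "0::nat"] exI[of _ id] conjI allI impI)
    show "closedin (zariski 0) {z \<in> Z. id z \<in> W}" if "closedin (zariski 0) W" for W
      using closedin_Int[OF 0(1) that] by (simp add: Int_def)
    show "hdim_le Z (coords {..<0}) 0" using hdim_le_coords[of "{..<0}" Z] by simp
  qed (use Z in auto)
next
  case (Suc n Z)
  show ?case
  proof (cases "Z = affine_space (Suc n)")
    case True
    show ?thesis
    proof (intro exI[of _ "Suc n"] exI[of _ id] conjI allI impI)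
      show "closedin (zariski (Suc n)) {z \<in> Z. id z \<in> W}" if "closedin (zariski (Suc n)) W" for W
        using closedin_Int[OF Suc.prems(1) that] by (simp add: Int_def)
      show "hdim_le Z (coords {..<Suc n}) (Suc n)" using hdim_le_coords[of "{..<Suc n}" Z] by simp
    qed (use True in auto)
  next
    case False
    then obtain x where "x \<in> affine_space (Suc n)" "x \<notin> Z"
      using closed_sub_affine[OF Suc.prems(1)] by blast
    then obtain P where P: "P \<in> vanish (Suc n) Z" "P x \<noteq> 0"
      using closed_memI[OF Suc.prems(1)] by blast
    then have "P \<in> subalg (coords {..<Suc n})" by (simp add: vanish_def)
    from monic_shear[OF this P(2)] obtain \<eta> D G where
      G: "G \<in> polys_over (subalg (coords {..<n}))" "degree G \<le> D"
      "\<forall>a. coeff G D a = coeff G D undefined" "coeff G D undefined \<noteq> 0"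
      "(\<lambda>x. P (shear n \<eta> x)) = poly G (\<lambda>x. x n)" by (elim exE conjE)
    have Gnz: "coeff G D a \<noteq> 0" for a using G(3,4) by metis
    let ?pr = "\<lambda>x :: nat \<Rightarrow> 'k. x(n := 0)"
    define \<tau> where "\<tau> = shear n (\<lambda>i. - \<eta> i)"
    have \<tau>: "\<tau> (shear n \<eta> y) = y" "shear n \<eta> (\<tau> y) = y" for y by (simp_all add: \<tau>_def shear_shear)
    have \<tau>_img: "\<tau> ` W = {y \<in> affine_space (Suc n). shear n \<eta> y \<in> W}" if "W \<subseteq> affine_space (Suc n)" for W
    proof (intro equalityI subsetI)
      fix y assume "y \<in> \<tau> ` W"
      then obtain w where "w \<in> W" "y = \<tau> w" by blast
      then show "y \<in> {y \<in> affine_space (Suc n). shear n \<eta> y \<in> W}"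
        using that \<tau>(2)[of w] shear_affine[of w n] by (auto simp: \<tau>_def)
    next
      fix y assume "y \<in> {y \<in> affine_space (Suc n). shear n \<eta> y \<in> W}"
      then show "y \<in> \<tau> ` W" using \<tau>(1)[of y] by (metis (mono_tags, lifting) image_eqI mem_Collect_eq)
    qed
    have \<tau>_closed: "closedin (zariski (Suc n)) (\<tau> ` W)" if "closedin (zariski (Suc n)) W" for W
      unfolding \<tau>_img[OF closed_sub_affine[OF that]]
      by (rule closedin_zariski_vimage[OF that]) (auto intro: subalg_shear shear_affine)
    define Z' where "Z' = ?pr ` \<tau> ` Z"
    have proj: "closedin (zariski n) (?pr ` \<tau> ` W)" if W: "W \<subseteq> Z" "closedin (zariski (Suc n)) W" for W
    proof (rule closed_projection[OF \<tau>_closed[OF W(2)] _ G(2) Gnz])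
      have "poly G (\<lambda>x. x n) \<in> vanish (Suc n) (\<tau> ` W)"
        unfolding vanish_def
      proof (intro CollectI conjI ballI)
        show "poly G (\<lambda>x. x n) \<in> subalg (coords {..<Suc n})" by (rule poly_last_subalg[OF G(1)])
        fix y assume "y \<in> \<tau> ` W"
        then obtain w where w: "w \<in> Z" "y = \<tau> w" using W(1) by blast
        have "poly G (\<lambda>x. x n) y = P (shear n \<eta> y)" by (simp only: G(5)[symmetric])
        also have "\<dots> = 0" using P(1) w by (simp add: \<tau> vanish_def)
        finally show "poly G (\<lambda>x. x n) y = 0" .
      qed
      then show "G \<in> last_polys n (vanish (Suc n) (\<tau> ` W))" using G(1) by (simp add: last_polys_def)
    qed
    have "closedin (zariski n) Z'" unfolding Z'_def by (rule proj[OF order_refl Suc.prems(1)])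
    moreover have "Z' \<noteq> {}" using Suc.prems(2) by (simp add: Z'_def)
    ultimately obtain e and \<pi> :: "(nat \<Rightarrow> 'k) \<Rightarrow> nat \<Rightarrow> 'k" where \<pi>: "\<pi> ` Z' = affine_space e"
      "\<And>W. W \<subseteq> Z' \<Longrightarrow> closedin (zariski n) W \<Longrightarrow> closedin (zariski e) (\<pi> ` W)"
      "\<And>W. closedin (zariski e) W \<Longrightarrow> closedin (zariski n) {z \<in> Z'. \<pi> z \<in> W}"
      "hdim_le Z' (coords {..<n}) e" using Suc.IH[of Z'] by blast
    show ?thesis
    proof (intro exI[of _ e] exI[of _ "\<lambda>z. \<pi> (?pr (\<tau> z))"] conjI allI impI)
      show "(\<lambda>z. \<pi> (?pr (\<tau> z))) ` Z = affine_space e" using \<pi>(1) by (simp add: Z'_def image_image)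
    next
      fix W assume W: "W \<subseteq> Z" "closedin (zariski (Suc n)) W"
      have "closedin (zariski e) (\<pi> ` ?pr ` \<tau> ` W)"
        by (rule \<pi>(2)[OF _ proj[OF W]]) (use W(1) in \<open>auto simp: Z'_def\<close>)
      then show "closedin (zariski e) ((\<lambda>z. \<pi> (?pr (\<tau> z))) ` W)" by (simp add: image_image)
    next
      fix W :: "(nat \<Rightarrow> 'k) set" assume "closedin (zariski e) W"
      from \<pi>(3)[OF this] have "closedin (zariski (Suc n))
          {x \<in> affine_space (Suc n). ?pr (\<tau> x) \<in> {z \<in> Z'. \<pi> z \<in> W}}"
      proof (rule closedin_zariski_vimage[where h = "\<lambda>x. ?pr (\<tau> x)"])
        fix i assume "i < n"
        then have "(\<lambda>x. ?pr (\<tau> x) i) = (\<lambda>x. shear n (\<lambda>i. - \<eta> i) x i)" by (simp add: \<tau>_def)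
        then show "(\<lambda>x. ?pr (\<tau> x) i) \<in> subalg (coords {..<Suc n})"
          using subalg_shear[of i n "\<lambda>i. - \<eta> i"] \<open>i < n\<close> by simp
      next
        fix x :: "nat \<Rightarrow> 'k" assume "x \<in> affine_space (Suc n)"
        from shear_affine[OF this, of "\<lambda>i. - \<eta> i"] show "?pr (\<tau> x) \<in> affine_space n"
          by (auto simp: \<tau>_def affine_space_def)
      qed
      from closedin_Int[OF Suc.prems(1) this]
      show "closedin (zariski (Suc n)) {z \<in> Z. \<pi> (?pr (\<tau> z)) \<in> W}"
      proof (rule back_subst[of "closedin (zariski (Suc n))"])
        show "Z \<inter> {x \<in> affine_space (Suc n). ?pr (\<tau> x) \<in> {z \<in> Z'. \<pi> z \<in> W}} = {z \<in> Z. \<pi> (?pr (\<tau> z)) \<in> W}"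
          using closed_sub_affine[OF Suc.prems(1)] by (auto simp: Z'_def)
      qed
    next
      have "hdim_le (\<tau> ` Z) (coords {..<Suc n}) e"
      proof (rule hdim_le_monic[OF \<pi>(4)[unfolded Z'_def] _ G(1,2) _ G(4)])
        show "coeff G D a = coeff G D undefined" for a using G(3) by blast
        show "poly G (\<lambda>x. x n) y = 0" if "y \<in> \<tau> ` Z" for y
        proof -
          have "poly G (\<lambda>x. x n) y = P (shear n \<eta> y)" by (simp only: G(5)[symmetric])
          then show ?thesis using P(1) that by (auto simp: \<tau> vanish_def)
        qed
      qed (use Suc.prems(2) in simp)
      then show "hdim_le Z (coords {..<Suc n}) e"
      proof (rule hdim_le_image[where h = "shear n \<eta>" and k = 1])
        fix \<psi> :: "(nat \<Rightarrow> 'k) \<Rightarrow> 'k" assume "\<psi> \<in> coords {..<Suc n}"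
        then obtain i where i: "i < Suc n" "\<psi> = (\<lambda>x. x i)" by (auto simp: coords_def)
        have c: "deg_le (coords {..<Suc n}) (Suc 0) (\<lambda>x :: nat \<Rightarrow> 'k. x j)" if "j < Suc n" for j
          using deg_le_base[of "\<lambda>x. x j" "coords {..<Suc n}"] that by auto
        show "deg_le (coords {..<Suc n}) 1 (\<lambda>x. \<psi> (shear n \<eta> x))"
          unfolding i(2) shear_def using i(1)
          by (cases "i < n") (auto intro!: deg_le_add deg_le_scale c)
      next
        show "Z \<subseteq> shear n \<eta> ` \<tau> ` Z" by (auto simp: \<tau> image_image)
      qed
    qed
  qed
qed

section \<open>Comparison with the Krull dimension\<close>

lemma affine_space_closed: "i \<le> e \<Longrightarrow> closedin (zariski e) (affine_space i :: (nat \<Rightarrow> 'k::field) set)"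
proof -
  assume "i \<le> e"
  then have "affine_space i = {x \<in> affine_space e. \<forall>f\<in>coords {i..<e}. f x = (0 :: 'k)}"
    by (auto simp: affine_space_def coords_def)
  also have "closedin (zariski e) \<dots>"
    by (rule closedin_zariskiI) (auto simp: coords_def[of "{i..<e}"])
  finally show ?thesis .
qed

lemma affine_space_irreducible:
  fixes P Q :: "(nat \<Rightarrow> 'k::field_char_0) set"
  assumes "closedin (zariski e) P" "closedin (zariski e) Q" "P \<union> Q = affine_space i" "i \<le> e"
  shows "P = affine_space i \<or> Q = affine_space i"
proof (rule ccontr)
  \<comment> \<open>Composition with the truncation turns the equations into polynomials on the
    whole function space, where two nonvanishing conditions can be met at once.\<close>
  define tr where "tr x j = (if j < i then x j else 0)" for x :: "nat \<Rightarrow> 'k" and j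
  have tr: "tr x \<in> affine_space i" "x \<in> affine_space i \<Longrightarrow> tr x = x" for x
    by (auto simp: tr_def affine_space_def)
  have tr_sub: "(\<lambda>x. f (tr x)) \<in> subalg (coords UNIV)" if "f \<in> subalg (coords {..<e})" for f
  proof (rule subalg_coords_subst[OF that])
    show "(\<lambda>x. tr x j) \<in> subalg (coords UNIV)" for j
      by (cases "j < i") (auto simp: tr_def intro: subalg_const)
  qed
  have pick: "\<exists>f y. f \<in> vanish e W \<and> f (tr y) \<noteq> 0" if W: "closedin (zariski e) W" "W \<subset> affine_space i" for W
  proof -
    obtain y where y: "y \<in> affine_space i" "y \<notin> W" using W(2) by blast
    then have "y \<in> affine_space e" using assms(4) by (auto simp: affine_space_def)
    then show ?thesis using closed_memI[OF W(1)] y tr(2) by metis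
  qed
  assume "\<not> ?thesis"
  then have "P \<subset> affine_space i" "Q \<subset> affine_space i" using assms(3) by auto
  with pick assms(1,2) obtain f a g b where fg: "f \<in> vanish e P" "f (tr a) \<noteq> 0" "g \<in> vanish e Q" "g (tr b) \<noteq> 0"
    by metis
  obtain c where c: "f (tr c) \<noteq> 0" "g (tr c) \<noteq> 0"
    using subalg_coords_nonzero[of "\<lambda>x. f (tr x)" UNIV a "\<lambda>x. g (tr x)" UNIV b] fg tr_sub
    by (auto simp: vanish_def)
  have "tr c \<in> P \<or> tr c \<in> Q" using tr(1)[of c] assms(3) by blast
  then show False using c fg by (auto simp: vanish_def)
qed

text \<open>The flag of coordinate subspaces of \<open>affine_space e\<close> is lifted along \<pi>
  to a chain of irreducible closed subsets of \<open>Z\<close>, so the Krull dimension is at least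
  \<open>e\<close>. Each member is minimal among the closed subsets of the previous one with the
  prescribed image; it is irreducible because its image is and \<pi> is closed.\<close>

theorem hdim_le_variety_dim:
  fixes Z :: "(nat \<Rightarrow> 'k::{alg_closed_field, field_char_0}) set"
  assumes Z: "closedin (zariski n) Z" "Z \<noteq> {}"
  shows "\<exists>e. enat e \<le> variety_dim n Z \<and> hdim_le Z (coords {..<n}) e"
proof -
  from noether_normalization[OF assms] obtain e and \<pi> :: "(nat \<Rightarrow> 'k) \<Rightarrow> nat \<Rightarrow> 'k" where \<pi>: "\<pi> ` Z = affine_space e"
    "\<And>W. W \<subseteq> Z \<Longrightarrow> closedin (zariski n) W \<Longrightarrow> closedin (zariski e) (\<pi> ` W)"
    "\<And>W. closedin (zariski e) W \<Longrightarrow> closedin (zariski n) {z \<in> Z. \<pi> z \<in> W}"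
    "hdim_le Z (coords {..<n}) e" by blast
  let ?good = "\<lambda>i C. C \<subseteq> Z \<and> closedin (zariski n) C \<and> \<pi> ` C = affine_space i \<and>
    irreducible_space (subtopology (zariski n) C)"
  have step: "\<exists>C\<subseteq>C0. ?good i C" if C0: "C0 \<subseteq> Z" "closedin (zariski n) C0" "affine_space i \<subseteq> \<pi> ` C0" "i \<le> e" for i C0
  proof -
    define \<F> where "\<F> = {C. C \<subseteq> C0 \<and> closedin (zariski n) C \<and> \<pi> ` C = affine_space i}"
    have "C0 \<inter> {z \<in> Z. \<pi> z \<in> affine_space i} \<in> \<F>"
      unfolding \<F>_def
    proof (intro CollectI conjI closedin_Int)
      show "closedin (zariski n) {z \<in> Z. \<pi> z \<in> affine_space i}"
        by (rule \<pi>(3)[OF affine_space_closed[OF C0(4)]])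
      show "\<pi> ` (C0 \<inter> {z \<in> Z. \<pi> z \<in> affine_space i}) = affine_space i"
      proof (intro equalityI subsetI)
        fix y :: "nat \<Rightarrow> 'k" assume y: "y \<in> affine_space i"
        then obtain z where "z \<in> C0" "y = \<pi> z" using C0(3) by blast
        then show "y \<in> \<pi> ` (C0 \<inter> {z \<in> Z. \<pi> z \<in> affine_space i})" using y C0(1) by blast
      qed auto
    qed (use C0 in auto)
    then have "\<F> \<noteq> {}" by blast
    moreover have "\<And>C. C \<in> \<F> \<Longrightarrow> closedin (zariski n) C" by (simp add: \<F>_def)
    ultimately have "\<exists>C\<in>\<F>. \<forall>C'\<in>\<F>. C' \<subseteq> C \<longrightarrow> C' = C" by (rule closed_minimal)
    then obtain C where C: "C \<in> \<F>" "\<And>C'. C' \<in> \<F> \<Longrightarrow> C' \<subseteq> C \<Longrightarrow> C' = C" by blast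
    then have C': "C \<subseteq> C0" "closedin (zariski n) C" "\<pi> ` C = affine_space i" by (simp_all add: \<F>_def)
    have "(\<lambda>_. 0) \<in> (affine_space i :: (nat \<Rightarrow> 'k) set)" by (simp add: affine_space_def)
    then have "C \<noteq> {}" using C'(3) by auto
    have top: "topspace (subtopology (zariski n) C) = C"
      using closed_sub_affine[OF C'(2)] by (auto simp: topspace_subtopology)
    have "irreducible_space (subtopology (zariski n) C)"
      unfolding irreducible_space_def top
    proof (intro conjI allI impI)
      show "C \<noteq> {}" by fact
      fix A B assume "closedin (subtopology (zariski n) C) A \<and> closedin (subtopology (zariski n) C) B \<and> A \<union> B = C"
      then have A: "closedin (zariski n) A" "A \<subseteq> C" and B: "closedin (zariski n) B" "B \<subseteq> C"
        and AB: "A \<union> B = C" using closedin_closed_subtopology[OF C'(2)] by auto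
      have "\<pi> ` A \<union> \<pi> ` B = affine_space i" using AB C'(3) by blast
      moreover have "A \<subseteq> Z" "B \<subseteq> Z" using A(2) B(2) C'(1) C0(1) by blast+
      then have "closedin (zariski e) (\<pi> ` A)" "closedin (zariski e) (\<pi> ` B)"
        using A(1) B(1) by (simp_all add: \<pi>(2))
      ultimately have "\<pi> ` A = affine_space i \<or> \<pi> ` B = affine_space i"
        using affine_space_irreducible C0(4) by blast
      then have "A \<in> \<F> \<or> B \<in> \<F>" using A B C'(1) by (auto simp: \<F>_def)
      then show "A = C \<or> B = C" using C(2) A(2) B(2) by blast
    qed
    then show ?thesis using C' C0(1) by blast
  qed
  define pick where "pick i C0 = (SOME C. C \<subseteq> C0 \<and> ?good i C)" for i C0
  have pick: "pick i C0 \<subseteq> C0 \<and> ?good i (pick i C0)"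
    if "C0 \<subseteq> Z" "closedin (zariski n) C0" "affine_space i \<subseteq> \<pi> ` C0" "i \<le> e" for i C0
    unfolding pick_def by (rule someI_ex) (use step[OF that] in blast)
  \<comment> \<open>The chain is built from the top: \<open>D j\<close> maps onto
    \<open>affine_space (e - j)\<close>. For the Krull dimension it is read backwards, as
    \<open>D (e - i)\<close>.\<close>
  define D where "D j = rec_nat (pick e Z) (\<lambda>j C. pick (e - Suc j) C) j" for j
  have D_Suc: "D (Suc j) = pick (e - Suc j) (D j)" for j by (simp add: D_def)
  have aff_mono: "affine_space i \<subseteq> (affine_space m :: (nat \<Rightarrow> 'k) set)" if "i \<le> m" for i m
    using that by (auto simp: affine_space_def)
  have D: "?good (e - j) (D j)" for j
  proof (induction j)
    case 0
    then show ?case using pick[of Z e] Z \<pi>(1) by (simp add: D_def)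
  next
    case (Suc j)
    have "affine_space (e - Suc j) \<subseteq> \<pi> ` D j" using Suc aff_mono[of "e - Suc j" "e - j"] by auto
    then show ?case using pick[of "D j" "e - Suc j"] Suc by (simp add: D_Suc)
  qed
  have D_sub: "D (Suc j) \<subset> D j" if "j < e" for j
  proof -
    have "affine_space (e - Suc j) \<subseteq> \<pi> ` D j" using D[of j] aff_mono[of "e - Suc j" "e - j"] by auto
    then have "D (Suc j) \<subseteq> D j" using pick[of "D j" "e - Suc j"] D[of j] by (simp add: D_Suc)
    moreover have "D (Suc j) \<noteq> D j"
    proof
      assume "D (Suc j) = D j"
      then have eq: "(affine_space (e - Suc j) :: (nat \<Rightarrow> 'k) set) = affine_space (e - j)"
        using D[of j] D[of "Suc j"] by metis
      have "(\<lambda>i. if i = e - Suc j then 1 else 0) \<in> (affine_space (e - j) :: (nat \<Rightarrow> 'k) set)"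
        using that by (auto simp: affine_space_def)
      then show False unfolding eq[symmetric] by (auto simp: affine_space_def)
    qed
    ultimately show ?thesis by blast
  qed
  let ?X = "subtopology (zariski n) Z"
  have chain: "(\<forall>i\<le>e. closedin ?X (D (e - i)) \<and> irreducible_space (subtopology ?X (D (e - i)))) \<and>
     (\<forall>i<e. D (e - i) \<subset> D (e - Suc i))"
  proof (intro conjI allI impI)
    fix i assume "i \<le> e"
    show "closedin ?X (D (e - i))" using D[of "e - i"] closedin_closed_subtopology[OF Z(1)] by blast
    show "irreducible_space (subtopology ?X (D (e - i)))"
      using D[of "e - i"] by (simp add: subtopology_subtopology Int_absorb1)
  next
    fix i assume "i < e"
    then show "D (e - i) \<subset> D (e - Suc i)" using D_sub[of "e - Suc i"] by (simp add: Suc_diff_Suc)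
  qed
  have "enat e \<le> variety_dim n Z"
    unfolding variety_dim_def krull_dim_def
    by (rule Sup_upper, rule CollectI, rule exI[of _ e], rule conjI, rule refl,
      rule exI[of _ "\<lambda>i. D (e - i)"], rule chain)
  with \<pi>(4) show ?thesis by blast
qed

section \<open>Regular functions on closed sets\<close>

text \<open>The polynomials \<open>h\<close> for which \<open>h * f\<close> is polynomial on
  \<open>Z\<close> form an ideal. It has no common zero: off \<open>Z\<close> there are the
  functions vanishing on \<open>Z\<close>, and on \<open>Z\<close> the local denominators. By the
  Nullstellensatz it contains 1.\<close>

lemma regular_on_closed_imp_polynomial:
  fixes Z :: "(nat \<Rightarrow> 'k::{alg_closed_field, field_char_0}) set"
  assumes Z: "closedin (zariski n) Z" and f: "regular_on n Z f"
  shows "\<exists>p\<in>subalg (coords {..<n}). \<forall>x\<in>Z. f x = p x"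
proof -
  let ?A = "subalg (coords {..<n}) :: ((nat \<Rightarrow> 'k) \<Rightarrow> 'k) set"
  define I where "I = {h \<in> ?A. \<exists>p\<in>?A. \<forall>x\<in>Z. h x * f x = p x}"
  have "(\<lambda>_. 1) \<in> I"
  proof (rule nullstellensatz)
    show "ideal_of n I"
      unfolding ideal_of_def
    proof (intro conjI ballI)
      show "I \<subseteq> ?A" by (auto simp: I_def)
      show "(\<lambda>_. 0) \<in> I" unfolding I_def
        by (intro CollectI conjI subalg_const bexI[of _ "\<lambda>_. 0"]) simp
    next
      fix g h assume "g \<in> I" "h \<in> I"
      then obtain p q where "g \<in> ?A" "p \<in> ?A" "\<forall>x\<in>Z. g x * f x = p x"
        "h \<in> ?A" "q \<in> ?A" "\<forall>x\<in>Z. h x * f x = q x" by (auto simp: I_def)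
      then show "(\<lambda>x. g x + h x) \<in> I"
        unfolding I_def
        by (intro CollectI conjI subalg_add bexI[of _ "\<lambda>x. p x + q x"]) (simp_all add: distrib_right)
    next
      fix g h assume "g \<in> I" "h \<in> ?A"
      then obtain p where "g \<in> ?A" "p \<in> ?A" "\<forall>x\<in>Z. g x * f x = p x" by (auto simp: I_def)
      then show "(\<lambda>x. h x * g x) \<in> I"
        using \<open>h \<in> ?A\<close> unfolding I_def
        by (intro CollectI conjI subalg_mult bexI[of _ "\<lambda>x. h x * p x"]) (simp_all add: mult.assoc)
    qed
    fix x :: "nat \<Rightarrow> 'k"
    \<comment> \<open>Elements of the ideal depend on the first \<open>n\<close> coordinates only,
      so \<open>x\<close> may be truncated to a point of affine space.\<close>
    define y where "y i = (if i < n then x i else 0)" for i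
    have y: "y \<in> affine_space n" by (simp add: y_def affine_space_def)
    have "\<exists>h\<in>I. h y \<noteq> 0"
    proof (cases "y \<in> Z")
      case False
      then obtain h where h: "h \<in> vanish n Z" "h y \<noteq> 0" using closed_memI[OF Z y] by blast
      then have hA: "h \<in> ?A" by (simp add: vanish_def)
      have h0: "h x * f x = 0" if "x \<in> Z" for x using h(1) that by (simp add: vanish_def)
      have "h \<in> I" unfolding I_def
        by (rule CollectI, rule conjI, rule hA, rule bexI[of _ "\<lambda>_. 0"], rule ballI, erule h0, rule subalg_const)
      show ?thesis by (rule bexI[of _ h]) fact+
    next
      case True
      from f[unfolded regular_on_def, rule_format, OF this] obtain U p q where
        U: "openin (subtopology (zariski n) Z) U" "y \<in> U"
        and pq: "p \<in> mpols n" "q \<in> mpols n" "\<forall>y\<in>U. mp_eval q y \<noteq> 0 \<and> f y = mp_eval p y / mp_eval q y"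
        by (elim exE conjE bexE)
      obtain V where V: "openin (zariski n) V" "U = V \<inter> Z"
        using U(1) by (auto simp: openin_subtopology)
      obtain S where S: "S \<subseteq> mpols n" "V = affine_space n - zero_locus n S"
        using V(1) by (auto simp: openin_zariski)
      obtain s where s: "s \<in> S" "mp_eval s y \<noteq> 0"
        using U(2) V(2) S(2) y by (auto simp: zero_locus_def)
      have sA: "mp_eval s \<in> ?A" using s(1) S(1) by (auto intro: mpol_imp_subalg)
      \<comment> \<open>The factor \<open>s\<close> vanishes at the points of \<open>Z\<close>
        outside \<open>U\<close>, where nothing is known about \<open>q\<close>.\<close>
      have "mp_eval s w * mp_eval q w * f w = mp_eval s w * mp_eval p w" if "w \<in> Z" for w
      proof (cases "mp_eval s w = 0")
        case False
        have "w \<in> affine_space n" using closed_sub_affine[OF Z] that by blast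
        then have "w \<in> U" using False s(1) that by (auto simp: V(2) S(2) zero_locus_def)
        then show ?thesis using pq(3) by simp
      qed simp
      then have "(\<lambda>w. mp_eval s w * mp_eval q w) \<in> I"
        unfolding I_def using sA s(1) S(1) pq(1,2)
        by (intro CollectI conjI subalg_mult mpol_imp_subalg
          bexI[of _ "\<lambda>w. mp_eval s w * mp_eval p w"] ballI) auto
      moreover have "mp_eval s y * mp_eval q y \<noteq> 0" using s(2) pq(3) U(2) by simp
      ultimately show ?thesis by (intro bexI[of _ "\<lambda>w. mp_eval s w * mp_eval q w"])
    qed
    then obtain h where h: "h \<in> I" "h y \<noteq> 0" by blast
    then have "h x = h y" by (intro subalg_coords_cong[of h "{..<n}"]) (auto simp: I_def y_def)
    with h show "\<exists>h\<in>I. h x \<noteq> 0" by (intro bexI[of _ h]) simp_all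
  qed
  then show ?thesis by (auto simp: I_def)
qed

section \<open>Directional derivatives and tangent spaces\<close>

text \<open>The derivative of \<open>f\<close> at \<open>z\<close> in direction \<open>v\<close>, as
  the linear coefficient along a line. It is determined by the function \<open>f\<close> without a
  chosen polynomial for it; characteristic zero makes the polynomial in \<open>t\<close>
  unique.\<close>

definition dird :: "((nat \<Rightarrow> 'k::field_char_0) \<Rightarrow> 'k) \<Rightarrow> (nat \<Rightarrow> 'k) \<Rightarrow> (nat \<Rightarrow> 'k) \<Rightarrow> 'k" where
  "dird f z v = coeff (THE p. \<forall>t. f (\<lambda>i. z i + t * v i) = poly p t) (Suc 0)"

lemma dird_eqI:
  assumes "\<And>t. f (\<lambda>i. z i + t * v i) = poly p t"
  shows "dird f z v = coeff p (Suc 0)"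
proof -
  have "(THE p. \<forall>t. f (\<lambda>i. z i + t * v i) = poly p t) = p"
  proof (rule the_equality)
    fix q assume "\<forall>t. f (\<lambda>i. z i + t * v i) = poly q t"
    then show "q = p" using assms by (intro poly_eq_fun) metis
  qed (use assms in blast)
  then show ?thesis by (simp add: dird_def)
qed

lemma dird_const [simp]: "dird (\<lambda>_. c) z v = 0"
  by (subst dird_eqI[of _ _ _ "[:c:]"]) simp_all

lemma dird_coord [simp]: "dird (\<lambda>x. x i) z v = v i"
  by (subst dird_eqI[of _ _ _ "[:z i, v i:]"]) simp_all

lemma subalg_line_poly:
  fixes f :: "(nat \<Rightarrow> 'k::field_char_0) \<Rightarrow> 'k"
  assumes "f \<in> subalg (coords I)"
  shows "\<exists>p. (\<forall>t. f (\<lambda>i. z i + t * v i) = poly p t) \<and> coeff p 0 = f z \<and> coeff p (Suc 0) = dird f z v"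
proof -
  obtain p where p: "\<And>t. f (\<lambda>i. z i + t * v i) = poly p t"
    using subalg_coords_line[OF assms, of z v] by blast
  from p[of 0] have "coeff p 0 = f z" by (simp add: poly_0_coeff_0)
  with p dird_eqI[OF p] show ?thesis by (intro exI[of _ p]) simp
qed

lemma dird_add:
  assumes "f \<in> subalg (coords I)" "g \<in> subalg (coords I)"
  shows "dird (\<lambda>x. f x + g x) z v = dird f z v + dird g z v"
proof -
  obtain p where p: "\<forall>t. f (\<lambda>i. z i + t * v i) = poly p t" "coeff p (Suc 0) = dird f z v"
    using subalg_line_poly[OF assms(1)] by blast
  obtain q where q: "\<forall>t. g (\<lambda>i. z i + t * v i) = poly q t" "coeff q (Suc 0) = dird g z v"
    using subalg_line_poly[OF assms(2)] by blast
  have "dird (\<lambda>x. f x + g x) z v = coeff (p + q) (Suc 0)" by (rule dird_eqI) (simp add: p q)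
  then show ?thesis by (simp add: p q)
qed

lemma dird_mult:
  assumes "f \<in> subalg (coords I)" "g \<in> subalg (coords I)"
  shows "dird (\<lambda>x. f x * g x) z v = f z * dird g z v + dird f z v * g z"
proof -
  obtain p where p: "\<forall>t. f (\<lambda>i. z i + t * v i) = poly p t" "coeff p 0 = f z" "coeff p (Suc 0) = dird f z v"
    using subalg_line_poly[OF assms(1)] by blast
  obtain q where q: "\<forall>t. g (\<lambda>i. z i + t * v i) = poly q t" "coeff q 0 = g z" "coeff q (Suc 0) = dird g z v"
    using subalg_line_poly[OF assms(2)] by blast
  have "dird (\<lambda>x. f x * g x) z v = coeff (p * q) (Suc 0)" by (rule dird_eqI) (simp add: p q)
  also have "\<dots> = f z * dird g z v + dird f z v * g z"
    using p q by (simp add: coeff_mult)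
  finally show ?thesis .
qed

lemma dird_diff:
  assumes "f \<in> subalg (coords I)" "g \<in> subalg (coords I)"
  shows "dird (\<lambda>x. f x - g x) z v = dird f z v - dird g z v"
proof -
  have "dird (\<lambda>x. f x + (-1) * g x) z v = dird f z v + dird (\<lambda>x. (-1) * g x) z v"
    by (rule dird_add[OF assms(1) subalg_mult[OF subalg_const assms(2)]])
  also have "dird (\<lambda>x. (-1) * g x) z v = - dird g z v"
    by (subst dird_mult[OF subalg_const assms(2)]) simp
  finally show ?thesis by simp
qed

lemma dird_sum:
  assumes "\<And>j. j \<in> J \<Longrightarrow> f j \<in> subalg (coords I)"
  shows "dird (\<lambda>x. \<Sum>j\<in>J. f j x) z v = (\<Sum>j\<in>J. dird (f j) z v)"
  using assms
proof (induction J rule: infinite_finite_induct)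
  case (insert j J)
  then show ?case using dird_add[of "f j" I "\<lambda>x. \<Sum>j\<in>J. f j x"] subalg_sum[of J f] by simp
qed simp_all

lemma dird_scale: "f \<in> subalg (coords I) \<Longrightarrow> dird (\<lambda>x. c * f x) z v = c * dird f z v"
  using dird_mult[OF subalg_const, of f I c] by simp

lemma dird_prod:
  assumes "finite J" "\<And>j. j \<in> J \<Longrightarrow> f j \<in> subalg (coords I)"
  shows "dird (\<lambda>x. \<Prod>j\<in>J. f j x) z v = (\<Sum>j\<in>J. dird (f j) z v * (\<Prod>i\<in>J - {j}. f i z))"
  using assms
proof (induction J rule: finite_induct)
  case (insert k J)
  have "dird (\<lambda>x. \<Prod>j\<in>insert k J. f j x) z v = dird (\<lambda>x. f k x * (\<Prod>j\<in>J. f j x)) z v"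
    using insert.hyps by simp
  also have "\<dots> = f k z * dird (\<lambda>x. \<Prod>j\<in>J. f j x) z v + dird (f k) z v * (\<Prod>j\<in>J. f j z)"
    using insert.prems by (intro dird_mult subalg_prod) auto
  also have "f k z * dird (\<lambda>x. \<Prod>j\<in>J. f j x) z v = (\<Sum>j\<in>J. dird (f j) z v * (\<Prod>i\<in>insert k J - {j}. f i z))"
  proof -
    have "(\<Prod>i\<in>insert k J - {j}. f i z) = f k z * (\<Prod>i\<in>J - {j}. f i z)" if "j \<in> J" for j
    proof -
      have "insert k J - {j} = insert k (J - {j})" using that insert.hyps by auto
      then show ?thesis using insert.hyps by simp
    qed
    then show ?thesis using insert by (simp add: sum_distrib_left mult_ac)
  qed
  also have "(\<Prod>j\<in>J. f j z) = (\<Prod>i\<in>insert k J - {k}. f i z)" using insert.hyps by simp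
  finally show ?case using insert.hyps by simp
qed simp

lemma dird_coord_power: "dird (\<lambda>x. x i ^ e) z v = of_nat e * z i ^ (e - 1) * v i"
proof (induction e)
  case (Suc e)
  have "dird (\<lambda>x. x i * x i ^ e) z v = z i * dird (\<lambda>x. x i ^ e) z v + dird (\<lambda>x. x i) z v * z i ^ e"
    by (intro dird_mult[of _ UNIV] subalg_power subalg_coord) auto
  then show ?case using Suc by (cases e) (simp_all add: algebra_simps)
qed simp

text \<open>The chain rule along a polynomial curve, by induction on \<open>f\<close>. The
  polynomial \<open>p\<close> is determined by its values, so it is enough to find some polynomial
  with this derivative.\<close>

lemma dird_curve:
  fixes f :: "(nat \<Rightarrow> 'k::field_char_0) \<Rightarrow> 'k"
  assumes "f \<in> subalg (coords I)" "\<And>t. f (\<lambda>i. poly (\<gamma> i) t) = poly p t"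
  shows "poly (pderiv p) t = dird f (\<lambda>i. poly (\<gamma> i) t) (\<lambda>i. poly (pderiv (\<gamma> i)) t)"
proof -
  have "\<exists>q. (\<forall>t. f (\<lambda>i. poly (\<gamma> i) t) = poly q t) \<and>
      poly (pderiv q) t = dird f (\<lambda>i. poly (\<gamma> i) t) (\<lambda>i. poly (pderiv (\<gamma> i)) t)"
    using assms(1)
  proof induction
    case (subalg_const c)
    show ?case by (rule exI[of _ "[:c:]"]) (simp add: pderiv_pCons)
  next
    case (subalg_base \<phi>)
    then obtain i where "\<phi> = (\<lambda>x. x i)" by (auto simp: coords_def)
    then show ?case by (intro exI[of _ "\<gamma> i"]) simp
  next
    case (subalg_add f g)
    then obtain p q where "\<forall>t. f (\<lambda>i. poly (\<gamma> i) t) = poly p t"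
      "poly (pderiv p) t = dird f (\<lambda>i. poly (\<gamma> i) t) (\<lambda>i. poly (pderiv (\<gamma> i)) t)"
      "\<forall>t. g (\<lambda>i. poly (\<gamma> i) t) = poly q t"
      "poly (pderiv q) t = dird g (\<lambda>i. poly (\<gamma> i) t) (\<lambda>i. poly (pderiv (\<gamma> i)) t)" by blast
    then show ?case using subalg_add.hyps
      by (intro exI[of _ "p + q"]) (simp add: pderiv_add dird_add[of f I g])
  next
    case (subalg_mult f g)
    then obtain p q where "\<forall>t. f (\<lambda>i. poly (\<gamma> i) t) = poly p t"
      "poly (pderiv p) t = dird f (\<lambda>i. poly (\<gamma> i) t) (\<lambda>i. poly (pderiv (\<gamma> i)) t)"
      "\<forall>t. g (\<lambda>i. poly (\<gamma> i) t) = poly q t"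
      "poly (pderiv q) t = dird g (\<lambda>i. poly (\<gamma> i) t) (\<lambda>i. poly (pderiv (\<gamma> i)) t)" by blast
    then show ?case using subalg_mult.hyps
      by (intro exI[of _ "p * q"]) (simp add: pderiv_mult dird_mult[of f I g] algebra_simps)
  qed
  then obtain q where q: "\<forall>t. f (\<lambda>i. poly (\<gamma> i) t) = poly q t"
    "poly (pderiv q) t = dird f (\<lambda>i. poly (\<gamma> i) t) (\<lambda>i. poly (pderiv (\<gamma> i)) t)" by blast
  have "p = q" by (rule poly_eq_fun) (metis assms(2) q(1))
  with q show ?thesis by simp
qed

text \<open>\<open>h\<close> maps the line through \<open>z\<close> in direction \<open>v\<close> to
  a polynomial curve, and the chain rule along curves applies at parameter 0.\<close>

lemma dird_comp:
  fixes f :: "(nat \<Rightarrow> 'k::field_char_0) \<Rightarrow> 'k"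
  assumes "f \<in> subalg (coords I)" "\<And>i. (\<lambda>x. h x i) \<in> subalg (coords J)"
  shows "dird (\<lambda>x. f (h x)) z v = dird f (h z) (\<lambda>i. dird (\<lambda>x. h x i) z v)"
proof -
  have "\<forall>i. \<exists>p. (\<forall>t. h (\<lambda>i. z i + t * v i) i = poly p t) \<and> coeff p 0 = h z i \<and>
      coeff p (Suc 0) = dird (\<lambda>x. h x i) z v"
    by (rule allI, rule subalg_line_poly, rule assms(2))
  from choice[OF this] obtain \<gamma> where \<gamma>: "\<forall>i. (\<forall>t. h (\<lambda>i. z i + t * v i) i = poly (\<gamma> i) t) \<and>
      coeff (\<gamma> i) 0 = h z i \<and> coeff (\<gamma> i) (Suc 0) = dird (\<lambda>x. h x i) z v" ..
  obtain p where p: "\<And>t. f (\<lambda>i. poly (\<gamma> i) t) = poly p t"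
    using subalg_coords_curve[OF assms(1), of \<gamma>] by blast
  have h: "h (\<lambda>i. z i + t * v i) = (\<lambda>i. poly (\<gamma> i) t)" for t using \<gamma> by (intro ext) simp
  have d0: "poly (pderiv r) 0 = coeff r (Suc 0)" for r :: "'k poly"
    by (simp add: poly_0_coeff_0 coeff_pderiv)
  have "dird (\<lambda>x. f (h x)) z v = coeff p (Suc 0)" by (rule dird_eqI) (simp add: h p)
  also have "\<dots> = dird f (\<lambda>i. poly (\<gamma> i) 0) (\<lambda>i. poly (pderiv (\<gamma> i)) 0)"
    using dird_curve[OF assms(1) p, of 0] by (simp only: d0)
  also have "(\<lambda>i. poly (\<gamma> i) 0) = h z" using \<gamma> by (simp add: poly_0_coeff_0)
  also have "(\<lambda>i. poly (pderiv (\<gamma> i)) 0) = (\<lambda>i. dird (\<lambda>x. h x i) z v)" using \<gamma> by (simp only: d0)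
  finally show ?thesis .
qed

lemma dird_zero: "f \<in> subalg (coords I) \<Longrightarrow> dird f z (\<lambda>_. 0) = 0"
  by (subst dird_eqI[of _ _ _ "[:f z:]"]) simp_all

lemma dird_scale_vector:
  fixes f :: "(nat \<Rightarrow> 'k::field_char_0) \<Rightarrow> 'k"
  assumes "f \<in> subalg (coords I)"
  shows "dird f z (\<lambda>i. c * v i) = c * dird f z v"
proof -
  obtain p where p: "\<forall>t. f (\<lambda>i. z i + t * v i) = poly p t" "coeff p (Suc 0) = dird f z v"
    using subalg_line_poly[OF assms] by blast
  have "dird f z (\<lambda>i. c * v i) = coeff (p \<circ>\<^sub>p [:0, c:]) (Suc 0)"
  proof (rule dird_eqI)
    fix t
    have "f (\<lambda>i. z i + (t * c) * v i) = poly p (t * c)" by (simp only: p(1)[rule_format])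
    then show "f (\<lambda>i. z i + t * (c * v i)) = poly (p \<circ>\<^sub>p [:0, c:]) t"
      by (simp add: poly_pcompose mult.assoc)
  qed
  also have "\<dots> = coeff (pderiv (p \<circ>\<^sub>p [:0, c:])) 0" by (simp add: coeff_pderiv)
  also have "\<dots> = c * coeff p (Suc 0)"
    by (simp add: pderiv_pcompose pderiv_pCons coeff_pderiv poly_pcompose flip: poly_0_coeff_0)
      (simp add: poly_0_coeff_0 coeff_pderiv)
  finally show ?thesis by (simp add: p(2))
qed

lemma mp_eval_sum: "mp_eval (\<Sum>i\<in>A. p i) x = (\<Sum>i\<in>A. mp_eval (p i) x)"
  by (induction A rule: infinite_finite_induct) (simp_all add: mp_eval_add)

text \<open>Connects the derivative of functions with the formal partial derivatives in which
  tangent spaces are defined.\<close>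

lemma dird_mp_eval:
  fixes p :: "'k::field_char_0 mpol"
  assumes "p \<in> mpols n"
  shows "dird (mp_eval p) z v = (\<Sum>i<n. mp_eval (mp_deriv i p) z * v i)"
proof -
  let ?e = Poly_Mapping.lookup
  have keys: "Poly_Mapping.keys m \<subseteq> {..<n}" if "m \<in> Poly_Mapping.keys p" for m
    using assms that by (auto simp: mpols_def)
  have mon: "mon_eval m x = (\<Prod>i<n. x i ^ ?e m i)" if "Poly_Mapping.keys m \<subseteq> {..<n}" for m and x :: "nat \<Rightarrow> 'k"
    unfolding mon_eval_def by (rule prod.mono_neutral_left) (use that in \<open>auto simp: in_keys_iff\<close>)
  have mon_sub: "(mon_eval m :: (nat \<Rightarrow> 'k) \<Rightarrow> 'k) \<in> subalg (coords {..<n})" if "Poly_Mapping.keys m \<subseteq> {..<n}"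
    for m :: "nat \<Rightarrow>\<^sub>0 nat"
  proof -
    have "mon_eval m = (\<lambda>x :: nat \<Rightarrow> 'k. \<Prod>i<n. x i ^ ?e m i)" by (rule ext) (rule mon[OF that])
    also have "\<dots> \<in> subalg (coords {..<n})" by (intro subalg_intros subalg_coord)
    finally show ?thesis .
  qed
  have dmon: "dird (mon_eval m) z v =
      (\<Sum>i<n. of_nat (?e m i) * mon_eval (m - Poly_Mapping.single i 1) z * v i)"
    if m: "Poly_Mapping.keys m \<subseteq> {..<n}" for m
  proof -
    have "dird (mon_eval m) z v = dird (\<lambda>x. \<Prod>i<n. x i ^ ?e m i) z v"
      by (rule arg_cong[where f = "\<lambda>f. dird f z v"], rule ext, rule mon[OF m])
    also have "\<dots> = (\<Sum>i<n. dird (\<lambda>x. x i ^ ?e m i) z v * (\<Prod>j\<in>{..<n} - {i}. z j ^ ?e m j))"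
      by (rule dird_prod[where I = UNIV], simp, rule subalg_power, rule subalg_coord, simp)
    also have "\<dots> = (\<Sum>i<n. of_nat (?e m i) * mon_eval (m - Poly_Mapping.single i 1) z * v i)"
    proof (intro sum.cong refl)
      fix i assume i: "i \<in> {..<n}"
      have sub: "Poly_Mapping.keys (m - Poly_Mapping.single i 1) \<subseteq> {..<n}"
      proof
        fix k assume "k \<in> Poly_Mapping.keys (m - Poly_Mapping.single i 1)"
        then have "k \<in> Poly_Mapping.keys m" by (auto simp: in_keys_iff lookup_minus)
        then show "k \<in> {..<n}" using m by blast
      qed
      have "mon_eval (m - Poly_Mapping.single i 1) z =
          z i ^ (?e m i - 1) * (\<Prod>j\<in>{..<n} - {i}. z j ^ ?e m j)"
        unfolding mon[OF sub] using i
        by (subst prod.remove[of _ i]) (auto simp: lookup_minus lookup_single intro!: prod.cong)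
      then show "dird (\<lambda>x. x i ^ ?e m i) z v * (\<Prod>j\<in>{..<n} - {i}. z j ^ ?e m j) =
          of_nat (?e m i) * mon_eval (m - Poly_Mapping.single i 1) z * v i"
        by (simp add: dird_coord_power mult_ac)
    qed
    finally show ?thesis .
  qed
  have "dird (mp_eval p) z v = (\<Sum>m\<in>Poly_Mapping.keys p. dird (\<lambda>x. ?e p m * mon_eval m x) z v)"
    unfolding mp_eval_def[abs_def]
    by (intro dird_sum[where I = "{..<n}"] subalg_mult subalg_const mon_sub keys)
  also have "\<dots> = (\<Sum>m\<in>Poly_Mapping.keys p. ?e p m *
      (\<Sum>i<n. of_nat (?e m i) * mon_eval (m - Poly_Mapping.single i 1) z * v i))"
    by (intro sum.cong refl) (simp add: dird_scale[OF mon_sub[OF keys]] dmon[OF keys])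
  also have "\<dots> = (\<Sum>i<n. mp_eval (mp_deriv i p) z * v i)"
    unfolding mp_deriv_def mp_eval_sum mp_eval_single sum_distrib_left sum_distrib_right
    by (subst sum.swap) (simp add: mult_ac)
  finally show ?thesis .
qed

lemma tangent_space_iff:
  fixes Z :: "(nat \<Rightarrow> 'k::field_char_0) set"
  shows "v \<in> tangent_space n Z z \<longleftrightarrow> v \<in> affine_space n \<and> (\<forall>f\<in>vanish n Z. dird f z v = 0)"
proof -
  have "vanish n Z = mp_eval ` vanishing_ideal n Z"
  proof (intro equalityI subsetI)
    fix f assume f: "f \<in> vanish n Z"
    then obtain p where p: "p \<in> mpols n" "f = mp_eval p"
      using subalg_imp_mpol[of f n] by (auto simp: vanish_def)
    then show "f \<in> mp_eval ` vanishing_ideal n Z"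
      using f by (intro image_eqI[of _ _ p]) (auto simp: vanishing_ideal_def vanish_def)
  qed (auto simp: vanishing_ideal_def vanish_def intro: mpol_imp_subalg)
  then show ?thesis
    unfolding tangent_space_def by (auto simp: vanishing_ideal_def dird_mp_eval)
qed

section \<open>The total tangent space as a closed set\<close>

definition base_point :: "nat \<Rightarrow> (nat \<Rightarrow> 'k::zero) \<Rightarrow> nat \<Rightarrow> 'k" where
  "base_point n u i = (if i < n then u i else 0)"

text \<open>Together with \<open>base_point\<close> this undoes \<open>join\<close>; the truncation
  keeps both components in affine \<open>n\<close>-space.\<close>

definition direction :: "nat \<Rightarrow> (nat \<Rightarrow> 'k::zero) \<Rightarrow> nat \<Rightarrow> 'k" where
  "direction n u i = (if i < n then u (n + i) else 0)"

lemma base_point_subalg: "(\<lambda>u. base_point n u i) \<in> subalg (coords {..<2 * n})"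
  by (cases "i < n") (auto simp: base_point_def intro: subalg_const)

lemma direction_subalg: "(\<lambda>u. direction n u i) \<in> subalg (coords {..<2 * n})"
  by (cases "i < n") (auto simp: direction_def intro: subalg_const)

lemma dird_subalg:
  fixes f :: "(nat \<Rightarrow> 'k::field_char_0) \<Rightarrow> 'k"
  assumes "f \<in> subalg (coords I)"
  shows "(\<lambda>u. dird f (base_point n u) (direction n u)) \<in> subalg (coords {..<2 * n})"
  using assms
proof induction
  case (subalg_const c)
  show ?case by (simp add: subalg.subalg_const)
next
  case (subalg_base \<phi>)
  then obtain i where "\<phi> = (\<lambda>x. x i)" by (auto simp: coords_def)
  then show ?case by (simp add: direction_subalg)
next
  case (subalg_add f g)
  then show ?case by (simp add: dird_add[of f I g] subalg.subalg_add)
next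
  case (subalg_mult f g)
  have "(\<lambda>u. h (base_point n u)) \<in> subalg (coords {..<2 * n})" if "h \<in> subalg (coords I)" for h :: "(nat \<Rightarrow> 'k) \<Rightarrow> 'k"
    by (rule subalg_coords_subst[OF that base_point_subalg])
  with subalg_mult show ?case
    by (simp add: dird_mult[of f I g] subalg.subalg_add subalg.subalg_mult)
qed

lemma total_tangent_space_iff:
  fixes Z :: "(nat \<Rightarrow> 'k::field_char_0) set"
  assumes "Z \<subseteq> affine_space n"
  shows "u \<in> total_tangent_space n Z \<longleftrightarrow> u \<in> affine_space (2 * n) \<and> base_point n u \<in> Z \<and>
    direction n u \<in> tangent_space n Z (base_point n u)"
proof
  assume "u \<in> total_tangent_space n Z"
  then obtain z v where zv: "u = join n z v" "z \<in> Z" "v \<in> tangent_space n Z z"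
    by (auto simp: total_tangent_space_def)
  then have aff: "z \<in> affine_space n" "v \<in> affine_space n"
    using assms by (auto simp: tangent_space_iff)
  then have "base_point n u = z" "direction n u = v"
    by (auto simp: zv(1) base_point_def direction_def join_def affine_space_def fun_eq_iff)
  with zv aff show "u \<in> affine_space (2 * n) \<and> base_point n u \<in> Z \<and>
      direction n u \<in> tangent_space n Z (base_point n u)"
    by (auto simp: affine_space_def join_def)
next
  assume u: "u \<in> affine_space (2 * n) \<and> base_point n u \<in> Z \<and>
    direction n u \<in> tangent_space n Z (base_point n u)"
  then have "u = join n (base_point n u) (direction n u)"
    by (auto simp: join_def base_point_def direction_def affine_space_def fun_eq_iff)
  with u show "u \<in> total_tangent_space n Z" unfolding total_tangent_space_def by blast
qed

lemma closed_total_tangent_space: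
  fixes Z :: "(nat \<Rightarrow> 'k::field_char_0) set"
  assumes "closedin (zariski n) Z"
  shows "closedin (zariski (2 * n)) (total_tangent_space n Z)"
proof -
  let ?S = "(\<lambda>f u. f (base_point n u)) ` vanish n Z \<union>
    (\<lambda>f u. dird f (base_point n u) (direction n u)) ` vanish n Z"
  have bp: "base_point n u \<in> affine_space n" "direction n u \<in> affine_space n" for u :: "nat \<Rightarrow> 'k"
    by (auto simp: base_point_def direction_def affine_space_def)
  have "base_point n u \<in> Z \<longleftrightarrow> (\<forall>f\<in>vanish n Z. f (base_point n u) = 0)" for u
    using closed_vanish[OF assms] bp by blast
  then have "total_tangent_space n Z = {u \<in> affine_space (2 * n). \<forall>f\<in>?S. f u = 0}"
    using total_tangent_space_iff[OF closed_sub_affine[OF assms]] bp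
    by (simp add: tangent_space_iff set_eq_iff ball_Un)
  also have "closedin (zariski (2 * n)) \<dots>"
  proof (rule closedin_zariskiI, rule Un_least)
    show "(\<lambda>f u. f (base_point n u)) ` vanish n Z \<subseteq> subalg (coords {..<2 * n})"
    proof (rule image_subsetI)
      fix f assume "f \<in> vanish n Z"
      then have "f \<in> subalg (coords {..<n})" by (simp add: vanish_def)
      then show "(\<lambda>u. f (base_point n u)) \<in> subalg (coords {..<2 * n})"
        by (rule subalg_coords_subst) (rule base_point_subalg)
    qed
    show "(\<lambda>f u. dird f (base_point n u) (direction n u)) ` vanish n Z \<subseteq> subalg (coords {..<2 * n})"
      by (rule image_subsetI, rule dird_subalg) (auto simp: vanish_def)
  qed
  finally show ?thesis .
qed

section \<open>Projections that are closed embeddings\<close>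

text \<open>The fibre over a point \<open>a\<close> of the projection that forgets \<open>\<xi>\<close> is described by one polynomial \<open>q\<close>
  in the last variable. Injectivity bounds the number of its roots and immersivity makes them simple,
  so \<open>q\<close> has degree at most one and \<open>\<xi>\<close> can be eliminated locally; the Nullstellensatz
  globalizes this.\<close>

lemma remove_generator:
  fixes Z :: "(nat \<Rightarrow> 'k::{alg_closed_field, field_char_0}) set"
  assumes Z: "closedin (zariski n) Z"
    and \<Phi>: "finite \<Phi>" "\<Phi> \<subseteq> subalg (coords {..<n})" and \<xi>: "\<xi> \<in> subalg (coords {..<n})"
    and gen: "\<And>j. j < n \<Longrightarrow> \<exists>\<psi>\<in>subalg (insert \<xi> \<Phi>). \<forall>z\<in>Z. \<psi> z = z j"
    and int: "integral_on Z (subalg \<Phi>) \<xi>"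
    and inj: "\<And>z w. z \<in> Z \<Longrightarrow> w \<in> Z \<Longrightarrow> \<forall>\<phi>\<in>\<Phi>. \<phi> z = \<phi> w \<Longrightarrow> z = w"
    and imm: "\<And>z v. z \<in> Z \<Longrightarrow> v \<in> affine_space n \<Longrightarrow> \<forall>f\<in>vanish n Z. dird f z v = 0 \<Longrightarrow>
      \<forall>\<phi>\<in>\<Phi>. dird \<phi> z v = 0 \<Longrightarrow> v = (\<lambda>_. 0)"
  shows "\<exists>s\<in>subalg \<Phi>. \<forall>z\<in>Z. \<xi> z = s z"
proof -
  obtain N and \<phi> :: "nat \<Rightarrow> (nat \<Rightarrow> 'k) \<Rightarrow> 'k" where \<phi>: "\<Phi> = \<phi> ` {..<N}"
    using finite_imp_nat_seg_image_inj_on[OF \<Phi>(1)] by (auto simp: lessThan_def)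
  have \<phi>A: "\<phi> i \<in> subalg (coords {..<n})" if "i < N" for i using that \<Phi>(2) \<phi> by auto
  define \<theta> where "\<theta> i = (if i = N then \<xi> else \<phi> i)" for i
  \<comment> \<open>The embedding of \<open>Z\<close> into affine space by all generators, with
    \<xi> as the last coordinate.\<close>
  define pt where "pt z i = (if i < Suc N then \<theta> i z else 0)" for z i
  have \<theta>A: "\<theta> i \<in> subalg (coords {..<n})" if "i < Suc N" for i
    using that \<phi>A \<xi> by (auto simp: \<theta>_def less_Suc_eq)
  have \<theta>img: "insert \<xi> \<Phi> = \<theta> ` {..<Suc N}"
    by (auto simp: \<phi> \<theta>_def image_iff less_Suc_eq)
  define J where "J = vanish (Suc N) (pt ` Z)"
  have J: "ideal_of (Suc N) J" unfolding J_def by (rule ideal_of_vanish)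
  have J_iff: "f \<in> J \<longleftrightarrow> f \<in> subalg (coords {..<Suc N}) \<and> (\<forall>z\<in>Z. f (pt z) = 0)" for f
    by (auto simp: J_def vanish_def)
  have "\<exists>s\<in>subalg (coords {..<Suc N}). \<forall>z\<in>Z. s (pt z) = z j" if j: "j < n" for j
  proof -
    obtain \<psi> where \<psi>: "\<psi> \<in> subalg (\<theta> ` {..<Suc N})" "\<forall>z\<in>Z. \<psi> z = z j"
      using gen[OF j] unfolding \<theta>img by (elim bexE)
    obtain s where s: "s \<in> subalg (coords {..<Suc N})" "\<psi> = (\<lambda>x. s (\<lambda>i. \<theta> i x))"
      using subalg_image_coords[OF \<psi>(1)] .
    have "s (pt z) = \<psi> z" for z
      unfolding s(2) by (rule subalg_coords_cong[OF s(1)]) (simp add: pt_def)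
    with s(1) \<psi>(2) show ?thesis by (intro bexI[of _ s]) simp_all
  qed
  then have "\<forall>j\<in>{..<n}. \<exists>s. s \<in> subalg (coords {..<Suc N}) \<and> (\<forall>z\<in>Z. s (pt z) = z j)" by blast
  from bchoice[OF this] obtain s where
    s: "\<forall>j\<in>{..<n}. s j \<in> subalg (coords {..<Suc N}) \<and> (\<forall>z\<in>Z. s j (pt z) = z j)" ..
  \<comment> \<open>A polynomial inverse of \<open>pt\<close> on the image of \<open>Z\<close>; it
    exists because the generators express all coordinates on \<open>Z\<close>.\<close>
  define \<Psi> where "\<Psi> b j = (if j < n then s j b else 0)" for b j
  have \<Psi>A: "(\<lambda>b. \<Psi> b j) \<in> subalg (coords {..<Suc N})" for j
    using s by (cases "j < n") (simp_all add: \<Psi>_def subalg_const)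
  have \<Psi>aff: "\<Psi> b \<in> affine_space n" for b by (simp add: \<Psi>_def affine_space_def)
  have \<Psi>pt: "\<Psi> (pt z) = z" if "z \<in> Z" for z
    using that s closed_sub_affine[OF Z] by (auto simp: \<Psi>_def affine_space_def fun_eq_iff)
  have comp: "(\<lambda>b. f (\<Psi> b)) \<in> subalg (coords {..<Suc N})" if "f \<in> subalg (coords {..<n})" for f
    by (rule subalg_coords_subst[OF that \<Psi>A])
  have vanJ: "(\<lambda>b. f (\<Psi> b)) \<in> J" if "f \<in> vanish n Z" for f
    using that comp[of f] by (simp add: J_iff \<Psi>pt vanish_def)
  have \<theta>J: "(\<lambda>b. \<theta> i (\<Psi> b) - b i) \<in> J" if "i < Suc N" for i
  proof -
    have "(\<lambda>b. \<theta> i (\<Psi> b) - b i) \<in> subalg (coords {..<Suc N})"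
      using that by (intro subalg_diff comp \<theta>A subalg_coord) simp_all
    then show ?thesis using that by (simp add: J_iff \<Psi>pt pt_def)
  qed
  \<comment> \<open>So \<open>J\<close> cuts out exactly the image of \<open>Z\<close>: at a common
    zero \<open>b\<close> the point \<open>\<Psi> b\<close> lies in \<open>Z\<close>, and the
    generators take the values \<open>b i\<close> there.\<close>
  have zero: "\<Psi> b \<in> Z \<and> (\<forall>i<Suc N. \<theta> i (\<Psi> b) = b i)" if b: "\<forall>f\<in>J. f b = 0" for b
  proof (intro conjI allI impI)
    show "\<Psi> b \<in> Z"
    proof (rule closed_memI[OF Z \<Psi>aff])
      show "f (\<Psi> b) = 0" if "f \<in> vanish n Z" for f using bspec[OF b vanJ[OF that]] .
    qed
    show "\<theta> i (\<Psi> b) = b i" if "i < Suc N" for i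
      using bspec[OF b \<theta>J[OF that]] by simp
  qed
  obtain D G where G: "G \<in> last_polys N J" "degree G \<le> Suc D" "\<And>a. coeff G (Suc D) a = 1"
  proof -
    obtain D c where c: "\<forall>i<D. c i \<in> subalg \<Phi>" "\<forall>z\<in>Z. \<xi> z ^ D + (\<Sum>i<D. c i z * \<xi> z ^ i) = 0"
      using int unfolding integral_on_def by (elim exE conjE)
    have "\<exists>\<alpha>. \<alpha> \<in> subalg (coords {..<N}) \<and> (\<forall>z. c i z = \<alpha> (pt z))" if i: "i < D" for i
    proof -
      have "c i \<in> subalg (\<phi> ` {..<N})" using c(1) i \<phi> by simp
      then obtain \<alpha> where \<alpha>: "\<alpha> \<in> subalg (coords {..<N})" "c i = (\<lambda>x. \<alpha> (\<lambda>i. \<phi> i x))"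
        by (rule subalg_image_coords)
      have "c i z = \<alpha> (pt z)" for z
        unfolding \<alpha>(2) by (rule subalg_coords_cong[OF \<alpha>(1)]) (simp add: pt_def \<theta>_def)
      with \<alpha>(1) show ?thesis by (intro exI[of _ \<alpha>]) simp
    qed
    then have "\<forall>i\<in>{..<D}. \<exists>\<alpha>. \<alpha> \<in> subalg (coords {..<N}) \<and> (\<forall>z. c i z = \<alpha> (pt z))" by simp
    from bchoice[OF this] obtain \<alpha> where
      \<alpha>: "\<forall>i\<in>{..<D}. \<alpha> i \<in> subalg (coords {..<N}) \<and> (\<forall>z. c i z = \<alpha> i (pt z))" ..
    define G0 where "G0 = monom 1 D + (\<Sum>i<D. monom (\<alpha> i) i)"
    have cG0: "coeff G0 k = (if k = D then 1 else 0) + (if k < D then \<alpha> k else 0)" for k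
      by (simp add: G0_def coeff_sum)
    have G0A: "G0 \<in> polys_over (subalg (coords {..<N}))"
      unfolding polys_over_def mem_Collect_eq
    proof
      fix k show "coeff G0 k \<in> subalg (coords {..<N})"
        unfolding cG0 using \<alpha> by (cases "k < D"; cases "k = D") (simp_all add: subalg_fun_intros)
    qed
    have "poly G0 (\<lambda>x. x N) (pt z) = 0" if z: "z \<in> Z" for z
    proof -
      have "poly G0 (\<lambda>x. x N) (pt z) = pt z N ^ D + (\<Sum>i<D. \<alpha> i (pt z) * pt z N ^ i)"
        by (simp add: G0_def poly_sum poly_monom sum_fun_apply power_fun_apply)
      also have "\<dots> = \<xi> z ^ D + (\<Sum>i<D. c i z * \<xi> z ^ i)"
        using \<alpha> by (simp add: pt_def \<theta>_def)
      finally show ?thesis using c(2) z by simp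
    qed
    then have "G0 \<in> last_polys N J"
      using G0A poly_last_subalg[OF G0A] by (simp add: last_polys_def J_iff)
    \<comment> \<open>The additional factor ensures a degree of at least 1, as eliminating down to
      degree 1 requires.\<close>
    then have "monom 1 1 * G0 \<in> last_polys N J" by (rule last_polys_closed(4)[OF J])
    moreover have "degree (monom 1 1 * G0) \<le> Suc D"
      by (rule degree_le) (auto simp: coeff_monom_mult cG0)
    moreover have "coeff (monom 1 1 * G0) (Suc D) a = 1" for a
      by (simp add: coeff_monom_mult cG0)
    ultimately show ?thesis by (rule that)
  qed
  have local: "\<exists>F\<in>last_polys N J. coeff F 1 a \<noteq> 0 \<and> (\<forall>i>1. coeff F i a = 0)" for a
  proof -
    obtain F where F: "F \<in> last_polys N J" "\<forall>H\<in>last_polys N J. fibre a F dvd fibre a H"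
      using fibre_generator[OF J, of a] by (elim bexE)
    define q where "q = fibre a F"
    have "coeff (fibre a G) (Suc D) = 1" using G(3) by simp
    then have "fibre a G \<noteq> 0" by (metis coeff_0 zero_neq_one)
    then have q0: "q \<noteq> 0" using F(2) G(1) by (auto simp: q_def)
    have root: "\<Psi> (a(N := t)) \<in> Z \<and> (\<forall>i<Suc N. \<theta> i (\<Psi> (a(N := t))) = (a(N := t)) i)"
      if t: "poly q t = 0" for t
    proof (rule zero, intro ballI)
      fix f assume f: "f \<in> J"
      have "f \<in> subalg (coords {..<Suc N})" using f by (simp add: J_iff)
      from subalg_Suc_poly[OF this] obtain H where
        H: "H \<in> polys_over (subalg (coords {..<N}))" "poly H (\<lambda>x. x N) = f" by (elim bexE)
      then have "H \<in> last_polys N J" using f by (simp add: last_polys_def)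
      then have "q dvd fibre a H" using F(2) by (simp add: q_def)
      then obtain r where "fibre a H = q * r" by (rule dvdE)
      then have "poly (fibre a H) t = 0" using t by simp
      then show "f (a(N := t)) = 0" by (simp only: poly_fibre[OF H(1)] H(2))
    qed
    have rootZ: "\<Psi> (a(N := t)) \<in> Z" if "poly q t = 0" for t
      using root[OF that] by (rule conjunct1)
    have root\<theta>: "\<theta> i (\<Psi> (a(N := t))) = (a(N := t)) i" if "poly q t = 0" "i < Suc N" for t i
      using root[OF that(1)] that(2) by (elim conjE allE[of _ i] impE)
    have uniq: "t = t'" if t: "poly q t = 0" "poly q t' = 0" for t t'
    proof -
      let ?z = "\<Psi> (a(N := t))" and ?z' = "\<Psi> (a(N := t'))"
      have "?z = ?z'"
      proof (rule inj[OF rootZ[OF t(1)] rootZ[OF t(2)]])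
        show "\<forall>f\<in>\<Phi>. f ?z = f ?z'"
        proof
          fix f assume "f \<in> \<Phi>"
          then obtain i where i: "i < N" "f = \<theta> i" by (auto simp: \<phi> \<theta>_def)
          then show "f ?z = f ?z'" using root\<theta>[OF t(1), of i] root\<theta>[OF t(2), of i] by simp
        qed
      qed
      then have "\<theta> N ?z = \<theta> N ?z'" by (rule arg_cong)
      then show ?thesis using root\<theta>[OF t(1), of N] root\<theta>[OF t(2), of N] by simp
    qed
    \<comment> \<open>At a double root every element of \<open>J\<close> has derivative 0 in the
      direction \<open>e\<close> of the last coordinate. The image \<open>v\<close> of
      \<open>e\<close> under the derivative of \<Psi> is then tangent to \<open>Z\<close> and killed
      by \<Phi>, although the derivative of \<xi> along it is 1.\<close>
    have simple: "poly (pderiv q) t \<noteq> 0" if t: "poly q t = 0" for t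
    proof
      assume dq: "poly (pderiv q) t = 0"
      define b where "b = a(N := t)"
      define e where "e i = (if i = N then 1 else 0 :: 'k)" for i
      have dJ: "dird f b e = 0" if f: "f \<in> J" for f
      proof -
        have fA: "f \<in> subalg (coords {..<Suc N})" using f by (simp add: J_iff)
        from subalg_Suc_poly[OF this] obtain H where
          H: "H \<in> polys_over (subalg (coords {..<N}))" "poly H (\<lambda>x. x N) = f" by (elim bexE)
        then have "H \<in> last_polys N J" using f by (simp add: last_polys_def)
        then have "q dvd fibre a H" using F(2) by (simp add: q_def)
        then obtain r where r: "fibre a H = q * r" by (elim dvdE)
        define \<gamma> where "\<gamma> i = (if i = N then [:0, 1:] else [:a i:])" for i
        have \<gamma>: "(\<lambda>i. poly (\<gamma> i) u) = a(N := u)" for u by (auto simp: \<gamma>_def fun_eq_iff)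
        have \<gamma>': "(\<lambda>i. poly (pderiv (\<gamma> i)) t) = e" by (auto simp: \<gamma>_def e_def fun_eq_iff pderiv_pCons)
        have "f (\<lambda>i. poly (\<gamma> i) u) = poly (fibre a H) u" for u
          using poly_fibre[OF H(1), of a u] H(2) by (simp add: \<gamma>)
        from dird_curve[OF fA this, of t]
        have "dird f b e = poly (pderiv (fibre a H)) t" by (simp add: \<gamma> \<gamma>' b_def)
        also have "\<dots> = 0" using t dq by (simp add: r pderiv_mult)
        finally show ?thesis .
      qed
      define v where "v j = dird (\<lambda>x. \<Psi> x j) b e" for j
      have dcomp: "dird (\<lambda>x. f (\<Psi> x)) b e = dird f (\<Psi> b) v" if "f \<in> subalg (coords {..<n})" for f
        unfolding v_def by (rule dird_comp[OF that \<Psi>A])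
      have bZ: "\<Psi> b \<in> Z" using rootZ[OF t] by (simp add: b_def)
      have d\<theta>: "dird (\<theta> i) (\<Psi> b) v = e i" if i: "i < Suc N" for i
      proof -
        have "dird (\<lambda>x. \<theta> i (\<Psi> x) - x i) b e = dird (\<lambda>x. \<theta> i (\<Psi> x)) b e - dird (\<lambda>x. x i) b e"
          using i by (intro dird_diff[where I = "{..<Suc N}"] comp \<theta>A subalg_coord) simp_all
        then show ?thesis using dJ[OF \<theta>J[OF i]] dcomp[OF \<theta>A[OF i]] by simp
      qed
      have "v = (\<lambda>_. 0)"
      proof (rule imm[OF bZ])
        show "v \<in> affine_space n" by (simp add: v_def affine_space_def \<Psi>_def)
        show "\<forall>f\<in>vanish n Z. dird f (\<Psi> b) v = 0"
        proof
          fix f assume f: "f \<in> vanish n Z"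
          then show "dird f (\<Psi> b) v = 0" using dJ[OF vanJ[OF f]] dcomp[of f] by (simp add: vanish_def)
        qed
        show "\<forall>f\<in>\<Phi>. dird f (\<Psi> b) v = 0"
        proof
          fix f assume "f \<in> \<Phi>"
          then obtain i where "i < N" "f = \<theta> i" by (auto simp: \<phi> \<theta>_def)
          then show "dird f (\<Psi> b) v = 0" using d\<theta>[of i] by (simp add: e_def)
        qed
      qed
      then have "dird (\<theta> N) (\<Psi> b) v = 0" using dird_zero[OF \<theta>A[of N]] by simp
      with d\<theta>[of N] show False by (simp add: e_def)
    qed
    have "degree q \<le> 1"
    proof (cases "degree q = 0")
      case False
      then obtain t where t: "poly q t = 0" using alg_closed_imp_poly_has_root by blast
      then obtain r where r: "q = [:- t, 1:] * r" using poly_eq_0_iff_dvd by (metis dvdE)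
      have "poly (pderiv q) t = poly r t" unfolding r pderiv_mult by (simp add: pderiv_pCons)
      then have rt: "poly r t \<noteq> 0" using simple[OF t] by simp
      have "degree r = 0"
      proof (rule ccontr)
        assume "degree r \<noteq> 0"
        then obtain t' where t': "poly r t' = 0" using alg_closed_imp_poly_has_root by blast
        then have "poly q t' = 0" by (simp add: r)
        from uniq[OF t this] t' rt show False by simp
      qed
      moreover have "r \<noteq> 0" using rt by auto
      ultimately show ?thesis unfolding r by (subst degree_mult_eq) auto
    qed simp
    then consider "degree q = 0" | "degree q = 1" by linarith
    then show ?thesis
    proof cases
      case 1
      \<comment> \<open>Over a point with empty fibre \<open>q\<close> is a nonzero constant;
        multiplication by the variable moves it to degree 1.\<close>
      then have c0: "coeff q 0 \<noteq> 0" "coeff q i = 0" if "i > 0" for i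
        using q0 leading_coeff_0_iff[of q] coeff_eq_0[of q i] that by auto
      have "monom 1 1 * F \<in> last_polys N J" by (rule last_polys_closed(4)[OF J F(1)])
      moreover have "coeff (monom 1 1 * F) 1 a \<noteq> 0"
        using c0(1)[of 1] by (simp add: coeff_monom_mult q_def)
      moreover have "coeff (monom 1 1 * F) i a = 0" if "i > 1" for i
        using c0(2)[of "i - 1"] that by (simp add: coeff_monom_mult q_def)
      ultimately show ?thesis by blast
    next
      case 2
      then have "coeff q 1 \<noteq> 0" using q0 leading_coeff_0_iff[of q] by simp
      moreover have "coeff q i = 0" if "i > 1" for i using 2 that by (intro coeff_eq_0) simp
      ultimately show ?thesis using F(1) by (intro bexI[of _ F]) (simp_all add: q_def)
    qed
  qed
  \<comment> \<open>The denominators of \<xi> over the algebra generated by \<Phi>. Each local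
    equation of degree 1 for \<xi> contributes its leading coefficient, and the Nullstellensatz
    makes 1 a denominator.\<close>
  define I where "I = {r \<in> subalg (coords {..<N}). \<exists>s\<in>subalg (coords {..<N}). \<forall>z\<in>Z. r (pt z) * \<xi> z = s (pt z)}"
  have "(\<lambda>_. 1) \<in> I"
  proof (rule nullstellensatz)
    show "ideal_of N I"
      unfolding ideal_of_def
    proof (intro conjI ballI)
      show "I \<subseteq> subalg (coords {..<N})" by (auto simp: I_def)
      show "(\<lambda>_. 0) \<in> I" unfolding I_def
        by (intro CollectI conjI subalg_const bexI[of _ "\<lambda>_. 0"]) simp
    next
      fix g h :: "(nat \<Rightarrow> 'k) \<Rightarrow> 'k" assume "g \<in> I" "h \<in> I"
      then obtain p q where "g \<in> subalg (coords {..<N})" "p \<in> subalg (coords {..<N})"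
        "\<forall>z\<in>Z. g (pt z) * \<xi> z = p (pt z)" "h \<in> subalg (coords {..<N})"
        "q \<in> subalg (coords {..<N})" "\<forall>z\<in>Z. h (pt z) * \<xi> z = q (pt z)" by (auto simp: I_def)
      then show "(\<lambda>x. g x + h x) \<in> I"
        unfolding I_def
        by (intro CollectI conjI subalg_add bexI[of _ "\<lambda>x. p x + q x"]) (simp_all add: distrib_right)
    next
      fix g h :: "(nat \<Rightarrow> 'k) \<Rightarrow> 'k" assume "g \<in> I" "h \<in> subalg (coords {..<N})"
      then obtain p where "g \<in> subalg (coords {..<N})" "p \<in> subalg (coords {..<N})"
        "\<forall>z\<in>Z. g (pt z) * \<xi> z = p (pt z)" by (auto simp: I_def)
      then show "(\<lambda>x. h x * g x) \<in> I"
        using \<open>h \<in> subalg (coords {..<N})\<close> unfolding I_def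
        by (intro CollectI conjI subalg_mult bexI[of _ "\<lambda>x. h x * p x"]) (simp_all add: mult.assoc)
    qed
    fix a :: "nat \<Rightarrow> 'k"
    obtain F where F: "F \<in> last_polys N J" "coeff F 1 a \<noteq> 0" "\<forall>i>1. coeff F i a = 0"
      using local[of a] by (elim bexE conjE)
    have "\<exists>H\<in>last_polys N J. degree H \<le> 1 \<and> coeff H 1 a \<noteq> 0"
      by (rule last_polys_elimination[OF J G(1,2) _ F(1,2)]) (use G(3) F(3) in simp_all)
    then obtain H where H: "H \<in> last_polys N J" "degree H \<le> 1" "coeff H 1 a \<noteq> 0"
      by (elim bexE conjE)
    have HA: "coeff H k \<in> subalg (coords {..<N})" for k
      using H(1) by (simp add: last_polys_def polys_over_def)
    have "coeff H 1 (pt z) * \<xi> z = - coeff H 0 (pt z)" if z: "z \<in> Z" for z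
    proof -
      have "poly H (\<lambda>x. x N) (pt z) = 0" using H(1) z by (simp add: last_polys_def J_iff)
      then have "coeff H 0 (pt z) + coeff H 1 (pt z) * \<xi> z = 0"
        by (simp add: poly_fun_apply[OF H(2)] pt_def \<theta>_def)
      then show ?thesis by (simp add: eq_neg_iff_add_eq_0 add.commute)
    qed
    then have "coeff H 1 \<in> I"
      unfolding I_def using HA
      by (intro CollectI conjI bexI[of _ "\<lambda>x. - coeff H 0 x"] subalg_uminus) simp_all
    then show "\<exists>f\<in>I. f a \<noteq> 0" using H(3) by (intro bexI[of _ "coeff H 1"])
  qed
  then obtain s where s: "s \<in> subalg (coords {..<N})" "\<forall>z\<in>Z. \<xi> z = s (pt z)" by (auto simp: I_def)
  have "(\<lambda>z. s (pt z)) \<in> subalg \<Phi>"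
  proof (rule subalg_coords_subst[OF s(1)])
    fix i assume "i \<in> {..<N}"
    then show "(\<lambda>z. pt z i) \<in> subalg \<Phi>" by (auto simp: pt_def \<theta>_def \<phi> intro: subalg_base)
  qed
  with s(2) show ?thesis by (intro bexI[of _ "\<lambda>z. s (pt z)"])
qed

lemma subalg_on_trans:
  assumes "f \<in> subalg \<Phi>" "\<And>\<phi>. \<phi> \<in> \<Phi> \<Longrightarrow> \<exists>g\<in>subalg \<Psi>. \<forall>z\<in>Z. \<phi> z = g z"
  shows "\<exists>g\<in>subalg \<Psi>. \<forall>z\<in>Z. f z = g z"
  using assms(1)
proof induction
  case (subalg_const c)
  show ?case by (intro bexI[of _ "\<lambda>_. c"] subalg.subalg_const) simp
next
  case (subalg_add f g)
  then obtain f' g' where "f' \<in> subalg \<Psi>" "\<forall>z\<in>Z. f z = f' z" "g' \<in> subalg \<Psi>" "\<forall>z\<in>Z. g z = g' z"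
    by (elim bexE)
  then show ?case by (intro bexI[of _ "\<lambda>x. f' x + g' x"] subalg.subalg_add) simp_all
next
  case (subalg_mult f g)
  then obtain f' g' where "f' \<in> subalg \<Psi>" "\<forall>z\<in>Z. f z = f' z" "g' \<in> subalg \<Psi>" "\<forall>z\<in>Z. g z = g' z"
    by (elim bexE)
  then show ?case by (intro bexI[of _ "\<lambda>x. f' x * g' x"] subalg.subalg_mult) simp_all
qed (rule assms(2))

lemma integral_on_mono: "integral_on X A \<xi> \<Longrightarrow> A \<subseteq> B \<Longrightarrow> integral_on X B \<xi>"
  unfolding integral_on_def by (meson subsetD)

text \<open>The members of \<Xi> are discarded one at a time. Injectivity, immersivity and
  integrality over \<Phi> remain valid when generators are added, so they are available at every
  stage.\<close>

lemma closed_embedding: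
  fixes Z :: "(nat \<Rightarrow> 'k::{alg_closed_field, field_char_0}) set"
  assumes Z: "closedin (zariski n) Z"
    and \<Phi>: "finite \<Phi>" "\<Phi> \<subseteq> subalg (coords {..<n})"
    and \<Xi>: "finite \<Xi>" "\<Xi> \<subseteq> subalg (coords {..<n})"
    and gen: "\<And>j. j < n \<Longrightarrow> \<exists>\<psi>\<in>subalg (\<Xi> \<union> \<Phi>). \<forall>z\<in>Z. \<psi> z = z j"
    and int: "\<And>\<xi>. \<xi> \<in> \<Xi> \<Longrightarrow> integral_on Z (subalg \<Phi>) \<xi>"
    and inj: "\<And>z w. z \<in> Z \<Longrightarrow> w \<in> Z \<Longrightarrow> \<forall>\<phi>\<in>\<Phi>. \<phi> z = \<phi> w \<Longrightarrow> z = w"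
    and imm: "\<And>z v. z \<in> Z \<Longrightarrow> v \<in> affine_space n \<Longrightarrow> \<forall>f\<in>vanish n Z. dird f z v = 0 \<Longrightarrow>
      \<forall>\<phi>\<in>\<Phi>. dird \<phi> z v = 0 \<Longrightarrow> v = (\<lambda>_. 0)"
    and j: "j < n"
  shows "\<exists>\<psi>\<in>subalg \<Phi>. \<forall>z\<in>Z. \<psi> z = z j"
  using \<Xi> gen int j
proof (induction \<Xi> arbitrary: j rule: finite_induct)
  case empty
  then show ?case by simp
next
  case (insert \<xi> \<Xi>)
  have "\<exists>s\<in>subalg (\<Xi> \<union> \<Phi>). \<forall>z\<in>Z. \<xi> z = s z"
  proof (rule remove_generator[OF Z])
    show "finite (\<Xi> \<union> \<Phi>)" using insert.hyps(1) \<Phi>(1) by simp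
    show "\<Xi> \<union> \<Phi> \<subseteq> subalg (coords {..<n})" "\<xi> \<in> subalg (coords {..<n})"
      using insert.prems(1) \<Phi>(2) by simp_all
    show "\<exists>\<psi>\<in>subalg (insert \<xi> (\<Xi> \<union> \<Phi>)). \<forall>z\<in>Z. \<psi> z = z j" if "j < n" for j
      using insert.prems(2)[OF that] by simp
    show "integral_on Z (subalg (\<Xi> \<union> \<Phi>)) \<xi>"
    proof (rule integral_on_mono)
      show "integral_on Z (subalg \<Phi>) \<xi>" by (rule insert.prems(3)) simp
      show "subalg \<Phi> \<subseteq> subalg (\<Xi> \<union> \<Phi>)" by (rule subsetI, erule subalg_mono) simp
    qed
    show "z = w" if "z \<in> Z" "w \<in> Z" "\<forall>\<phi>\<in>\<Xi> \<union> \<Phi>. \<phi> z = \<phi> w" for z w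
      by (rule inj[OF that(1,2)]) (use that(3) in simp)
    show "v = (\<lambda>_. 0)" if "z \<in> Z" "v \<in> affine_space n" "\<forall>f\<in>vanish n Z. dird f z v = 0"
      "\<forall>\<phi>\<in>\<Xi> \<union> \<Phi>. dird \<phi> z v = 0" for z v
      by (rule imm[OF that(1,2,3)]) (use that(4) in simp)
  qed
  then obtain s where s: "s \<in> subalg (\<Xi> \<union> \<Phi>)" "\<forall>z\<in>Z. \<xi> z = s z" by (elim bexE)
  show ?case
  proof (rule insert.IH)
    show "\<Xi> \<subseteq> subalg (coords {..<n})" using insert.prems(1) by simp
    show "integral_on Z (subalg \<Phi>) \<xi>'" if "\<xi>' \<in> \<Xi>" for \<xi>'
      by (rule insert.prems(3)) (use that in simp)
    show "j < n" by (rule insert.prems(4))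
    fix j assume "j < n"
    from insert.prems(2)[OF this] obtain \<psi> where \<psi>: "\<psi> \<in> subalg (insert \<xi> (\<Xi> \<union> \<Phi>))" "\<forall>z\<in>Z. \<psi> z = z j"
      by auto
    have "\<exists>g\<in>subalg (\<Xi> \<union> \<Phi>). \<forall>z\<in>Z. \<psi> z = g z"
    proof (rule subalg_on_trans[OF \<psi>(1)])
      fix \<phi> assume "\<phi> \<in> insert \<xi> (\<Xi> \<union> \<Phi>)"
      then consider "\<phi> = \<xi>" | "\<phi> \<in> \<Xi> \<union> \<Phi>" by blast
      then show "\<exists>g\<in>subalg (\<Xi> \<union> \<Phi>). \<forall>z\<in>Z. \<phi> z = g z"
      proof cases
        case 1
        with s show ?thesis by (intro bexI[of _ s]) simp_all
      next
        case 2
        then show ?thesis by (intro bexI[of _ \<phi>] subalg_base) simp_all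
      qed
    qed
    then obtain g where "g \<in> subalg (\<Xi> \<union> \<Phi>)" "\<forall>z\<in>Z. \<psi> z = g z" by (elim bexE)
    with \<psi>(2) show "\<exists>\<psi>\<in>subalg (\<Xi> \<union> \<Phi>). \<forall>z\<in>Z. \<psi> z = z j" by (intro bexI[of _ g]) simp_all
  qed
qed

section \<open>A surjection onto the complement\<close>

lemma surjection_onto_complement:
  fixes Z :: "(nat \<Rightarrow> 'k::{alg_closed_field, field_char_0}) set"
  assumes n: "n \<ge> 2" and Z: "closedin (zariski n) Z" "Z \<subseteq> codim2_subspace n"
  shows "\<exists>\<Theta>. (\<forall>i<n. (\<lambda>x. \<Theta> x i) \<in> subalg (coords {..<n})) \<and> \<Theta> ` affine_space n = affine_space n - Z"
proof -
  obtain T where T: "T \<subseteq> vanish n Z" "finite T" "\<And>x. \<forall>f\<in>T. f x = 0 \<Longrightarrow> \<forall>f\<in>vanish n Z. f x = 0"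
    using finite_equations[of "vanish n Z" n] by (auto simp: vanish_def)
  obtain r and p :: "nat \<Rightarrow> (nat \<Rightarrow> 'k) \<Rightarrow> 'k" where p: "T = p ` {..<r}"
    using finite_imp_nat_seg_image_inj_on[OF T(2)] by (auto simp: lessThan_def)
  have pA: "p j \<in> subalg (coords {..<n})" and pZ: "x \<in> Z \<Longrightarrow> p j x = 0" if "j < r" for j x
    using T(1) that by (auto simp: p vanish_def)
  have Z_iff: "x \<in> Z \<longleftrightarrow> x \<in> affine_space n \<and> x 0 = 0 \<and> x 1 = 0 \<and> (\<forall>j<r. p j x = 0)" for x
  proof (intro iffI conjI allI impI)
    assume x: "x \<in> affine_space n \<and> x 0 = 0 \<and> x 1 = 0 \<and> (\<forall>j<r. p j x = 0)"
    then have "\<forall>f\<in>T. f x = 0" by (auto simp: p)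
    from T(3)[OF this] x show "x \<in> Z" by (intro closed_memI[OF Z(1)]) simp_all
  qed (use Z(2) pZ in \<open>auto simp: codim2_subspace_def\<close>)
  define pr where "pr x = x(0 := 0, 1 := 0)" for x :: "nat \<Rightarrow> 'k"
  have prA: "(\<lambda>x. pr x i) \<in> subalg (coords {..<n})" if "i < n" for i
    using that by (cases "i = 0 \<or> i = 1") (auto simp: pr_def intro: subalg_const)
  \<comment> \<open>The summand \<open>a\<close> with coefficient 1 makes
    \<open>poly q1 0 = 1\<close> below, so roots of \<open>q1\<close> are nonzero. The summand with
    \<open>u\<close> makes \<open>q1\<close> nonconstant whenever \<open>u\<close> is nonzero, at a
    power not occupied by any \<open>p j\<close>.\<close>
  define Q where "Q a u x = a + (\<Sum>j<r. p j (pr x) * a ^ (j + 2)) + u * a ^ (r + 2)" for a u x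
  define \<Theta> where "\<Theta> x i = (if i = 0 then 1 + x 0 * x 1
    else if i = 1 then Q (x 0) (1 + x 0 * x 1) x else x i)" for x :: "nat \<Rightarrow> 'k" and i :: nat
  have pr_pr: "pr (\<Theta> x) = pr x" for x by (auto simp: pr_def \<Theta>_def)
  show ?thesis
  proof (intro exI[of _ \<Theta>] conjI allI impI)
    fix i assume i: "i < n"
    have x01: "(\<lambda>x. x 0) \<in> subalg (coords {..<n})" "(\<lambda>x. x 1) \<in> subalg (coords {..<n})"
      using n by (auto intro: subalg_coord)
    have ppr: "(\<lambda>x. p j (pr x)) \<in> subalg (coords {..<n})" if "j < r" for j
      by (rule subalg_coords_subst[OF pA[OF that]]) (simp add: prA)
    consider "i = 0" | "i = 1" | "i \<noteq> 0" "i \<noteq> 1" by blast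
    then show "(\<lambda>x. \<Theta> x i) \<in> subalg (coords {..<n})"
    proof cases
      case 1
      then have "(\<lambda>x. \<Theta> x i) = (\<lambda>x. 1 + x 0 * x 1)" by (simp add: \<Theta>_def)
      then show ?thesis by (simp only:) (intro subalg_intros x01)
    next
      case 2
      then have "(\<lambda>x. \<Theta> x i) = (\<lambda>x. x 0 + (\<Sum>j<r. p j (pr x) * x 0 ^ (j + 2)) + (1 + x 0 * x 1) * x 0 ^ (r + 2))"
        by (simp add: \<Theta>_def Q_def)
      then show ?thesis by (simp only:) (intro subalg_intros x01 ppr, simp)
    next
      case 3
      then show ?thesis using i by (auto simp: \<Theta>_def)
    qed
  next
    show "\<Theta> ` affine_space n = affine_space n - Z"
    proof (intro equalityI subsetI)
      fix y assume "y \<in> \<Theta> ` affine_space n"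
      then obtain x where x: "x \<in> affine_space n" "y = \<Theta> x" by blast
      have "y \<in> affine_space n" using x n by (auto simp: affine_space_def \<Theta>_def)
      moreover have "y \<notin> Z"
      proof
        assume "y \<in> Z"
        then have y: "y 0 = 0" "y 1 = 0" "\<And>j. j < r \<Longrightarrow> p j y = 0" by (auto simp: Z_iff)
        have "pr y = y" using y by (auto simp: pr_def)
        then have "p j (pr x) = 0" if "j < r" for j using y(3)[OF that] pr_pr[of x] x(2) by simp
        moreover have u: "1 + x 0 * x 1 = 0" using y(1) by (simp add: x \<Theta>_def)
        ultimately have "y 1 = x 0" by (simp add: x \<Theta>_def Q_def)
        with y(2) u show False by simp
      qed
      ultimately show "y \<in> affine_space n - Z" by blast
    next
      fix y assume y: "y \<in> affine_space n - Z"
      define u v where "u = y 0" and "v = y 1"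
      define q1 where "q1 = [:1:] + (\<Sum>j<r. monom (p j (pr y)) (j + 1)) + monom u (r + 1)"
      have Qq1: "Q a u y = a * poly q1 a" for a
        by (simp add: Q_def q1_def poly_sum poly_monom distrib_left sum_distrib_left mult_ac)
      have q1_0: "poly q1 0 = 1" by (simp add: q1_def poly_sum poly_monom)
      have coeff_q1: "coeff q1 (Suc k) = (if k < r then p k (pr y) else 0) + (if k = r then u else 0)" for k
        by (auto simp: q1_def coeff_sum)
      \<comment> \<open>A nonzero \<open>a\<close> allows \<open>1 + a * b = u\<close> to be solved
        for \<open>b\<close>; for \<open>u = 1\<close> the value \<open>b = 0\<close> works with
        every \<open>a\<close>. Only for \<open>v = 0\<close> and \<open>u \<noteq> 1\<close> does
        the root 0 have to be avoided, by taking a root of \<open>q1\<close>.\<close>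
      have "\<exists>a. Q a u y = v \<and> (u = 1 \<or> a \<noteq> 0)"
      proof (cases "v = 0 \<and> u \<noteq> 1")
        case True
        have "\<exists>k. coeff q1 (Suc k) \<noteq> 0"
        proof (cases "u = 0")
          case False
          then show ?thesis using coeff_q1[of r] by (intro exI[of _ r]) simp
        next
          case u0: True
          then have "pr y = y" using True by (auto simp: pr_def u_def v_def)
          moreover obtain j where "j < r" "p j y \<noteq> 0"
            using y u0 True by (auto simp: Z_iff u_def v_def)
          ultimately show ?thesis using coeff_q1[of j] by (intro exI[of _ j]) simp
        qed
        then have "degree q1 > 0" using le_degree[of q1] by (metis less_le_trans zero_less_Suc)
        then obtain a where a: "poly q1 a = 0" using alg_closed_imp_poly_has_root by blast
        then have "a \<noteq> 0" using q1_0 by auto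
        then show ?thesis using a Qq1[of a] True by (intro exI[of _ a]) simp
      next
        case False
        define q where "q = [:0, 1:] * q1 - [:v:]"
        have "coeff q1 0 = 1" using q1_0 by (simp add: poly_0_coeff_0)
        then have "coeff q 1 = 1" by (simp add: q_def)
        then have "degree q > 0" using le_degree[of q 1] by simp
        then obtain a where a: "poly q a = 0" using alg_closed_imp_poly_has_root by blast
        then have "Q a u y = v" by (simp add: Qq1 q_def)
        moreover have "u = 1 \<or> a \<noteq> 0" using False \<open>Q a u y = v\<close> Qq1[of a] by auto
        ultimately show ?thesis by blast
      qed
      then obtain a where a: "Q a u y = v" "u = 1 \<or> a \<noteq> 0" by blast
      \<comment> \<open>For \<open>u = 1\<close> the quotient is 0, also at \<open>a = 0\<close> by
        the convention for division by zero.\<close>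
      define x where "x = y(0 := a, 1 := (u - 1) / a)"
      have ux: "1 + x 0 * x 1 = u" using a(2) by (auto simp: x_def)
      have "Q a u x = v" using a(1) by (simp add: Q_def x_def pr_def)
      then have "\<Theta> x = y" using ux by (auto simp: \<Theta>_def fun_eq_iff u_def v_def x_def)
      moreover have "x \<in> affine_space n" using y n by (auto simp: x_def affine_space_def)
      ultimately show "y \<in> \<Theta> ` affine_space n" by blast
    qed
  qed
qed

section \<open>Polynomial bijections of affine space\<close>

text \<open>A polynomial bijection is what the final step uses: it carries the complement of a set
  onto the complement of its image. Those constructed below are compositions of linear maps and
  shears.\<close>

definition poly_bij :: "nat \<Rightarrow> ((nat \<Rightarrow> 'k::comm_ring_1) \<Rightarrow> nat \<Rightarrow> 'k) \<Rightarrow> bool" where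
  "poly_bij n \<Theta> \<longleftrightarrow> bij_betw \<Theta> (affine_space n) (affine_space n) \<and>
     (\<forall>i<n. (\<lambda>x. \<Theta> x i) \<in> subalg (coords {..<n}))"

lemma poly_bij_comp:
  assumes "poly_bij n \<Theta>" "poly_bij n \<Theta>'"
  shows "poly_bij n (\<lambda>x. \<Theta> (\<Theta>' x))"
  unfolding poly_bij_def
proof (intro conjI allI impI)
  show "bij_betw (\<lambda>x. \<Theta> (\<Theta>' x)) (affine_space n) (affine_space n)"
    using bij_betw_trans[of \<Theta>' _ _ \<Theta>] assms by (auto simp: poly_bij_def comp_def)
  fix i assume "i < n"
  then have "(\<lambda>x. \<Theta> x i) \<in> subalg (coords {..<n})" using assms(1) by (simp add: poly_bij_def)
  then show "(\<lambda>x. \<Theta> (\<Theta>' x) i) \<in> subalg (coords {..<n})"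
    by (rule subalg_coords_subst) (use assms(2) in \<open>simp add: poly_bij_def\<close>)
qed

definition linmap :: "nat \<Rightarrow> (nat \<Rightarrow> nat \<Rightarrow> 'k::comm_ring_1) \<Rightarrow> (nat \<Rightarrow> 'k) \<Rightarrow> nat \<Rightarrow> 'k" where
  "linmap n M x i = (if i < n then \<Sum>j<n. M i j * x j else 0)"

lemma linmap_inverse:
  assumes "\<And>i j. i < n \<Longrightarrow> j < n \<Longrightarrow> (\<Sum>r<n. N i r * M r j) = (if i = j then 1 else 0)"
    "x \<in> affine_space n"
  shows "linmap n N (linmap n M x) = x"
proof
  fix i
  show "linmap n N (linmap n M x) i = x i"
  proof (cases "i < n")
    case True
    have "linmap n N (linmap n M x) i = (\<Sum>r<n. \<Sum>j<n. N i r * M r j * x j)"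
      using True by (simp add: linmap_def sum_distrib_left mult.assoc)
    also have "\<dots> = (\<Sum>j<n. (\<Sum>r<n. N i r * M r j) * x j)"
      by (subst sum.swap) (simp add: sum_distrib_right)
    also have "\<dots> = (\<Sum>j<n. if i = j then x j else 0)"
      using True by (intro sum.cong) (simp_all add: assms(1))
    also have "\<dots> = x i" using True by simp
    finally show ?thesis .
  next
    case False
    then show ?thesis using assms(2) by (simp add: linmap_def affine_space_def)
  qed
qed

lemma poly_bij_linmap:
  assumes "\<And>i j. i < n \<Longrightarrow> j < n \<Longrightarrow> (\<Sum>r<n. N i r * M r j) = (if i = j then 1 else 0)"
    "\<And>i j. i < n \<Longrightarrow> j < n \<Longrightarrow> (\<Sum>r<n. M i r * N r j) = (if i = j then 1 else 0)"
  shows "poly_bij n (linmap n M)"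
  unfolding poly_bij_def
proof (intro conjI allI impI)
  show "bij_betw (linmap n M) (affine_space n) (affine_space n)"
    by (rule bij_betw_byWitness[where f' = "linmap n N"])
      (use linmap_inverse[OF assms(1)] linmap_inverse[OF assms(2)] in \<open>auto simp: linmap_def affine_space_def\<close>)
  fix i assume "i < n"
  then have "(\<lambda>x. linmap n M x i) = (\<lambda>x. \<Sum>j<n. M i j * x j)" by (simp add: linmap_def)
  also have "\<dots> \<in> subalg (coords {..<n})" by (intro subalg_sum subalg_mult subalg_const subalg_coord)
  finally show "(\<lambda>x. linmap n M x i) \<in> subalg (coords {..<n})" .
qed

text \<open>The rows together with the unit vector \<open>i\<close> are \<open>n + 1\<close> vectors
  in a space of dimension \<open>n\<close>. In a relation between them the unit vector must occur,
  since the rows are independent; solving for it gives row \<open>i\<close> of a left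
  inverse.\<close>

lemma inverse_matrix:
  fixes M :: "nat \<Rightarrow> nat \<Rightarrow> 'k::field"
  assumes indep: "\<And>b. \<exists>r<n. b r \<noteq> 0 \<Longrightarrow> \<exists>j<n. (\<Sum>r<n. M r j * b r) \<noteq> 0"
  shows "\<exists>N. (\<forall>i<n. \<forall>j<n. (\<Sum>r<n. N i r * M r j) = (if i = j then 1 else 0)) \<and>
    (\<forall>i<n. \<forall>j<n. (\<Sum>r<n. M i r * N r j) = (if i = j then 1 else 0))"
proof -
  define \<delta> where "\<delta> k j = (if j = k then 1 else 0 :: 'k)" for k j :: nat
  have span: "(\<lambda>j. if j < n then h j else 0) \<in> fvs.span (\<delta> ` {..<n})" for h
  proof -
    have "(\<lambda>j. if j < n then h j else 0) = (\<Sum>k<n. (\<lambda>j. h k * \<delta> k j))"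
      by (auto simp: fun_eq_iff sum_fun_apply \<delta>_def if_distrib cong: if_cong)
    also have "\<dots> \<in> fvs.span (\<delta> ` {..<n})"
      by (intro fvs.span_sum fvs.span_scale fvs.span_base) simp
    finally show ?thesis .
  qed
  have "\<exists>b. \<forall>j<n. (\<Sum>r<n. b r * M r j) = (if i = j then 1 else 0)" if i: "i < n" for i
  proof -
    define g where "g e j = (if j < n then if e = n then \<delta> i j else M e j else 0)" for e j
    have "card (\<delta> ` {..<n}) < card {..n}" using card_image_le[of "{..<n}" \<delta>] by simp
    moreover have "g ` {..n} \<subseteq> fvs.span (\<delta> ` {..<n})"
      using span[of "\<lambda>j. if e = n then \<delta> i j else M e j" for e] by (auto simp: g_def[abs_def])
    ultimately obtain a where a: "\<exists>e\<in>{..n}. a e \<noteq> 0" "\<And>x. (\<Sum>e\<le>n. a e * g e x) = 0"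
      using span_family_dependent[of "{..n}" "\<delta> ` {..<n}" g] by auto
    have rel: "(\<Sum>r<n. a r * M r j) + a n * \<delta> i j = 0" if "j < n" for j
    proof -
      have "(\<Sum>r<n. a r * M r j) = (\<Sum>r<n. a r * g r j)" using that by (simp add: g_def)
      then show ?thesis using a(2)[of j] that by (simp add: g_def flip: lessThan_Suc_atMost)
    qed
    have "a n \<noteq> 0"
    proof
      assume 0: "a n = 0"
      have "\<exists>r<n. a r \<noteq> 0" using a(1) 0 by (metis atMost_iff le_neq_implies_less)
      from indep[OF this] rel 0 show False by (auto simp: mult.commute)
    qed
    have "(\<Sum>r<n. (- a r / a n) * M r j) = (if i = j then 1 else 0)" if "j < n" for j
    proof -
      have "(\<Sum>r<n. (- a r / a n) * M r j) = - ((\<Sum>r<n. a r * M r j) / a n)"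
        by (simp add: sum_divide_distrib sum_negf)
      also have "(\<Sum>r<n. a r * M r j) = - (a n * \<delta> i j)" using rel[OF that] by (simp add: eq_neg_iff_add_eq_0)
      finally show ?thesis using \<open>a n \<noteq> 0\<close> by (simp add: \<delta>_def)
    qed
    then show ?thesis by (intro exI[of _ "\<lambda>r. - a r / a n"]) simp
  qed
  then have "\<forall>i\<in>{..<n}. \<exists>b. \<forall>j<n. (\<Sum>r<n. b r * M r j) = (if i = j then 1 else 0)" by simp
  from bchoice[OF this] obtain N where
    N: "\<forall>i\<in>{..<n}. \<forall>j<n. (\<Sum>r<n. N i r * M r j) = (if i = j then 1 else 0)" ..
  have "(\<Sum>k<n. M i k * N k j) = (if i = j then 1 else 0)" if ij: "i < n" "j < n" for i j
  proof (rule ccontr)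
    \<comment> \<open>Row \<open>i\<close> of the matrix M N - 1. Multiplying it by M on the right
      gives 0 because N M = 1, so independence of the rows of M makes it 0.\<close>
    define w where "w s = (\<Sum>k<n. M i k * N k s) - (if i = s then 1 else 0)" for s
    assume "\<not> ?thesis"
    then have "\<exists>s<n. w s \<noteq> 0" using ij by (intro exI[of _ j]) (simp add: w_def)
    from indep[OF this] obtain l where l: "l < n" "(\<Sum>s<n. M s l * w s) \<noteq> 0" by blast
    have "(\<Sum>s<n. M s l * w s) = (\<Sum>s<n. \<Sum>k<n. M i k * (N k s * M s l)) - (\<Sum>s<n. if i = s then M s l else 0)"
    proof -
      have "M s l * w s = (\<Sum>k<n. M i k * (N k s * M s l)) - (if i = s then M s l else 0)" for s
        by (cases "i = s") (simp_all add: w_def right_diff_distrib sum_distrib_left mult_ac)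
      then show ?thesis by (simp only: sum_subtractf)
    qed
    also have "(\<Sum>s<n. \<Sum>k<n. M i k * (N k s * M s l)) = (\<Sum>k<n. M i k * (\<Sum>s<n. N k s * M s l))"
      by (subst sum.swap) (simp add: sum_distrib_left)
    also have "\<dots> = (\<Sum>k<n. if k = l then M i k else 0)"
      using N l(1) by (intro sum.cong) simp_all
    also have "\<dots> - (\<Sum>s<n. if i = s then M s l else 0) = 0" using l(1) ij(1) by simp
    finally show False using l(2) by simp
  qed
  with N show ?thesis by (intro exI[of _ N]) simp
qed

lemma poly_bij_shear:
  assumes "i < n" "s \<in> subalg (coords ({..<n} - {i}))"
  shows "poly_bij n (\<lambda>x. x(i := x i + s x))"
  unfolding poly_bij_def
proof (intro conjI allI impI)
  have s: "s (x(i := c)) = s x" for x c by (rule subalg_coords_cong[OF assms(2)]) auto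
  show "bij_betw (\<lambda>x. x(i := x i + s x)) (affine_space n) (affine_space n)"
    by (rule bij_betw_byWitness[where f' = "\<lambda>x. x(i := x i - s x)"])
      (use assms(1) in \<open>auto simp: s affine_space_def\<close>)
  fix k assume k: "k < n"
  show "(\<lambda>x. (x(i := x i + s x)) k) \<in> subalg (coords {..<n})"
  proof (cases "k = i")
    case True
    have "(\<lambda>x. x i + s x) \<in> subalg (coords {..<n})"
      by (intro subalg_add subalg_coord subalg_coords_mono[OF assms(2)]) (use assms(1) in auto)
    with True show ?thesis by simp
  next
    case False
    with k show ?thesis by auto
  qed
qed

text \<open>The tuples \<open>(f\<^sub>0, \<dots>, f\<^sub>i\<^sub>-\<^sub>1, g\<^sub>i, \<dots>, g\<^sub>n\<^sub>-\<^sub>1)\<close> for consecutive \<open>i\<close> differ in one entry, and the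
  other entries already generate all functions on \<open>Z\<close>, so a shear takes one tuple to the next.\<close>

lemma replace_coordinates:
  fixes f g :: "nat \<Rightarrow> (nat \<Rightarrow> 'k::comm_ring_1) \<Rightarrow> 'k"
  assumes f: "\<And>r. r < n \<Longrightarrow> f r \<in> subalg (coords {..<n})" and g: "\<And>r. r < n \<Longrightarrow> g r \<in> subalg (coords {..<n})"
    and emb: "\<And>i j. i < n \<Longrightarrow> j < n \<Longrightarrow> \<exists>\<psi>\<in>subalg (f ` {..<i} \<union> g ` {i<..<n}). \<forall>z\<in>Z. \<psi> z = z j"
  shows "\<exists>\<Theta>. poly_bij n \<Theta> \<and>
    (\<forall>z\<in>Z. \<Theta> (\<lambda>k. if k < n then g k z else 0) = (\<lambda>k. if k < n then f k z else 0))"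
proof -
  define \<tau> where "\<tau> i z k = (if k < i then f k z else if k < n then g k z else 0)" for i z k
  have "\<exists>\<Theta>. poly_bij n \<Theta> \<and> (\<forall>z\<in>Z. \<Theta> (\<tau> 0 z) = \<tau> i z)" if "i \<le> n" for i
    using that
  proof (induction i)
    case 0
    have "poly_bij n (\<lambda>x. x)" by (auto simp: poly_bij_def bij_betw_def)
    then show ?case by (intro exI[of _ "\<lambda>x. x"]) simp
  next
    case (Suc i)
    then have i: "i < n" by simp
    from Suc obtain \<Theta> where \<Theta>: "poly_bij n \<Theta>" "\<forall>z\<in>Z. \<Theta> (\<tau> 0 z) = \<tau> i z" by auto
    let ?\<Phi> = "f ` {..<i} \<union> g ` {i<..<n}"
    have img: "?\<Phi> = (\<lambda>k z. \<tau> i z k) ` ({..<n} - {i})"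
    proof (intro equalityI subsetI)
      fix \<phi> assume "\<phi> \<in> ?\<Phi>"
      then consider k where "k < i" "\<phi> = f k" | k where "i < k" "k < n" "\<phi> = g k" by auto
      then show "\<phi> \<in> (\<lambda>k z. \<tau> i z k) ` ({..<n} - {i})"
      proof cases
        case 1
        then show ?thesis using i by (intro image_eqI[of _ _ k]) (auto simp: \<tau>_def)
      next
        case 2
        then show ?thesis by (intro image_eqI[of _ _ k]) (auto simp: \<tau>_def)
      qed
    next
      fix \<phi> assume "\<phi> \<in> (\<lambda>k z. \<tau> i z k) ` ({..<n} - {i})"
      then obtain k where k: "k < n" "k \<noteq> i" "\<phi> = (\<lambda>z. \<tau> i z k)" by auto
      then show "\<phi> \<in> ?\<Phi>" by (cases "k < i") (auto simp: \<tau>_def)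
    qed
    have all: "\<exists>s\<in>subalg (coords ({..<n} - {i})). \<forall>z\<in>Z. h z = s (\<tau> i z)" if h: "h \<in> subalg (coords {..<n})" for h
    proof -
      have "\<exists>h'\<in>subalg ?\<Phi>. \<forall>z\<in>Z. h z = h' z"
      proof (rule subalg_on_trans[OF h])
        fix \<phi> :: "(nat \<Rightarrow> 'k) \<Rightarrow> 'k" assume "\<phi> \<in> coords {..<n}"
        then obtain j where j: "j < n" "\<phi> = (\<lambda>x. x j)" by (auto simp: coords_def)
        from emb[OF i j(1)] obtain \<psi> where "\<psi> \<in> subalg ?\<Phi>" "\<forall>z\<in>Z. \<psi> z = z j" by (elim bexE)
        then show "\<exists>h'\<in>subalg ?\<Phi>. \<forall>z\<in>Z. \<phi> z = h' z" by (intro bexI[of _ \<psi>]) (simp_all add: j(2))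
      qed
      then obtain h' where h': "h' \<in> subalg ?\<Phi>" "\<forall>z\<in>Z. h z = h' z" by (elim bexE)
      obtain s where s: "s \<in> subalg (coords ({..<n} - {i}))" "h' = (\<lambda>z. s (\<lambda>k. \<tau> i z k))"
        using subalg_image_coords[OF h'(1)[unfolded img]] .
      with h'(2) show ?thesis by (intro bexI[of _ s]) simp_all
    qed
    obtain s where s: "s \<in> subalg (coords ({..<n} - {i}))" "\<forall>z\<in>Z. g i z = s (\<tau> i z)"
      using all[OF g[OF i]] by (elim bexE)
    obtain s' where s': "s' \<in> subalg (coords ({..<n} - {i}))" "\<forall>z\<in>Z. f i z = s' (\<tau> i z)"
      using all[OF f[OF i]] by (elim bexE)
    \<comment> \<open>The shear adds \<open>f i - g i\<close>, expressed through the entries that do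
      not change.\<close>
    let ?S = "\<lambda>x. x(i := x i + (s' x - s x))"
    have "poly_bij n ?S" by (rule poly_bij_shear[OF i]) (intro subalg_diff s s')
    then have "poly_bij n (\<lambda>x. ?S (\<Theta> x))" by (rule poly_bij_comp[OF _ \<Theta>(1)])
    moreover have "?S (\<Theta> (\<tau> 0 z)) = \<tau> (Suc i) z" if z: "z \<in> Z" for z
    proof -
      have eq: "\<Theta> (\<tau> 0 z) = \<tau> i z" using \<Theta>(2) z by blast
      have "\<tau> i z i + (s' (\<tau> i z) - s (\<tau> i z)) = f i z"
        using s(2) s'(2) z i by (simp add: \<tau>_def[of i z i])
      then show ?thesis unfolding eq by (auto simp: \<tau>_def fun_eq_iff less_Suc_eq)
    qed
    ultimately show ?case by (intro exI[of _ "\<lambda>x. ?S (\<Theta> x)"] conjI ballI)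
  qed
  from this[of n] obtain \<Theta> where \<Theta>: "poly_bij n \<Theta>" "\<forall>z\<in>Z. \<Theta> (\<tau> 0 z) = \<tau> n z" by auto
  have "\<tau> 0 z = (\<lambda>k. if k < n then g k z else 0)" "\<tau> n z = (\<lambda>k. if k < n then f k z else 0)" for z
    by (auto simp: \<tau>_def fun_eq_iff)
  with \<Theta> show ?thesis by (intro exI[of _ \<Theta>]) simp
qed

section \<open>Extension of isomorphisms\<close>

text \<open>With \<open>f = A F\<close> and \<open>g = B x\<close> for generic matrices \<open>A\<close>, \<open>B\<close>, each of the tuples
  \<open>(f\<^sub>0, \<dots>, f\<^sub>i\<^sub>-\<^sub>1, g\<^sub>i\<^sub>+\<^sub>1, \<dots>, g\<^sub>n\<^sub>-\<^sub>1)\<close> embeds \<open>Z\<close>. In the array \<open>c\<close> of all coefficients, the rows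
  \<open>0, \<dots>, n - 1\<close> form \<open>A\<close>, the next \<open>n\<close> rows form \<open>B\<close>, row \<open>2 n\<close> is auxiliary, and the last \<open>n\<close>
  rows give the coordinates that are eliminated one by one.\<close>

lemma extend_isomorphism:
  fixes Z :: "(nat \<Rightarrow> 'k::{alg_closed_field, field_char_0}) set"
  assumes n: "n \<ge> 2" and Z: "closedin (zariski n) Z"
    and d: "hdim_le Z (coords {..<n}) d" "2 * d + 2 \<le> n"
    and t: "hdim_le (total_tangent_space n Z) (coords {..<2 * n}) t" "t + 1 \<le> n"
    and F: "\<And>i. i < n \<Longrightarrow> F i \<in> subalg (coords {..<n})"
    and G: "\<And>i. i < n \<Longrightarrow> G i \<in> subalg (coords {..<n})"
    and GF: "\<And>i z. i < n \<Longrightarrow> z \<in> Z \<Longrightarrow> G i (\<lambda>j. if j < n then F j z else 0) = z i"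
  shows "\<exists>\<Theta>. poly_bij n \<Theta> \<and> (\<forall>z\<in>Z. \<Theta> z = (\<lambda>j. if j < n then F j z else 0))"
proof -
  define Fv where "Fv z j = (if j < n then F j z else 0)" for z j
  have FvA: "(\<lambda>z. Fv z j) \<in> subalg (coords {..<n})" for j
    by (cases "j < n") (simp_all add: Fv_def F subalg_const)
  have GFv: "G i (Fv z) = z i" if "i < n" "z \<in> Z" for i z
    using GF[OF that] by (simp add: Fv_def[abs_def])
  have Zaff: "z \<in> Z \<Longrightarrow> z \<in> affine_space n" for z using closed_sub_affine[OF Z] by blast
  have ext: "z = w" if "z \<in> affine_space n" "w \<in> affine_space n" "\<And>i. i < n \<Longrightarrow> z i = w i" for z w :: "nat \<Rightarrow> 'k"
  proof
    fix i show "z i = w i" using that by (cases "i < n") (auto simp: affine_space_def)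
  qed
  have Finj: "z = w" if "z \<in> Z" "w \<in> Z" "\<forall>j<n. F j z = F j w" for z w
  proof (rule ext[OF Zaff[OF that(1)] Zaff[OF that(2)]])
    fix i assume "i < n"
    moreover have "Fv z = Fv w" using that(3) by (auto simp: Fv_def)
    ultimately show "z i = w i" using GFv that(1,2) by metis
  qed
  have Fimm: "v = (\<lambda>_. 0)" if v: "v \<in> affine_space n" "\<forall>f\<in>vanish n Z. dird f z v = 0"
    "\<forall>j<n. dird (F j) z v = 0" for z v
  proof (rule ext[OF v(1)])
    fix i assume i: "i < n"
    have comp: "(\<lambda>x. G i (Fv x)) \<in> subalg (coords {..<n})"
      by (rule subalg_coords_subst[OF G[OF i] FvA])
    have "(\<lambda>x. G i (Fv x) - x i) \<in> vanish n Z"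
      using i by (simp add: vanish_def GFv subalg_diff[OF comp subalg_coord])
    from bspec[OF v(2) this] have "dird (\<lambda>x. G i (Fv x) - x i) z v = 0" .
    then have "v i = dird (\<lambda>x. G i (Fv x)) z v"
      using i by (simp add: dird_diff[OF comp subalg_coord])
    also have "\<dots> = dird (G i) (Fv z) (\<lambda>j. dird (\<lambda>x. Fv x j) z v)"
      by (rule dird_comp[OF G[OF i] FvA])
    also have "(\<lambda>j. dird (\<lambda>x. Fv x j) z v) = (\<lambda>_. 0)"
    proof
      fix j show "dird (\<lambda>x. Fv x j) z v = 0"
        using v(3) by (cases "j < n") (simp_all add: Fv_def)
    qed
    also have "dird (G i) (Fv z) (\<lambda>_. 0) = 0" by (rule dird_zero[OF G[OF i]])
    finally show "v i = 0" .
  qed (simp add: affine_space_def)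
  \<comment> \<open>The \<open>n - 1\<close> rows of the tuple number \<open>i\<close>: those below
    \<open>i\<close> act on \<open>F\<close>, those from \<open>n + Suc i\<close> on act on the
    coordinates.\<close>
  define R where "R i = {..<i} \<union> {n + Suc i..<2 * n}" for i
  have R: "finite (R i)" "card (R i) = n - 1" if "i < n" for i
  proof -
    show "finite (R i)" by (simp add: R_def)
    have "{..<i} \<inter> {n + Suc i..<2 * n} = {}" using that by auto
    then have "card (R i) = i + (2 * n - (n + Suc i))" unfolding R_def by (subst card_Un_disjoint) simp_all
    then show "card (R i) = n - 1" using that by simp
  qed
  define indep where "indep off c \<longleftrightarrow> (\<forall>b. (\<exists>r\<in>{off..<off + n}. b r \<noteq> 0) \<longrightarrow>
    (\<exists>j\<in>{..<n}. (\<Sum>r\<in>{off..<off + n}. c (r, j) * b r) \<noteq> 0))" for off :: nat and c :: "nat \<times> nat \<Rightarrow> 'k"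
  have gen_indep: "generic (indep off)" for off
    unfolding indep_def[abs_def]
    by (rule generic_independent_rows[where \<rho> = n and ra = off and rb = "Suc off"]) (use n in auto)
  \<comment> \<open>The tuple number \<open>i\<close> separates the points of \<open>Z\<close>. The
    pairs off the diagonal have growth at most \<open>2 * d\<close>, which is less than the number
    \<open>n - 1\<close> of rows.\<close>
  define pairs where "pairs i c \<longleftrightarrow> (\<forall>p\<in>{p \<in> Z \<times> Z. fst p \<noteq> snd p}. \<exists>r\<in>R i. (\<Sum>j\<in>{..<n}. c (r, j) *
    (if r < n then F j (fst p) - F j (snd p) else fst p j - snd p j)) \<noteq> 0)" for i and c :: "nat \<times> nat \<Rightarrow> 'k"
  have gen_pairs: "generic (pairs i)" if i: "i < n" for i
    unfolding pairs_def[abs_def]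
  proof (rule generic_avoid)
    show "hdim_le {p \<in> Z \<times> Z. fst p \<noteq> snd p} (tensor (coords {..<n}) (coords {..<n})) (d + d)"
      by (rule hdim_le_subset[OF hdim_le_Times[OF d(1) d(1)]]) auto
    show "d + d < card (R i)" using R(2)[OF i] d(2) by simp
    show "(\<lambda>p. if r < n then F j (fst p) - F j (snd p) else fst p j - snd p j)
        \<in> subalg (tensor (coords {..<n}) (coords {..<n}))" if j: "j \<in> {..<n}" for r j
    proof (cases "r < n")
      case True
      then show ?thesis using j F[of j]
        by (simp add: subalg_diff subalg_tensor_fst subalg_tensor_snd)
    next
      case False
      then show ?thesis using j
          subalg_diff[OF subalg_tensor_fst[OF subalg_coord] subalg_tensor_snd[OF subalg_coord], of j "{..<n}" j "{..<n}"]
        by simp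
    qed
    show "\<exists>j\<in>{..<n}. (if r < n then F j (fst p) - F j (snd p) else fst p j - snd p j) \<noteq> 0"
      if p: "p \<in> {p \<in> Z \<times> Z. fst p \<noteq> snd p}" for p r
    proof (rule ccontr)
      assume no: "\<not> ?thesis"
      have pZ: "fst p \<in> Z" "snd p \<in> Z" "fst p \<noteq> snd p" using p by auto
      have "fst p = snd p"
      proof (cases "r < n")
        case True
        then have "\<forall>j<n. F j (fst p) = F j (snd p)" using no by auto
        then show ?thesis by (rule Finj[OF pZ(1,2)])
      next
        case False
        then show ?thesis using no by (intro ext Zaff pZ) auto
      qed
      with pZ(3) show False ..
    qed
  qed (use R(1)[OF i] in simp_all)
  \<comment> \<open>The nonzero tangent vectors. They are stable under scaling of the second half of
    the coordinates, so that \<open>t \<le> n - 1\<close> is enough.\<close>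
  define T where "T = {u \<in> total_tangent_space n Z. \<exists>k<n. u (n + k) \<noteq> 0}"
  define tangents where "tangents i c \<longleftrightarrow> (\<forall>u\<in>T. \<exists>r\<in>R i. (\<Sum>j\<in>{..<n}. c (r, j) *
    (if r < n then dird (F j) (base_point n u) (direction n u) else direction n u j)) \<noteq> 0)"
    for i and c :: "nat \<times> nat \<Rightarrow> 'k"
  have T_iff: "u \<in> T \<longleftrightarrow> u \<in> affine_space (2 * n) \<and> base_point n u \<in> Z \<and>
    direction n u \<in> affine_space n \<and> (\<forall>f\<in>vanish n Z. dird f (base_point n u) (direction n u) = 0) \<and>
    (\<exists>k<n. u (n + k) \<noteq> 0)" for u
    unfolding T_def total_tangent_space_iff[OF closed_sub_affine[OF Z]] tangent_space_iff by auto
  have gen_tangents: "generic (tangents i)" if i: "i < n" for i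
    unfolding tangents_def[abs_def]
  proof (rule generic_avoid_cone[where \<rho> = "2 * n" and jc = 0 and jd = 1
      and P = "(\<lambda>k u. u (n + k)) ` {..<n}" and sc = "\<lambda>s u k. if n \<le> k then s * u k else u k"
      and \<Phi> = "coords {..<2 * n}" and D = t])
    show "hdim_le T (coords {..<2 * n}) t"
      by (rule hdim_le_subset[OF t(1)]) (auto simp: T_def)
    show "t \<le> card (R i)" using R(2)[OF i] t(2) by simp
    show "2 * n \<notin> R i" using i by (simp add: R_def)
    show "(\<lambda>u. if r < n then dird (F j) (base_point n u) (direction n u) else direction n u j)
        \<in> subalg (coords {..<2 * n})" if "j \<in> {..<n}" for r j
      using that dird_subalg[OF F, of j n] direction_subalg[of n j] by (cases "r < n") simp_all
    show "\<exists>j\<in>{..<n}. (if r < n then dird (F j) (base_point n u) (direction n u) else direction n u j) \<noteq> 0"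
      if u: "u \<in> T" for u r
    proof (rule ccontr)
      assume no: "\<not> ?thesis"
      obtain k where k: "k < n" "direction n u k \<noteq> 0" using u by (auto simp: T_iff direction_def)
      show False
      proof (cases "r < n")
        case True
        then have "\<forall>j<n. dird (F j) (base_point n u) (direction n u) = 0" using no by auto
        then have "direction n u = (\<lambda>_. 0)" using u by (intro Fimm) (simp_all add: T_iff)
        then show False using k by simp
      next
        case False
        then show False using no k by auto
      qed
    qed
    show "(\<lambda>k u. u (n + k)) ` {..<n} \<subseteq> subalg (coords {..<2 * n})"
      by auto
    show "\<exists>l\<in>(\<lambda>k u. u (n + k)) ` {..<n}. l u \<noteq> 0" if "u \<in> T" for u
      using that by (auto simp: T_iff)
    have bp: "base_point n (\<lambda>k. if n \<le> k then s * u k else u k) = base_point n u" for s :: 'k and u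
      by (auto simp: base_point_def)
    have dr: "direction n (\<lambda>k. if n \<le> k then s * u k else u k) = (\<lambda>k. s * direction n u k)" for s :: 'k and u
      by (auto simp: direction_def)
    have dF: "dird f z (\<lambda>k. s * v k) = s * dird f z v" if "f \<in> subalg (coords {..<n})"
      for f z v and s :: 'k using that by (rule dird_scale_vector)
    show "(\<lambda>k. if n \<le> k then s * u k else u k) \<in> T" if "s \<noteq> 0" "u \<in> T" for s u
      using that dF unfolding T_iff bp dr by (auto simp: affine_space_def vanish_def)
    show "l (\<lambda>k. if n \<le> k then s * u k else u k) = s * l u" if "l \<in> (\<lambda>k u. u (n + k)) ` {..<n}"
      for s :: 'k and u l
      using that by auto
    show "(if r < n then dird (F j) (base_point n (\<lambda>k. if n \<le> k then s * u k else u k))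
          (direction n (\<lambda>k. if n \<le> k then s * u k else u k))
        else direction n (\<lambda>k. if n \<le> k then s * u k else u k) j) =
      s * (if r < n then dird (F j) (base_point n u) (direction n u) else direction n u j)"
      if "j \<in> {..<n}" for s u r j
      using that by (simp add: bp dr dF F)
  qed (use R(1)[OF i] n in simp_all)
  define f g where "f c r x = (\<Sum>j<n. c (r, j) * F j x)" and "g c r x = (\<Sum>j<n. c (r, j) * x j)"
    for c :: "nat \<times> nat \<Rightarrow> 'k" and r x
  \<comment> \<open>The rows from \<open>2 * n + 1\<close> on supply further combinations. They are
    integral over the first \<open>d\<close> combinations of \<open>F\<close> here, and over the
    last \<open>d\<close> combinations of the coordinates in \<open>gen_g\<close>.\<close>
  have gen_f: "generic (\<lambda>c. integral_on Z (subalg (f c ` {..<d})) (f c (2 * n + 1 + l)))" for l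
    unfolding f_def[abs_def]
    by (rule generic_integral[OF d(1), where j' = n]) (use d(2) F in simp_all)
  have gen_g: "generic (\<lambda>c. integral_on Z (subalg (g c ` {2 * n - d..<2 * n})) (g c (2 * n + 1 + l)))" for l
    unfolding g_def[abs_def]
    by (rule generic_integral[OF d(1), where j' = n]) (use d(2) in auto)
  have "generic (\<lambda>c. (\<forall>off\<in>{0, n, 2 * n + 1}. indep off c) \<and> (\<forall>i\<in>{..<n}. pairs i c) \<and>
      (\<forall>i\<in>{..<n}. tangents i c) \<and>
      (\<forall>l\<in>{..<n}. integral_on Z (subalg (f c ` {..<d})) (f c (2 * n + 1 + l))) \<and>
      (\<forall>l\<in>{..<n}. integral_on Z (subalg (g c ` {2 * n - d..<2 * n})) (g c (2 * n + 1 + l))))"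
    by (intro generic_conj generic_Ball gen_indep gen_pairs gen_tangents gen_f gen_g) simp_all
  from generic_ex[OF this] obtain c where
    c1: "\<forall>off\<in>{0, n, 2 * n + 1}. indep off c" and c2: "\<forall>i\<in>{..<n}. pairs i c"
    and c3: "\<forall>i\<in>{..<n}. tangents i c"
    and c4: "\<forall>l\<in>{..<n}. integral_on Z (subalg (f c ` {..<d})) (f c (2 * n + 1 + l))"
    and c5: "\<forall>l\<in>{..<n}. integral_on Z (subalg (g c ` {2 * n - d..<2 * n})) (g c (2 * n + 1 + l))"
    by (elim exE conjE)
  have fA: "f c r \<in> subalg (coords {..<n})" for r
    unfolding f_def[abs_def] by (intro subalg_sum subalg_mult subalg_const) (simp add: F)
  have gA: "g c r \<in> subalg (coords {..<n})" for r
    unfolding g_def[abs_def] by (intro subalg_sum subalg_mult subalg_const subalg_coord)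
  have inv: "\<exists>N. (\<forall>i<n. \<forall>j<n. (\<Sum>r<n. N i r * c (off + r, j)) = (if i = j then 1 else 0)) \<and>
    (\<forall>i<n. \<forall>j<n. (\<Sum>r<n. c (off + i, r) * N r j) = (if i = j then 1 else 0))"
    if off: "off \<in> {0, n, 2 * n + 1}" for off
  proof (rule inverse_matrix)
    fix b :: "nat \<Rightarrow> 'k" assume "\<exists>r<n. b r \<noteq> 0"
    then obtain r where r: "r < n" "b r \<noteq> 0" by blast
    have "indep off c" using c1 off by blast
    moreover have "\<exists>r\<in>{off..<off + n}. b (r - off) \<noteq> 0" using r by (intro bexI[of _ "off + r"]) auto
    ultimately have "\<exists>j\<in>{..<n}. (\<Sum>r\<in>{off..<off + n}. c (r, j) * b (r - off)) \<noteq> 0"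
      unfolding indep_def by (elim allE[of _ "\<lambda>r. b (r - off)"] impE)
    then obtain j where j: "j < n" "(\<Sum>r\<in>{off..<off + n}. c (r, j) * b (r - off)) \<noteq> 0" by auto
    have "(\<Sum>r\<in>{off..<off + n}. c (r, j) * b (r - off)) = (\<Sum>r<n. c (off + r, j) * b r)"
      by (rule sum.reindex_bij_witness[where i = "\<lambda>r. off + r" and j = "\<lambda>r. r - off"]) auto
    with j show "\<exists>j<n. (\<Sum>r<n. c (off + r, j) * b r) \<noteq> 0" by auto
  qed
  have emb: "\<exists>\<psi>\<in>subalg (f c ` {..<i} \<union> (\<lambda>r. g c (n + r)) ` {i<..<n}). \<forall>z\<in>Z. \<psi> z = z j"
    if ij: "i < n" "j < n" for i j
  proof -
    let ?\<Phi> = "f c ` {..<i} \<union> (\<lambda>r. g c (n + r)) ` {i<..<n}"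
    \<comment> \<open>The tuple number \<open>i\<close> contains \<open>d\<close> entries of
      \<open>f\<close> if \<open>d \<le> i\<close>, and otherwise \<open>n - 1 - i \<ge> d\<close>
      entries of \<open>g\<close>, because \<open>2 * d + 2 \<le> n\<close>. The functions to be
      eliminated belong to the same embedding; their coefficient matrix is invertible, so they
      generate all functions on \<open>Z\<close>.\<close>
    define \<Xi> where "\<Xi> = (if d \<le> i then (\<lambda>l. f c (2 * n + 1 + l)) ` {..<n} else (\<lambda>l. g c (2 * n + 1 + l)) ` {..<n})"
    obtain N where N: "\<forall>i<n. \<forall>j<n. (\<Sum>r<n. N i r * c (2 * n + 1 + r, j)) = (if i = j then 1 else 0)"
      using inv[of "2 * n + 1"] by blast
    have solve: "(\<Sum>r<n. N k r * (\<Sum>j<n. c (2 * n + 1 + r, j) * y j)) = y k" if k: "k < n" for k and y :: "nat \<Rightarrow> 'k"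
    proof -
      have "(\<Sum>r<n. N k r * (\<Sum>j<n. c (2 * n + 1 + r, j) * y j)) =
          (\<Sum>j<n. (\<Sum>r<n. N k r * c (2 * n + 1 + r, j)) * y j)"
        unfolding sum_distrib_left sum_distrib_right by (subst sum.swap) (simp add: mult.assoc)
      also have "\<dots> = (\<Sum>j<n. if k = j then y j else 0)" using N k by (intro sum.cong) simp_all
      also have "\<dots> = y k" using k by simp
      finally show ?thesis .
    qed
    have row: "\<phi> \<in> ?\<Phi> \<longleftrightarrow> (\<exists>r\<in>R i. \<phi> = (if r < n then f c r else g c r))" for \<phi>
    proof
      assume "\<phi> \<in> ?\<Phi>"
      then consider r where "r < i" "\<phi> = f c r" | r where "i < r" "r < n" "\<phi> = g c (n + r)" by auto
      then show "\<exists>r\<in>R i. \<phi> = (if r < n then f c r else g c r)"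
      proof cases
        case 1
        then show ?thesis using ij by (intro bexI[of _ r]) (auto simp: R_def)
      next
        case 2
        then show ?thesis by (intro bexI[of _ "n + r"]) (auto simp: R_def)
      qed
    next
      assume "\<exists>r\<in>R i. \<phi> = (if r < n then f c r else g c r)"
      then obtain r where r: "r \<in> R i" "\<phi> = (if r < n then f c r else g c r)" by blast
      show "\<phi> \<in> ?\<Phi>"
      proof (cases "r < n")
        case True
        then show ?thesis using r by (auto simp: R_def)
      next
        case False
        then have "\<phi> = g c (n + (r - n))" "r - n \<in> {i<..<n}" using r ij by (auto simp: R_def)
        then show ?thesis by blast
      qed
    qed
    show ?thesis
    proof (rule closed_embedding[OF Z, where \<Xi> = \<Xi>])
      show "finite ?\<Phi>" "finite \<Xi>" by (auto simp: \<Xi>_def)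
      show "?\<Phi> \<subseteq> subalg (coords {..<n})" "\<Xi> \<subseteq> subalg (coords {..<n})"
        using fA gA by (auto simp: \<Xi>_def)
      show "j < n" by fact
      show "integral_on Z (subalg ?\<Phi>) \<xi>" if \<xi>: "\<xi> \<in> \<Xi>" for \<xi>
      proof (cases "d \<le> i")
        case True
        then obtain l where l: "l < n" "\<xi> = f c (2 * n + 1 + l)" using \<xi> by (auto simp: \<Xi>_def)
        have "integral_on Z (subalg (f c ` {..<d})) \<xi>" using c4 l by blast
        then show ?thesis
        proof (rule integral_on_mono)
          show "subalg (f c ` {..<d}) \<subseteq> subalg ?\<Phi>"
            by (rule subsetI, erule subalg_mono) (use True in auto)
        qed
      next
        case False
        then obtain l where l: "l < n" "\<xi> = g c (2 * n + 1 + l)" using \<xi> by (auto simp: \<Xi>_def)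
        have "integral_on Z (subalg (g c ` {2 * n - d..<2 * n})) \<xi>" using c5 l by blast
        then show ?thesis
        proof (rule integral_on_mono)
          have "g c ` {2 * n - d..<2 * n} \<subseteq> ?\<Phi>"
          proof (rule image_subsetI)
            fix r assume r: "r \<in> {2 * n - d..<2 * n}"
            then have "r = n + (r - n)" "r - n \<in> {i<..<n}" using False d(2) by auto
            then show "g c r \<in> ?\<Phi>" by (metis UnI2 imageI)
          qed
          then show "subalg (g c ` {2 * n - d..<2 * n}) \<subseteq> subalg ?\<Phi>"
            by (auto intro: subalg_mono)
        qed
      qed
    next
      fix j assume j: "j < n"
      show "\<exists>\<psi>\<in>subalg (\<Xi> \<union> ?\<Phi>). \<forall>z\<in>Z. \<psi> z = z j"
      proof (cases "d \<le> i")
        case True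
        have Fk: "(\<lambda>z. \<Sum>r<n. N k r * f c (2 * n + 1 + r) z) \<in> subalg (\<Xi> \<union> ?\<Phi>)" for k
          using True by (intro subalg_sum subalg_mult subalg_const subalg_base) (auto simp: \<Xi>_def)
        have "(\<lambda>z. G j (\<lambda>k. if k < n then \<Sum>r<n. N k r * f c (2 * n + 1 + r) z else 0)) \<in> subalg (\<Xi> \<union> ?\<Phi>)"
        proof (rule subalg_coords_subst[OF G[OF j]])
          fix k assume "k \<in> {..<n}"
          then show "(\<lambda>z. if k < n then \<Sum>r<n. N k r * f c (2 * n + 1 + r) z else 0) \<in> subalg (\<Xi> \<union> ?\<Phi>)"
            using Fk[of k] by simp
        qed
        moreover have "(\<lambda>k. if k < n then \<Sum>r<n. N k r * f c (2 * n + 1 + r) z else 0) = Fv z" for z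
          using solve[of _ "\<lambda>j. F j z"] by (auto simp: Fv_def f_def fun_eq_iff)
        ultimately have "(\<lambda>z. G j (Fv z)) \<in> subalg (\<Xi> \<union> ?\<Phi>)" by simp
        then show ?thesis using GFv[OF j] by (intro bexI[of _ "\<lambda>z. G j (Fv z)"]) simp_all
      next
        case False
        have "(\<lambda>z. \<Sum>r<n. N j r * g c (2 * n + 1 + r) z) \<in> subalg (\<Xi> \<union> ?\<Phi>)"
          using False by (intro subalg_sum subalg_mult subalg_const subalg_base) (auto simp: \<Xi>_def)
        moreover have "(\<Sum>r<n. N j r * g c (2 * n + 1 + r) z) = z j" for z
          using solve[OF j, of z] by (simp add: g_def)
        ultimately show ?thesis by (intro bexI[of _ "\<lambda>z. \<Sum>r<n. N j r * g c (2 * n + 1 + r) z"]) simp_all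
      qed
    next
      fix z w assume zw: "z \<in> Z" "w \<in> Z" "\<forall>\<phi>\<in>?\<Phi>. \<phi> z = \<phi> w"
      show "z = w"
      proof (rule ccontr)
        assume "z \<noteq> w"
        then have zw': "(z, w) \<in> {p \<in> Z \<times> Z. fst p \<noteq> snd p}" using zw by simp
        have "pairs i c" using c2 ij by blast
        from bspec[OF this[unfolded pairs_def] zw', unfolded fst_conv snd_conv]
        obtain r where r: "r \<in> R i" "(\<Sum>j<n. c (r, j) *
            (if r < n then F j z - F j w else z j - w j)) \<noteq> 0" by (elim bexE)
        have "(if r < n then f c r else g c r) \<in> ?\<Phi>" using row r(1) by blast
        from bspec[OF zw(3) this] r(2) show False
          by (cases "r < n") (simp_all add: f_def g_def right_diff_distrib sum_subtractf)
      qed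
    next
      fix z v assume zv: "z \<in> Z" "v \<in> affine_space n" "\<forall>f\<in>vanish n Z. dird f z v = 0"
        "\<forall>\<phi>\<in>?\<Phi>. dird \<phi> z v = 0"
      show "v = (\<lambda>_. 0)"
      proof (rule ccontr)
        assume "v \<noteq> (\<lambda>_. 0)"
        then obtain k where k: "v k \<noteq> 0" by blast
        then have "k < n" using zv(2) by (auto simp: affine_space_def not_le[symmetric])
        define u where "u = join n z v"
        have bp: "base_point n u = z" and dr: "direction n u = v"
          using Zaff[OF zv(1)] zv(2)
          by (auto simp: u_def base_point_def direction_def join_def affine_space_def fun_eq_iff)
        have uT: "u \<in> T"
          unfolding T_iff bp dr using zv k \<open>k < n\<close>
          by (auto simp: u_def join_def affine_space_def intro!: exI[of _ k])
        have "tangents i c" using c3 ij by blast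
        from bspec[OF this[unfolded tangents_def] uT, unfolded bp dr]
        obtain r where r: "r \<in> R i" "(\<Sum>j<n. c (r, j) *
            (if r < n then dird (F j) z v else v j)) \<noteq> 0" by (elim bexE)
        have "(if r < n then f c r else g c r) \<in> ?\<Phi>" using row r(1) by blast
        from bspec[OF zv(4) this] have 0: "dird (if r < n then f c r else g c r) z v = 0" .
        have "dird (f c r) z v = (\<Sum>j<n. c (r, j) * dird (F j) z v)"
          unfolding f_def[abs_def]
          by (subst dird_sum[where I = "{..<n}"])
            (simp_all add: F subalg_mult subalg_const dird_scale[OF F])
        moreover have "dird (g c r) z v = (\<Sum>j<n. c (r, j) * v j)"
          unfolding g_def[abs_def]
          by (subst dird_sum[where I = "{..<n}"])
            (simp_all add: subalg_coord subalg_mult subalg_const dird_scale[OF subalg_coord[OF UNIV_I]])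
        ultimately show False using 0 r(2) by (cases "r < n") simp_all
      qed
    qed
  qed
  have "\<exists>\<Theta>. poly_bij n \<Theta> \<and>
    (\<forall>z\<in>Z. \<Theta> (\<lambda>k. if k < n then g c (n + k) z else 0) = (\<lambda>k. if k < n then f c k z else 0))"
    by (rule replace_coordinates[OF fA gA emb])
  then obtain \<Theta> where \<Theta>: "poly_bij n \<Theta>"
    "\<forall>z\<in>Z. \<Theta> (\<lambda>k. if k < n then g c (n + k) z else 0) = (\<lambda>k. if k < n then f c k z else 0)"
    by (elim exE conjE)
  let ?A = "\<lambda>r j. c (r, j)" and ?B = "\<lambda>r j. c (n + r, j)"
  obtain A' where A': "\<forall>i<n. \<forall>j<n. (\<Sum>r<n. A' i r * c (r, j)) = (if i = j then 1 else 0)"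
    "\<forall>i<n. \<forall>j<n. (\<Sum>r<n. c (i, r) * A' r j) = (if i = j then 1 else 0)"
    using inv[of 0] by auto
  obtain B' where B': "\<forall>i<n. \<forall>j<n. (\<Sum>r<n. B' i r * c (n + r, j)) = (if i = j then 1 else 0)"
    "\<forall>i<n. \<forall>j<n. (\<Sum>r<n. c (n + i, r) * B' r j) = (if i = j then 1 else 0)"
    using inv[of n] by auto
  have bijA: "poly_bij n (linmap n A')" by (rule poly_bij_linmap[where N = ?A]) (use A' in simp_all)
  have bijB: "poly_bij n (linmap n ?B)" by (rule poly_bij_linmap[where N = B']) (use B' in simp_all)
  \<comment> \<open>\<open>?B\<close> turns the coordinates into \<open>g\<close>, \<Theta> turns
    \<open>g\<close> into \<open>f\<close>, and the inverse matrix \<open>A'\<close> turns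
    \<open>f\<close> back into \<open>F\<close>.\<close>
  have "poly_bij n (\<lambda>x. linmap n A' (\<Theta> (linmap n ?B x)))"
    by (rule poly_bij_comp[OF bijA poly_bij_comp[OF \<Theta>(1) bijB]])
  moreover have "linmap n A' (\<Theta> (linmap n ?B z)) = (\<lambda>j. if j < n then F j z else 0)" if z: "z \<in> Z" for z
  proof -
    have "linmap n ?B z = (\<lambda>k. if k < n then g c (n + k) z else 0)"
      by (auto simp: linmap_def g_def fun_eq_iff)
    moreover have "linmap n ?A (Fv z) = (\<lambda>k. if k < n then f c k z else 0)"
      by (auto simp: linmap_def f_def Fv_def fun_eq_iff)
    ultimately have "\<Theta> (linmap n ?B z) = linmap n ?A (Fv z)" using \<Theta>(2) z by simp
    moreover have "linmap n A' (linmap n ?A (Fv z)) = Fv z"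
      by (rule linmap_inverse) (use A'(1) in \<open>simp_all add: Fv_def affine_space_def\<close>)
    ultimately show ?thesis by (simp add: Fv_def[abs_def])
  qed
  ultimately show ?thesis by (intro exI[of _ "\<lambda>x. linmap n A' (\<Theta> (linmap n ?B x))"] conjI ballI)
qed

section \<open>From polynomial maps to morphisms of varieties\<close>

lemma regular_on_polynomial:
  fixes f :: "(nat \<Rightarrow> 'k::field) \<Rightarrow> 'k"
  assumes "f \<in> subalg (coords {..<n})"
  shows "regular_on n (affine_space n) f"
  unfolding regular_on_def
proof
  fix x :: "nat \<Rightarrow> 'k" assume x: "x \<in> affine_space n"
  obtain p where p: "p \<in> mpols n" "f = mp_eval p" using subalg_imp_mpol[OF assms] by (elim bexE)
  have q: "(1 :: 'k mpol) \<in> mpols n" by (simp add: mpols_const flip: single_one)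
  have U: "openin (subtopology (zariski n) (affine_space n)) (affine_space n :: (nat \<Rightarrow> 'k) set)"
    by (simp add: openin_subtopology_refl)
  show "\<exists>U. openin (subtopology (zariski n) (affine_space n)) U \<and> x \<in> U \<and>
      (\<exists>p\<in>mpols n. \<exists>q\<in>mpols n. \<forall>y\<in>U. mp_eval q y \<noteq> 0 \<and> f y = mp_eval p y / mp_eval q y)"
    by (rule exI[of _ "affine_space n"], intro conjI U x, rule bexI[OF _ p(1)], rule bexI[OF _ q])
      (simp add: p(2))
qed

theorem corollary1p4:
  fixes n :: nat and Z1 Z2 :: "(nat \<Rightarrow> 'k::{alg_closed_field, field_char_0}) set"
  assumes "n \<ge> 2"
    and "closedin (zariski n) Z1"
    and "Z1 \<subseteq> codim2_subspace n"
    and "enat n \<ge> max (2 * variety_dim n Z1 + 1) (variety_dim (2 * n) (total_tangent_space n Z1)) + 1"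
    and "closedin (zariski n) Z2"
    and "isomorphic_varieties n Z2 n Z1"
  shows "\<exists>f. morphism n (affine_space n) n (affine_space n - Z2) f \<and>
             f ` affine_space n = affine_space n - Z2"
proof -
  have "\<exists>f g. morphism n Z2 n Z1 f \<and> morphism n Z1 n Z2 g \<and>
      (\<forall>x\<in>Z2. g (f x) = x) \<and> (\<forall>y\<in>Z1. f (g y) = y)"
    using assms(6) unfolding isomorphic_varieties_def .
  then obtain f g where fg: "morphism n Z2 n Z1 f" "morphism n Z1 n Z2 g"
    "\<forall>x\<in>Z2. g (f x) = x" "\<forall>y\<in>Z1. f (g y) = y" by (elim exE conjE)
  have f_Z1: "f x \<in> Z1" if "x \<in> Z2" for x using fg(1) that by (auto simp: morphism_def)
  have g_Z2: "g y \<in> Z2" if "y \<in> Z1" for y using fg(2) that by (auto simp: morphism_def)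
  have "\<exists>\<Theta>. poly_bij n \<Theta> \<and> (\<forall>z\<in>Z1. \<Theta> z = g z)"
  \<comment> \<open>The comparison of growth with the Krull dimension is for nonempty sets; for
    empty \<open>Z1\<close> the identity serves.\<close>
  proof (cases "Z1 = {}")
    case True
    have "poly_bij n (\<lambda>x :: nat \<Rightarrow> 'k. x)" by (auto simp: poly_bij_def bij_betw_def)
    then show ?thesis using True by (intro exI[of _ "\<lambda>x. x"]) simp
  next
    case False
    then obtain z0 where z0: "z0 \<in> Z1" by blast
    have "(\<lambda>_. 0) \<in> tangent_space n Z1 z0" by (simp add: tangent_space_def affine_space_def)
    then have "join n z0 (\<lambda>_. 0) \<in> total_tangent_space n Z1"
      using z0 unfolding total_tangent_space_def by blast
    then have "total_tangent_space n Z1 \<noteq> {}" by blast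
    from hdim_le_variety_dim[OF closed_total_tangent_space[OF assms(2)] this] obtain t where
      t: "enat t \<le> variety_dim (2 * n) (total_tangent_space n Z1)"
      "hdim_le (total_tangent_space n Z1) (coords {..<2 * n}) t" by (elim exE conjE)
    from hdim_le_variety_dim[OF assms(2) False] obtain d where
      d: "enat d \<le> variety_dim n Z1" "hdim_le Z1 (coords {..<n}) d" by (elim exE conjE)
    have "enat (t + 1) \<le> max (2 * variety_dim n Z1 + 1) (variety_dim (2 * n) (total_tangent_space n Z1)) + 1"
    proof -
      have "enat (t + 1) = enat t + 1" by (simp add: one_enat_def)
      also have "\<dots> \<le> max (2 * variety_dim n Z1 + 1) (variety_dim (2 * n) (total_tangent_space n Z1)) + 1"
        using t(1) by (intro add_right_mono) (simp add: le_max_iff_disj)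
      finally show ?thesis .
    qed
    then have tn: "t + 1 \<le> n" using assms(4) by (metis enat_ord_simps(1) order_trans)
    have "enat (2 * d + 2) \<le> max (2 * variety_dim n Z1 + 1) (variety_dim (2 * n) (total_tangent_space n Z1)) + 1"
    proof -
      have "enat (2 * d + 2) = enat d + enat d + 1 + 1" by (simp add: one_enat_def)
      also have "\<dots> \<le> variety_dim n Z1 + variety_dim n Z1 + 1 + 1"
        by (intro add_mono d(1) order_refl)
      also have "\<dots> = (2 * variety_dim n Z1 + 1) + 1" by (simp add: mult_2)
      also have "\<dots> \<le> max (2 * variety_dim n Z1 + 1) (variety_dim (2 * n) (total_tangent_space n Z1)) + 1"
        by (intro add_right_mono) simp
      finally show ?thesis .
    qed
    then have dn: "2 * d + 2 \<le> n" using assms(4) by (metis enat_ord_simps(1) order_trans)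
    have "\<forall>i\<in>{..<n}. \<exists>p. p \<in> subalg (coords {..<n}) \<and> (\<forall>z\<in>Z1. g z i = p z)"
    proof
      fix i assume "i \<in> {..<n}"
      then have "regular_on n Z1 (\<lambda>z. g z i)" using fg(2) by (simp add: morphism_def)
      from regular_on_closed_imp_polynomial[OF assms(2) this]
      show "\<exists>p. p \<in> subalg (coords {..<n}) \<and> (\<forall>z\<in>Z1. g z i = p z)" by (simp add: Bex_def)
    qed
    from bchoice[OF this] obtain F where
      F: "\<forall>i\<in>{..<n}. F i \<in> subalg (coords {..<n}) \<and> (\<forall>z\<in>Z1. g z i = F i z)" ..
    have "\<forall>i\<in>{..<n}. \<exists>p. p \<in> subalg (coords {..<n}) \<and> (\<forall>z\<in>Z2. f z i = p z)"
    proof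
      fix i assume "i \<in> {..<n}"
      then have "regular_on n Z2 (\<lambda>z. f z i)" using fg(1) by (simp add: morphism_def)
      from regular_on_closed_imp_polynomial[OF assms(5) this]
      show "\<exists>p. p \<in> subalg (coords {..<n}) \<and> (\<forall>z\<in>Z2. f z i = p z)" by (simp add: Bex_def)
    qed
    from bchoice[OF this] obtain G where
      G: "\<forall>i\<in>{..<n}. G i \<in> subalg (coords {..<n}) \<and> (\<forall>z\<in>Z2. f z i = G i z)" ..
    have Fg: "(\<lambda>j. if j < n then F j z else 0) = g z" if z: "z \<in> Z1" for z
    proof
      fix j
      have "g z \<in> affine_space n" using closed_sub_affine[OF assms(5)] g_Z2[OF z] by blast
      then show "(if j < n then F j z else 0) = g z j"
        using F z by (auto simp: affine_space_def)
    qed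
    have "\<exists>\<Theta>. poly_bij n \<Theta> \<and> (\<forall>z\<in>Z1. \<Theta> z = (\<lambda>j. if j < n then F j z else 0))"
    proof (rule extend_isomorphism[OF assms(1,2) d(2) dn t(2) tn])
      show "F i \<in> subalg (coords {..<n})" "G i \<in> subalg (coords {..<n})" if "i < n" for i
        using F G that by simp_all
      show "G i (\<lambda>j. if j < n then F j z else 0) = z i" if i: "i < n" and z: "z \<in> Z1" for i z
      proof -
        have "G i (g z) = f (g z) i" using G i g_Z2[OF z] by simp
        then show ?thesis unfolding Fg[OF z] using fg(4) z by simp
      qed
    qed
    then show ?thesis by (simp add: Fg cong: ball_cong)
  qed
  then obtain \<Theta> where \<Theta>: "poly_bij n \<Theta>" "\<forall>z\<in>Z1. \<Theta> z = g z" by (elim exE conjE)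
  have \<Theta>Z: "\<Theta> ` Z1 = Z2"
  proof (intro equalityI subsetI)
    fix y assume "y \<in> Z2"
    then have "y = \<Theta> (f y)" using \<Theta>(2) f_Z1 fg(3) by simp
    then show "y \<in> \<Theta> ` Z1" using f_Z1[OF \<open>y \<in> Z2\<close>] by blast
  qed (use \<Theta>(2) g_Z2 in auto)
  obtain \<Lambda> where \<Lambda>: "\<forall>i<n. (\<lambda>x. \<Lambda> x i) \<in> subalg (coords {..<n})"
    "\<Lambda> ` affine_space n = affine_space n - Z1"
    using surjection_onto_complement[OF assms(1,2,3)] by (elim exE conjE)
  have "(\<lambda>x. \<Theta> (\<Lambda> x)) ` affine_space n = \<Theta> ` (affine_space n - Z1)"
    by (simp flip: \<Lambda>(2) image_image)
  also have "\<dots> = \<Theta> ` affine_space n - \<Theta> ` Z1"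
    using \<Theta>(1) closed_sub_affine[OF assms(2)]
    by (intro inj_on_image_set_diff[of _ "affine_space n"]) (auto simp: poly_bij_def bij_betw_def)
  also have "\<dots> = affine_space n - Z2"
    using \<Theta>(1) \<Theta>Z by (simp add: poly_bij_def bij_betw_def)
  finally have img: "(\<lambda>x. \<Theta> (\<Lambda> x)) ` affine_space n = affine_space n - Z2" .
  moreover have "morphism n (affine_space n) n (affine_space n - Z2) (\<lambda>x. \<Theta> (\<Lambda> x))"
    unfolding morphism_def
  proof (intro conjI allI impI)
    fix i assume "i < n"
    then have "(\<lambda>x. \<Theta> x i) \<in> subalg (coords {..<n})" using \<Theta>(1) by (simp add: poly_bij_def)
    then have "(\<lambda>x. \<Theta> (\<Lambda> x) i) \<in> subalg (coords {..<n})"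
      by (rule subalg_coords_subst) (use \<Lambda>(1) in simp)
    then show "regular_on n (affine_space n) (\<lambda>x. \<Theta> (\<Lambda> x) i)" by (rule regular_on_polynomial)
  qed (simp add: img)
  ultimately show ?thesis by (intro exI[of _ "\<lambda>x. \<Theta> (\<Lambda> x)"] conjI)
qed

end
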